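(* Let $\mathfrak g$ be a symmetrizable Kac-Moody algebra over $\mathbb Q$. The classical limit $B_{\mathrm{cl}}$ of the Kashiwara algebra of $\mathfrak g$ is a Sridharan algebra for the Lie algebra $\mathfrak a$: one has $B_{\mathrm{cl}}\cong U_c(\mathfrak a)$, where the $2$-cocycle $c:\mathfrak a\wedge\mathfrak a\to\mathbb Q$ is defined by $c(e_i,f_j)=\delta_{i,j}$, $c(e_i,e_j)=c(f_i,f_j)=c(h,e_i)=c(h,f_i)=c(h,h')=0$ for $i,j\in I$, $h,h'\in\mathfrak t$, together with the cocycle relations.
   Context: $\mathfrak g$ has Cartan subalgebra $\mathfrak t$, simple roots $\alpha_i\in\mathfrak t^*$, coroots $h_i\in\mathfrak t$ ($i\in I$ finite), Chevalley generators $e_i,f_i$, nilpotent parts $\mathfrak n_\pm$ and Borel parts $\mathfrak b_\pm=\mathfrak t\oplus\mathfrak n_\pm$. $\mathfrak a$ is the Lie subalgebra of $\mathfrak b_+\times\mathfrak b_-$ of pairs $(x_+,x_-)$ such that there is $h\in\mathfrak t$ with $x_+-h\in\mathfrak n_+$ and $x_--h\in\mathfrak n_-$. In $\mathfrak a$ one writes $e_i=(e_i,0)$, $f_i=(0,f_i)$ and $h=(h,h)$ for $h\in\mathfrak t$; these elements generate $\mathfrak a$. $B_{\mathrm{cl}}$ is the associative unital $\mathbb Q$-algebra generated by $e'_i,f_i$ ($i\in I$) and the (commuting) vector space $\mathfrak t$, with relations $[h,e'_i]=\langle\alpha_i,h\rangle e'_i$, $[h,f_j]=-\langle\alpha_j,h\rangle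 f_j$, $e'_if_j=f_je'_i+\delta_{i,j}$, and the Serre relations $\mathrm{ad}(X_i)^{1-\langle h_i,\alpha_j\rangle}(X_j)=0$ for $i\ne j$, $X=e'$ and $X=f$. A $2$-cocycle of a $\mathbb Q$-Lie algebra $\mathfrak a$ with values in $\mathbb Q$ is an alternating bilinear form $c$ with $c([x,y],z)+c([y,z],x)+c([z,x],y)=0$. The Sridharan algebra $U_c(\mathfrak a)$ is the quotient of the tensor algebra of $\mathfrak a$ by the two-sided ideal generated by $x\cdot y-y\cdot x-[x,y]-c(x,y)\cdot1$, $x,y\in\mathfrak a$. *)

theory Defs
  imports "HOL-Algebra.QuotRing" "HOL-Algebra.Module" "HOL-Library.Poly_Mapping"
    "HOL-Library.Product_Plus" Complex_Main
begin

section \<open>Associative unital algebras over the rationals\<close>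

text \<open>
  A $\mathbb Q$-algebra is represented by the \<^type>\<open>module\<close> record of \<^theory>\<open>HOL-Algebra.Module\<close>,
  which is a ring record together with a scalar multiplication.
\<close>

type_synonym 'a qalg = "(rat, 'a) module"

definition alg_isomorphic :: "'a qalg \<Rightarrow> 'b qalg \<Rightarrow> bool" (infix \<open>\<simeq>\<^sub>Q\<close> 50) where
  "A \<simeq>\<^sub>Q B \<longleftrightarrow>
    (\<exists>\<phi> \<in> ring_iso A B. \<forall>r. \<forall>x \<in> carrier A. \<phi> (r \<odot>\<^bsub>A\<^esub> x) = r \<odot>\<^bsub>B\<^esub> \<phi> x)"

text \<open>A two-sided ideal of a unital $\mathbb Q$-algebra is stable under scalars, so the quotient
  ring inherits a scalar multiplication.\<close>

definition quot_alg :: "'a qalg \<Rightarrow> 'a set \<Rightarrow> 'a set qalg" (infixl \<open>Quot\<^sub>Q\<close> 65) where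
  "A Quot\<^sub>Q I =
    \<lparr>carrier = carrier (A Quot I), mult = mult (A Quot I), one = one (A Quot I),
     zero = zero (A Quot I), add = add (A Quot I),
     smult = (\<lambda>r X. \<Union>x\<in>X. I +>\<^bsub>A\<^esub> (r \<odot>\<^bsub>A\<^esub> x))\<rparr>"

text \<open>Lists form the free monoid, so that the convolution product on finitely supported
  functions on lists is the product of the free associative algebra.\<close>

instantiation list :: (type) monoid_add
begin
definition zero_list :: "'a list" where "zero_list = []"
definition plus_list :: "'a list \<Rightarrow> 'a list \<Rightarrow> 'a list" where "plus_list = (@)"
instance by standard (simp_all add: zero_list_def plus_list_def)
end

definition qscale :: "rat \<Rightarrow> ('k \<Rightarrow>\<^sub>0 rat) \<Rightarrow> ('k \<Rightarrow>\<^sub>0 rat)" where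
  "qscale r = Poly_Mapping.map ((*) r)"

definition free_alg :: "'x set \<Rightarrow> ('x list \<Rightarrow>\<^sub>0 rat) qalg" where
  "free_alg S =
    \<lparr>carrier = {p. \<forall>w \<in> Poly_Mapping.keys p. set w \<subseteq> S},
     mult = (*), one = 1, zero = 0, add = (+), smult = qscale\<rparr>"

definition var :: "'x \<Rightarrow> ('x list \<Rightarrow>\<^sub>0 rat)" where
  "var x = Poly_Mapping.single [x] 1"

text \<open>The tensor algebra of a rational vector space \<open>V\<close> (a subspace of an ambient type with
  scalar multiplication \<open>sc\<close>) is the free algebra on the set \<open>V\<close> with the linear structure of \<open>V\<close>
  imposed on the free generators.\<close>

definition tensor_ideal ::
    "(rat \<Rightarrow> 'v \<Rightarrow> 'v) \<Rightarrow> 'v set \<Rightarrow> ('v::ab_group_add list \<Rightarrow>\<^sub>0 rat) set" where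
  "tensor_ideal sc V = Idl\<^bsub>free_alg V\<^esub>
     ({var (x + y) - var x - var y | x y. x \<in> V \<and> y \<in> V} \<union>
      {var (sc r x) - qscale r (var x) | r x. x \<in> V})"

definition tensor_algebra ::
    "(rat \<Rightarrow> 'v \<Rightarrow> 'v) \<Rightarrow> 'v set \<Rightarrow> ('v::ab_group_add list \<Rightarrow>\<^sub>0 rat) set qalg" where
  "tensor_algebra sc V = free_alg V Quot\<^sub>Q tensor_ideal sc V"

definition tensor_incl ::
    "(rat \<Rightarrow> 'v \<Rightarrow> 'v) \<Rightarrow> 'v set \<Rightarrow> 'v \<Rightarrow> ('v::ab_group_add list \<Rightarrow>\<^sub>0 rat) set" where
  "tensor_incl sc V x = tensor_ideal sc V +>\<^bsub>free_alg V\<^esub> var x"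


section \<open>Lie algebras, cocycles and Sridharan algebras\<close>

locale lie_algebra = vector_space sc
  for sc :: "rat \<Rightarrow> 'g::ab_group_add \<Rightarrow> 'g" +
  fixes br :: "'g \<Rightarrow> 'g \<Rightarrow> 'g"
  assumes br_add_left: "br (x + y) z = br x z + br y z"
    and br_add_right: "br x (y + z) = br x y + br x z"
    and br_scale_left: "br (sc r x) y = sc r (br x y)"
    and br_scale_right: "br x (sc r y) = sc r (br x y)"
    and br_self: "br x x = 0"
    and jacobi: "br x (br y z) + br y (br z x) + br z (br x y) = 0"

definition lie_subalgebra ::
    "(rat \<Rightarrow> 'g::ab_group_add \<Rightarrow> 'g) \<Rightarrow> ('g \<Rightarrow> 'g \<Rightarrow> 'g) \<Rightarrow> 'g set \<Rightarrow> bool" where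
  "lie_subalgebra sc br L \<longleftrightarrow>
    0 \<in> L \<and> (\<forall>x\<in>L. \<forall>y\<in>L. x + y \<in> L \<and> br x y \<in> L) \<and> (\<forall>r. \<forall>x\<in>L. sc r x \<in> L)"

definition lie_span ::
    "(rat \<Rightarrow> 'g::ab_group_add \<Rightarrow> 'g) \<Rightarrow> ('g \<Rightarrow> 'g \<Rightarrow> 'g) \<Rightarrow> 'g set \<Rightarrow> 'g set" where
  "lie_span sc br S = \<Inter>{L. lie_subalgebra sc br L \<and> S \<subseteq> L}"

definition two_cocycle ::
    "(rat \<Rightarrow> 'g::ab_group_add \<Rightarrow> 'g) \<Rightarrow> ('g \<Rightarrow> 'g \<Rightarrow> 'g) \<Rightarrow> 'g set \<Rightarrow> ('g \<Rightarrow> 'g \<Rightarrow> rat) \<Rightarrow> bool" where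
  "two_cocycle sc br L c \<longleftrightarrow>
    (\<forall>x\<in>L. \<forall>y\<in>L. \<forall>z\<in>L. c (x + y) z = c x z + c y z \<and> c x (y + z) = c x y + c x z) \<and>
    (\<forall>r. \<forall>x\<in>L. \<forall>y\<in>L. c (sc r x) y = r * c x y \<and> c x (sc r y) = r * c x y) \<and>
    (\<forall>x\<in>L. c x x = 0) \<and>
    (\<forall>x\<in>L. \<forall>y\<in>L. \<forall>z\<in>L. c (br x y) z + c (br y z) x + c (br z x) y = 0)"

definition sridharan_algebra ::
    "(rat \<Rightarrow> 'g::ab_group_add \<Rightarrow> 'g) \<Rightarrow> ('g \<Rightarrow> 'g \<Rightarrow> 'g) \<Rightarrow> 'g set \<Rightarrow> ('g \<Rightarrow> 'g \<Rightarrow> rat) \<Rightarrow>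
     ('g list \<Rightarrow>\<^sub>0 rat) set set qalg" where
  "sridharan_algebra sc br L c =
    (let T = tensor_algebra sc L; j = tensor_incl sc L in
     T Quot\<^sub>Q (Idl\<^bsub>T\<^esub>
       {j x \<otimes>\<^bsub>T\<^esub> j y \<ominus>\<^bsub>T\<^esub> j y \<otimes>\<^bsub>T\<^esub> j x \<ominus>\<^bsub>T\<^esub> j (br x y) \<ominus>\<^bsub>T\<^esub> c x y \<odot>\<^bsub>T\<^esub> \<one>\<^bsub>T\<^esub> | x y.
          x \<in> L \<and> y \<in> L}))"


section \<open>Lie algebras presented by generators and relations\<close>

text \<open>Finitely supported functions on the free magma, with the product extended bilinearly, form
  the free nonassociative algebra. The Lie algebra with given relations is its quotient by the ideal
  generated by the relations together with all squares and all Jacobi expressions.\<close>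

datatype 'x magma = Leaf 'x | Node "'x magma" "'x magma"

definition mvar :: "'x \<Rightarrow> ('x magma \<Rightarrow>\<^sub>0 rat)" where
  "mvar x = Poly_Mapping.single (Leaf x) 1"

definition mbr ::
    "('x magma \<Rightarrow>\<^sub>0 rat) \<Rightarrow> ('x magma \<Rightarrow>\<^sub>0 rat) \<Rightarrow> ('x magma \<Rightarrow>\<^sub>0 rat)" where
  "mbr p q = (\<Sum>s \<in> Poly_Mapping.keys p. \<Sum>t \<in> Poly_Mapping.keys q.
     Poly_Mapping.single (Node s t) (Poly_Mapping.lookup p s * Poly_Mapping.lookup q t))"

inductive_set lie_relation_ideal ::
    "('x magma \<Rightarrow>\<^sub>0 rat) set \<Rightarrow> ('x magma \<Rightarrow>\<^sub>0 rat) set"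
  for R :: "('x magma \<Rightarrow>\<^sub>0 rat) set" where
  relation: "p \<in> R \<Longrightarrow> p \<in> lie_relation_ideal R"
| square: "mbr p p \<in> lie_relation_ideal R"
| jacobi: "mbr p (mbr q r) + mbr q (mbr r p) + mbr r (mbr p q) \<in> lie_relation_ideal R"
| zero: "0 \<in> lie_relation_ideal R"
| add: "p \<in> lie_relation_ideal R \<Longrightarrow> q \<in> lie_relation_ideal R \<Longrightarrow> p + q \<in> lie_relation_ideal R"
| scale: "p \<in> lie_relation_ideal R \<Longrightarrow> qscale a p \<in> lie_relation_ideal R"
| left: "p \<in> lie_relation_ideal R \<Longrightarrow> mbr q p \<in> lie_relation_ideal R"
| right: "p \<in> lie_relation_ideal R \<Longrightarrow> mbr p q \<in> lie_relation_ideal R"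

primrec magma_eval :: "('g \<Rightarrow> 'g \<Rightarrow> 'g) \<Rightarrow> ('x \<Rightarrow> 'g) \<Rightarrow> 'x magma \<Rightarrow> 'g" where
  "magma_eval br v (Leaf x) = v x"
| "magma_eval br v (Node s t) = br (magma_eval br v s) (magma_eval br v t)"

definition lie_eval ::
    "(rat \<Rightarrow> 'g::ab_group_add \<Rightarrow> 'g) \<Rightarrow> ('g \<Rightarrow> 'g \<Rightarrow> 'g) \<Rightarrow> ('x \<Rightarrow> 'g) \<Rightarrow> ('x magma \<Rightarrow>\<^sub>0 rat) \<Rightarrow> 'g"
  where
  "lie_eval sc br v p =
     (\<Sum>s \<in> Poly_Mapping.keys p. sc (Poly_Mapping.lookup p s) (magma_eval br v s))"

text \<open>The canonical map from the free nonassociative algebra induces an isomorphism from the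
  presented Lie algebra.\<close>

definition lie_presented_by ::
    "(rat \<Rightarrow> 'g::ab_group_add \<Rightarrow> 'g) \<Rightarrow> ('g \<Rightarrow> 'g \<Rightarrow> 'g) \<Rightarrow> ('x \<Rightarrow> 'g) \<Rightarrow> ('x magma \<Rightarrow>\<^sub>0 rat) set \<Rightarrow> bool"
  where
  "lie_presented_by sc br v R \<longleftrightarrow>
     surj (lie_eval sc br v) \<and> {p. lie_eval sc br v p = 0} = lie_relation_ideal R"


section \<open>Symmetrizable Kac-Moody algebras\<close>

definition generalized_cartan_matrix :: "('i \<Rightarrow> 'i \<Rightarrow> int) \<Rightarrow> bool" where
  "generalized_cartan_matrix A \<longleftrightarrow>
     (\<forall>i. A i i = 2) \<and> (\<forall>i j. i \<noteq> j \<longrightarrow> A i j \<le> 0) \<and> (\<forall>i j. A i j = 0 \<longleftrightarrow> A j i = 0)"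

definition symmetrizable :: "('i \<Rightarrow> 'i \<Rightarrow> int) \<Rightarrow> bool" where
  "symmetrizable A \<longleftrightarrow>
     (\<exists>d :: 'i \<Rightarrow> rat. (\<forall>i. d i \<noteq> 0) \<and> (\<forall>i j. d i * of_int (A i j) = d j * of_int (A j i)))"

text \<open>The type \<open>'t\<close> is the Cartan subalgebra; \<open>\<alpha> j h\<close> is the pairing of the simple root \<open>\<alpha> j\<close> with
  \<open>h\<close>, and \<open>A i j\<close> is the pairing of the coroot \<open>hc i\<close> with \<open>\<alpha> j\<close>.\<close>

locale cartan_realization = vector_space sT
  for sT :: "rat \<Rightarrow> 't::ab_group_add \<Rightarrow> 't" +
  fixes A :: "'i::finite \<Rightarrow> 'i \<Rightarrow> int"
    and \<alpha> :: "'i \<Rightarrow> 't \<Rightarrow> rat"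
    and hc :: "'i \<Rightarrow> 't"
  assumes gcm: "generalized_cartan_matrix A"
    and finite_dim: "\<exists>B. finite B \<and> span B = UNIV"
    and roots_linear: "Vector_Spaces.linear sT (*) (\<alpha> i)"
    and roots_independent: "(\<forall>h. (\<Sum>i\<in>UNIV. u i * \<alpha> i h) = 0) \<Longrightarrow> u i = 0"
    and coroots_independent: "(\<Sum>i\<in>UNIV. sT (u i) (hc i)) = 0 \<Longrightarrow> u i = 0"
    and pairing: "\<alpha> j (hc i) = of_int (A i j)"

text \<open>Generators: \<open>GE i\<close> is $e_i$ (or $e'_i$ in the Kashiwara algebra), \<open>GF i\<close> is $f_i$, and \<open>GT h\<close>
  is the element \<open>h\<close> of the Cartan subalgebra.\<close>

datatype ('i, 't) gen = GE 'i | GF 'i | GT 't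

definition kac_moody_relations ::
    "(rat \<Rightarrow> 't::ab_group_add \<Rightarrow> 't) \<Rightarrow> ('i \<Rightarrow> 'i \<Rightarrow> int) \<Rightarrow> ('i \<Rightarrow> 't \<Rightarrow> rat) \<Rightarrow> ('i \<Rightarrow> 't) \<Rightarrow>
     (('i, 't) gen magma \<Rightarrow>\<^sub>0 rat) set" where
  "kac_moody_relations sT A \<alpha> hc =
     (let E = (\<lambda>i. mvar (GE i)); F = (\<lambda>i. mvar (GF i)); H = (\<lambda>h. mvar (GT h)) in
      {H (h + h') - H h - H h' | h h'. True} \<union>
      {H (sT r h) - qscale r (H h) | r h. True} \<union>
      {mbr (H h) (H h') | h h'. True} \<union>
      {mbr (H h) (E i) - qscale (\<alpha> i h) (E i) | h i. True} \<union>
      {mbr (H h) (F i) + qscale (\<alpha> i h) (F i) | h i. True} \<union>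
      {mbr (E i) (F j) - (if i = j then H (hc i) else 0) | i j. True} \<union>
      {(mbr (E i) ^^ nat (1 - A i j)) (E j) | i j. i \<noteq> j} \<union>
      {(mbr (F i) ^^ nat (1 - A i j)) (F j) | i j. i \<noteq> j})"

text \<open>\<open>\<iota>\<close> is the inclusion of the Cartan subalgebra. Since \<open>A\<close> is symmetrizable, the Lie algebra
  defined by the Serre relations is the Kac-Moody algebra of the realization (theorem of Gabber
  and Kac). The realization need not have the minimal dimension.\<close>

locale symmetrizable_kac_moody_algebra =
  cartan_realization sT A \<alpha> hc + Lie: lie_algebra sc br
  for sT :: "rat \<Rightarrow> 't::ab_group_add \<Rightarrow> 't"
    and A :: "'i::finite \<Rightarrow> 'i \<Rightarrow> int"
    and \<alpha> :: "'i \<Rightarrow> 't \<Rightarrow> rat"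
    and hc :: "'i \<Rightarrow> 't"
    and sc :: "rat \<Rightarrow> 'g::ab_group_add \<Rightarrow> 'g"
    and br :: "'g \<Rightarrow> 'g \<Rightarrow> 'g" +
  fixes e f :: "'i \<Rightarrow> 'g"
    and \<iota> :: "'t \<Rightarrow> 'g"
  assumes symmetrizable: "symmetrizable A"
    and presented: "lie_presented_by sc br (case_gen e f \<iota>) (kac_moody_relations sT A \<alpha> hc)"


section \<open>The Lie algebra of pairs and the classical Kashiwara algebra\<close>

definition prod_scale :: "(rat \<Rightarrow> 'g \<Rightarrow> 'g) \<Rightarrow> rat \<Rightarrow> 'g \<times> 'g \<Rightarrow> 'g \<times> 'g" where
  "prod_scale sc r = map_prod (sc r) (sc r)"

definition prod_br :: "('g \<Rightarrow> 'g \<Rightarrow> 'g) \<Rightarrow> 'g \<times> 'g \<Rightarrow> 'g \<times> 'g \<Rightarrow> 'g \<times> 'g" where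
  "prod_br br x y = (br (fst x) (fst y), br (snd x) (snd y))"

definition nilpotent_part ::
    "(rat \<Rightarrow> 'g::ab_group_add \<Rightarrow> 'g) \<Rightarrow> ('g \<Rightarrow> 'g \<Rightarrow> 'g) \<Rightarrow> ('i \<Rightarrow> 'g) \<Rightarrow> 'g set" where
  "nilpotent_part sc br e = lie_span sc br (range e)"

definition borel_part ::
    "(rat \<Rightarrow> 'g::ab_group_add \<Rightarrow> 'g) \<Rightarrow> ('g \<Rightarrow> 'g \<Rightarrow> 'g) \<Rightarrow> ('i \<Rightarrow> 'g) \<Rightarrow> ('t \<Rightarrow> 'g) \<Rightarrow> 'g set" where
  "borel_part sc br e \<iota> = {\<iota> h + n | h n. n \<in> nilpotent_part sc br e}"

definition pair_algebra ::
    "(rat \<Rightarrow> 'g::ab_group_add \<Rightarrow> 'g) \<Rightarrow> ('g \<Rightarrow> 'g \<Rightarrow> 'g) \<Rightarrow> ('i \<Rightarrow> 'g) \<Rightarrow> ('i \<Rightarrow> 'g) \<Rightarrow> ('t \<Rightarrow> 'g) \<Rightarrow>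
     ('g \<times> 'g) set" where
  "pair_algebra sc br e f \<iota> =
     {(x, y). x \<in> borel_part sc br e \<iota> \<and> y \<in> borel_part sc br f \<iota> \<and>
        (\<exists>h. x - \<iota> h \<in> nilpotent_part sc br e \<and> y - \<iota> h \<in> nilpotent_part sc br f)}"

text \<open>The values of the cocycle on the generators $(e_i,0)$, $(0,f_i)$ and $(h,h)$. A
  cocycle with these values is unique only up to a coboundary: if a linear form \<open>\<phi>\<close> is zero on all
  generators and on their brackets, then adding \<open>\<phi>([x, y])\<close> does not change them.\<close>

definition kashiwara_values ::
    "('i \<Rightarrow> 'g::zero) \<Rightarrow> ('i \<Rightarrow> 'g) \<Rightarrow> ('t \<Rightarrow> 'g) \<Rightarrow> ('g \<times> 'g \<Rightarrow> 'g \<times> 'g \<Rightarrow> rat) \<Rightarrow> bool" where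
  "kashiwara_values e f \<iota> c \<longleftrightarrow>
     (let E = (\<lambda>i. (e i, 0)); F = (\<lambda>i. (0, f i)); H = (\<lambda>h. (\<iota> h, \<iota> h)) in
      (\<forall>i j. c (E i) (F j) = (if i = j then 1 else 0)) \<and>
      (\<forall>i j. c (E i) (E j) = 0) \<and>
      (\<forall>i j. c (F i) (F j) = 0) \<and>
      (\<forall>h i. c (H h) (E i) = 0) \<and>
      (\<forall>h i. c (H h) (F i) = 0) \<and>
      (\<forall>h h'. c (H h) (H h') = 0))"

definition comm :: "'r::ring_1 \<Rightarrow> 'r \<Rightarrow> 'r" where
  "comm x y = x * y - y * x"

definition kashiwara_cl_relations ::
    "(rat \<Rightarrow> 't::ab_group_add \<Rightarrow> 't) \<Rightarrow> ('i \<Rightarrow> 'i \<Rightarrow> int) \<Rightarrow> ('i \<Rightarrow> 't \<Rightarrow> rat) \<Rightarrow>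
     (('i, 't) gen list \<Rightarrow>\<^sub>0 rat) set" where
  "kashiwara_cl_relations sT A \<alpha> =
     (let E = (\<lambda>i. var (GE i)); F = (\<lambda>i. var (GF i)); H = (\<lambda>h. var (GT h)) in
      {H (h + h') - H h - H h' | h h'. True} \<union>
      {H (sT r h) - qscale r (H h) | r h. True} \<union>
      {comm (H h) (H h') | h h'. True} \<union>
      {comm (H h) (E i) - qscale (\<alpha> i h) (E i) | h i. True} \<union>
      {comm (H h) (F j) + qscale (\<alpha> j h) (F j) | h j. True} \<union>
      {E i * F j - F j * E i - (if i = j then 1 else 0) | i j. True} \<union>
      {(comm (E i) ^^ nat (1 - A i j)) (E j) | i j. i \<noteq> j} \<union>
      {(comm (F i) ^^ nat (1 - A i j)) (F j) | i j. i \<noteq> j})"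

definition kashiwara_cl ::
    "(rat \<Rightarrow> 't::ab_group_add \<Rightarrow> 't) \<Rightarrow> ('i \<Rightarrow> 'i \<Rightarrow> int) \<Rightarrow> ('i \<Rightarrow> 't \<Rightarrow> rat) \<Rightarrow>
     (('i, 't) gen list \<Rightarrow>\<^sub>0 rat) set qalg" where
  "kashiwara_cl sT A \<alpha> =
     free_alg UNIV Quot\<^sub>Q (Idl\<^bsub>free_alg UNIV\<^esub> (kashiwara_cl_relations sT A \<alpha>))"

end

theory Submission
  imports Defs
begin

text \<open>
  Both algebras are quotients of free algebras, and the isomorphism is induced by two maps between
  these: \<open>to_pairs\<close> sends the letters \<open>e'\<^sub>i\<close>, \<open>f\<^sub>i\<close>, \<open>h\<close> to \<open>(e\<^sub>i, 0)\<close>, \<open>(0, f\<^sub>i)\<close>, \<open>(h, h)\<close>, and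
  \<open>from_pairs\<close> sends an element of the Lie algebra of pairs to a chosen lift of it. Two things have to
  be shown: the relations of the Kashiwara algebra hold in the Sridharan algebra, and the Lie algebra
  of pairs lifts, with bracket deformed by the cocycle, to the Kashiwara algebra.

  For the first, a bracket in the Sridharan algebra differs from the bracket of the Lie algebra by
  the scalar \<open>c(x, y)\<close>, so the only doubtful relations are those of Serre. Choose a \<open>\<rho>\<close> in the Cartan
  subalgebra on which every simple root is 1. The cocycle identity gives
  \<open>c(\<rho>, [x, y]) = \<plusminus>k c(x, y)\<close> for homogeneous \<open>x\<close> and \<open>y\<close> of total height \<open>k\<close> in
  one of the nilpotent parts; hence \<open>c(x, y) = 0\<close> whenever \<open>[x, y] = 0\<close>, and no scalar is left over in a Serre relation.

  For the second, the nilpotent parts must be presented by the Serre relations alone and meet the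
  Cartan subalgebra in 0, although only \<open>\<gg>\<close> as a whole is given by generators and relations. This is read
  off from Verma modules. On the free algebra in letters \<open>i\<close> let \<open>f\<^sub>i\<close> act by left multiplication,
  \<open>h\<close> diagonally and \<open>e\<^sub>i\<close> by the operators, shortening words, that the commutation rules dictate. Since a
  Serre element commutes with every opposite generator (\<open>serre_commutes\<close>), the Serre ideal is
  stable and \<open>\<gg>\<close> acts on the quotient (\<open>acts_lie_relation_ideal\<close>). A Lie polynomial in the
  \<open>f\<^sub>i\<close> that vanishes in \<open>\<gg>\<close> acts by zero, but it acts by left multiplication with its own value in
  the free algebra, so this value lies in the Serre ideal (\<open>creation_lie_polynomial\<close>). The
  coefficient of the empty word separates the Cartan subalgebra from the nilpotent parts. The
  coefficients of one-letter words, which the Serre ideal does not touch, are linear forms that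
  pick out the components along the \<open>f\<^sub>i\<close>; with the roles of \<open>e\<close> and \<open>f\<close> exchanged one gets the
  components along the \<open>e\<^sub>i\<close>, and their products form a cocycle with the required values.

  The required values determine a cocycle only up to a coboundary, which the lift has to absorb.
  An iterated bracket \<open>x\<close> of generators in one nilpotent part, of height \<open>k\<close>, is lifted to the same iterated commutator
  of letters minus the scalar \<open>\<plusminus>c(\<rho>, x) / k\<close>. All lifts together form the set
  \<open>\<Gamma>\<close> of pairs of an element and a lift of it; it is closed under brackets (\<open>\<Gamma>_bracket\<close>), reaches every
  element (\<open>\<Gamma>_total\<close>) and contains over 0 only members of the Kashiwara ideal (\<open>\<Gamma>_zero\<close>).
\<close>

section \<open>Linear extension of functions on a basis\<close>

lemma lookup_qscale [simp]: "Poly_Mapping.lookup (qscale r p) k = r * Poly_Mapping.lookup p k"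
  by (cases "Poly_Mapping.lookup p k = 0") (simp_all add: qscale_def Poly_Mapping.map.rep_eq)

interpretation Q: vector_space "qscale :: rat \<Rightarrow> ('k \<Rightarrow>\<^sub>0 rat) \<Rightarrow> ('k \<Rightarrow>\<^sub>0 rat)"
  by unfold_locales (auto intro!: poly_mapping_eqI simp: lookup_add algebra_simps)

lemma qscale_single [simp]: "qscale r (Poly_Mapping.single k c) = Poly_Mapping.single k (r * c)"
  by (rule poly_mapping_eqI) (simp add: lookup_single when_def)

lemma qscale_mult_left: "qscale r p * q = qscale r (p * q)"
  for p q :: "'k::monoid_add \<Rightarrow>\<^sub>0 rat"
  by (simp add: qscale_def mult_map_scale_conv_mult mult.assoc)

lemma poly_mapping_linear_induct [case_names zero single add]:
  fixes p :: "'k \<Rightarrow>\<^sub>0 'b::comm_monoid_add"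
  assumes "P 0"
    and "\<And>k c. k \<in> Poly_Mapping.keys p \<Longrightarrow> P (Poly_Mapping.single k c)"
    and "\<And>p q. P p \<Longrightarrow> P q \<Longrightarrow> P (p + q)"
  shows "P p"
proof -
  have "P (\<Sum>k\<in>K. Poly_Mapping.single k (Poly_Mapping.lookup p k))"
    if "finite K" "K \<subseteq> Poly_Mapping.keys p" for K
    using that by (induction K rule: finite_induct) (auto intro: assms)
  moreover have "p = (\<Sum>k\<in>Poly_Mapping.keys p. Poly_Mapping.single k (Poly_Mapping.lookup p k))"
    by (rule poly_mapping_eqI)
       (auto simp: lookup_sum lookup_single when_def sum.delta in_keys_iff)
  ultimately show ?thesis
    by (metis finite_keys subset_refl)
qed

lemma qscale_mult_right: "p * qscale r q = qscale r (p * q)"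
  for p q :: "'k::monoid_add \<Rightarrow>\<^sub>0 rat"
proof (induction p rule: poly_mapping_linear_induct)
  case (single w c)
  show ?case
    by (induction q rule: poly_mapping_linear_induct)
       (simp_all add: mult_single Q.scale_right_distrib distrib_left mult.left_commute)
qed (simp_all add: Q.scale_right_distrib distrib_right)

definition lin_ext :: "(rat \<Rightarrow> 'v \<Rightarrow> 'v) \<Rightarrow> ('k \<Rightarrow> 'v) \<Rightarrow> ('k \<Rightarrow>\<^sub>0 rat) \<Rightarrow> 'v::comm_monoid_add" where
  "lin_ext sc g p = (\<Sum>k\<in>Poly_Mapping.keys p. sc (Poly_Mapping.lookup p k) (g k))"

lemma lie_eval_eq_lin: "lie_eval sc br v = lin_ext sc (magma_eval br v)"
  by (rule ext) (simp add: lie_eval_def lin_ext_def)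

locale rat_vector_space = vector_space sc for sc :: "rat \<Rightarrow> 'v::ab_group_add \<Rightarrow> 'v"
begin

lemma lin_superset:
  assumes "finite K" "Poly_Mapping.keys p \<subseteq> K"
  shows "lin_ext sc g p = (\<Sum>k\<in>K. sc (Poly_Mapping.lookup p k) (g k))"
  unfolding lin_ext_def using assms
  by (intro sum.mono_neutral_left) (auto simp: in_keys_iff)

lemma lin_zero [simp]: "lin_ext sc g 0 = 0"
  by (simp add: lin_ext_def)

lemma lin_add: "lin_ext sc g (p + q) = lin_ext sc g p + lin_ext sc g q"
proof -
  let ?K = "Poly_Mapping.keys p \<union> Poly_Mapping.keys q"
  have *: "finite ?K" "Poly_Mapping.keys p \<subseteq> ?K" "Poly_Mapping.keys q \<subseteq> ?K"
    "Poly_Mapping.keys (p + q) \<subseteq> ?K"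
    using keys_add[of p q] by auto
  show ?thesis
    unfolding *(1)[THEN lin_superset, OF *(2)] *(1)[THEN lin_superset, OF *(3)]
      *(1)[THEN lin_superset, OF *(4)]
    by (simp add: lookup_add scale_left_distrib sum.distrib)
qed

lemma lin_single [simp]: "lin_ext sc g (Poly_Mapping.single k c) = sc c (g k)"
  by (cases "c = 0") (simp_all add: lin_ext_def)

lemma lin_qscale: "lin_ext sc g (qscale r p) = sc r (lin_ext sc g p)"
proof -
  have "Poly_Mapping.keys (qscale r p) \<subseteq> Poly_Mapping.keys p"
    by (auto simp: in_keys_iff)
  from lin_superset[OF _ this] show ?thesis
    by (simp add: lin_ext_def scale_sum_right)
qed

lemma lin_uminus: "lin_ext sc g (- p) = - lin_ext sc g p"
  using lin_add[of g p "- p"] by (simp add: eq_neg_iff_add_eq_0 add.commute)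

lemma lin_diff: "lin_ext sc g (p - q) = lin_ext sc g p - lin_ext sc g q"
  using lin_add[of g p "- q"] by (simp add: lin_uminus)

lemma lin_sum: "lin_ext sc g (sum P X) = (\<Sum>x\<in>X. lin_ext sc g (P x))"
  by (induction X rule: infinite_finite_induct) (simp_all add: lin_add)

lemma lin_cong_minus: "lin_ext sc (\<lambda>k. g k - g' k) p = lin_ext sc g p - lin_ext sc g' p"
  by (simp add: lin_ext_def scale_right_diff_distrib sum_subtractf)

lemma lin_compose:
  assumes "\<phi> 0 = 0" "\<And>x y. \<phi> (x + y) = \<phi> x + \<phi> y" "\<And>r x. \<phi> (s r x) = sc r (\<phi> x)"
  shows "\<phi> (lin_ext s g p) = lin_ext sc (\<phi> \<circ> g) p"
proof -
  have "\<phi> (\<Sum>k\<in>K. s (Poly_Mapping.lookup p k) (g k)) =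
      (\<Sum>k\<in>K. sc (Poly_Mapping.lookup p k) (\<phi> (g k)))" for K
    by (induction K rule: infinite_finite_induct) (simp_all add: assms)
  then show ?thesis by (simp add: lin_ext_def)
qed

end


interpretation Q: rat_vector_space "qscale :: rat \<Rightarrow> ('k \<Rightarrow>\<^sub>0 rat) \<Rightarrow> ('k \<Rightarrow>\<^sub>0 rat)"
  by unfold_locales


section \<open>Rational algebras and evaluation of noncommutative polynomials\<close>

locale rat_algebra = rat_vector_space s for s :: "rat \<Rightarrow> 'r::ring_1 \<Rightarrow> 'r" +
  assumes scale_mult_left: "s r x * y = s r (x * y)"
    and scale_mult_right: "x * s r y = s r (x * y)"
begin

lemma lie_algebra_comm: "lie_algebra s comm"
  by unfold_locales
     (simp_all add: comm_def scale_mult_left scale_mult_right algebra_simps scale_right_diff_distrib)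

sublocale Comm: lie_algebra s comm
  by (rule lie_algebra_comm)

end

interpretation Q: rat_algebra "qscale :: rat \<Rightarrow> ('k::monoid_add \<Rightarrow>\<^sub>0 rat) \<Rightarrow> ('k \<Rightarrow>\<^sub>0 rat)"
  by unfold_locales (simp_all add: qscale_mult_left qscale_mult_right)

definition ev :: "(rat \<Rightarrow> 'r \<Rightarrow> 'r) \<Rightarrow> ('x \<Rightarrow> 'r) \<Rightarrow> ('x list \<Rightarrow>\<^sub>0 rat) \<Rightarrow> 'r::ring_1" where
  "ev s v p = lin_ext s (\<lambda>w. prod_list (map v w)) p"

context rat_algebra
begin

lemma ev_add: "ev s v (p + q) = ev s v p + ev s v q"
  and ev_zero [simp]: "ev s v 0 = 0"
  and ev_diff: "ev s v (p - q) = ev s v p - ev s v q"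
  and ev_qscale: "ev s v (qscale r p) = s r (ev s v p)"
  and ev_single: "ev s v (Poly_Mapping.single w c) = s c (prod_list (map v w))"
  by (simp_all add: ev_def lin_add lin_diff lin_qscale)

lemma ev_var [simp]: "ev s v (var x) = v x"
  by (simp add: var_def ev_single)

lemma ev_one [simp]: "ev s v 1 = 1"
  by (simp add: ev_single zero_list_def flip: single_one)

lemma ev_mult: "ev s v (p * q) = ev s v p * ev s v q"
proof (induction p rule: poly_mapping_linear_induct)
  case (single w c)
  show ?case
  proof (induction q rule: poly_mapping_linear_induct)
    case (single w' c')
    then show ?case
      by (simp add: mult_single ev_single plus_list_def scale_mult_left scale_mult_right mult_ac)
  qed (simp_all add: ev_add algebra_simps)
qed (simp_all add: ev_add algebra_simps)

lemma ev_comm: "ev s v (comm p q) = comm (ev s v p) (ev s v q)"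
  by (simp add: comm_def ev_diff ev_mult)

lemma ev_magma: "ev s v (magma_eval comm u m) = magma_eval comm (ev s v \<circ> u) m"
  by (induction m) (simp_all add: ev_comm)

end

lemma single_Cons: "Poly_Mapping.single (x # w) (c::rat) = var x * Poly_Mapping.single w c"
  by (simp add: var_def mult_single plus_list_def)

lemma free_algebra_induct [case_names one var add mult scale]:
  fixes p :: "'x list \<Rightarrow>\<^sub>0 rat"
  assumes "\<forall>w\<in>Poly_Mapping.keys p. set w \<subseteq> S"
    and "P 1" "\<And>x. x \<in> S \<Longrightarrow> P (var x)" "\<And>p q. P p \<Longrightarrow> P q \<Longrightarrow> P (p + q)"
    "\<And>p q. P p \<Longrightarrow> P q \<Longrightarrow> P (p * q)" "\<And>r p. P p \<Longrightarrow> P (qscale r p)"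
  shows "P p"
proof (induction p rule: poly_mapping_linear_induct)
  case zero
  show ?case using assms(6)[OF assms(2), of 0] by simp
next
  case (single w c)
  have "P (Poly_Mapping.single w 1)" if "set w \<subseteq> S" for w
    using that
    by (induction w) (simp_all add: assms single_Cons flip: zero_list_def)
  then have "P (qscale c (Poly_Mapping.single w 1))"
    using single assms(1) by (intro assms(6)) auto
  then show ?case by simp
qed (rule assms)

section \<open>Bilinear evaluation in Lie algebras\<close>

sublocale lie_algebra \<subseteq> rat_vector_space sc
  by unfold_locales

context lie_algebra
begin

lemma br_zero_left [simp]: "br 0 y = 0"
  and br_zero_right [simp]: "br x 0 = 0"
  using br_add_left[of 0 0 y] br_add_right[of x 0 0] by simp_all

lemma br_minus_left: "br (- x) y = - br x y"
  using br_add_left[of x "-x" y] by (simp add: eq_neg_iff_add_eq_0 add.commute)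

lemma br_minus_right: "br x (- y) = - br x y"
  using br_add_right[of x y "-y"] by (simp add: eq_neg_iff_add_eq_0 add.commute)

lemma br_diff_left: "br (x - z) y = br x y - br z y"
  using br_add_left[of x "-z" y] by (simp add: br_minus_left)

lemma br_diff_right: "br x (y - z) = br x y - br x z"
  using br_add_right[of x y "-z"] by (simp add: br_minus_right)

lemma br_skew: "br x y = - br y x"
proof -
  have "br (x + y) (x + y) = br x y + br y x"
    unfolding br_add_left br_add_right by (simp add: br_self)
  then show ?thesis by (simp add: br_self eq_neg_iff_add_eq_0)
qed

lemma br_derivation: "br x (br y z) = br (br x y) z + br y (br x z)"
proof -
  have "br y (br z x) = - br y (br x z)" "br z (br x y) = - br (br x y) z"
    by (metis br_minus_right br_skew) (metis br_skew)
  with jacobi[of x y z] show ?thesis by (simp add: algebra_simps)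
qed

lemma br_sum_left: "br (sum g X) y = (\<Sum>x\<in>X. br (g x) y)"
  by (induction X rule: infinite_finite_induct) (simp_all add: br_add_left)

lemma br_sum_right: "br y (sum g X) = (\<Sum>x\<in>X. br y (g x))"
  by (induction X rule: infinite_finite_induct) (simp_all add: br_add_right)

lemma lie_eval_mbr: "lie_eval sc br v (mbr p q) = br (lie_eval sc br v p) (lie_eval sc br v q)"
  by (simp add: mbr_def lie_eval_eq_lin lin_sum)
     (simp add: lin_ext_def br_sum_left br_sum_right br_scale_left br_scale_right scale_sum_right
       sum.swap[of _ "Poly_Mapping.keys q"] mult.commute)

lemma lie_eval_mvar [simp]: "lie_eval sc br v (mvar x) = v x"
  by (simp add: lie_eval_eq_lin mvar_def)

lemmas lie_eval_add = lin_add[of "magma_eval br v" for v, folded lie_eval_eq_lin]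
lemmas lie_eval_diff = lin_diff[of "magma_eval br v" for v, folded lie_eval_eq_lin]
lemmas lie_eval_qscale = lin_qscale[of "magma_eval br v" for v, folded lie_eval_eq_lin]
lemmas lie_eval_zero = lin_zero[of "magma_eval br v" for v, folded lie_eval_eq_lin]

lemma lie_eval_funpow:
  "lie_eval sc br v ((mbr p ^^ n) q) = (br (lie_eval sc br v p) ^^ n) (lie_eval sc br v q)"
  by (induction n) (simp_all add: lie_eval_mbr)

lemma lie_subalgebra_range_lie_eval: "lie_subalgebra sc br (range (lie_eval sc br v))"
  unfolding lie_subalgebra_def
  by (auto simp flip: lie_eval_zero[of v] lie_eval_add lie_eval_mbr lie_eval_qscale)

end

lemma lie_span_least: "lie_subalgebra sc br L \<Longrightarrow> S \<subseteq> L \<Longrightarrow> lie_span sc br S \<subseteq> L"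
  by (auto simp: lie_span_def)

lemma lie_subalgebra_lie_span: "lie_subalgebra sc br (lie_span sc br S)"
  by (auto simp: lie_span_def lie_subalgebra_def)

lemma lie_span_superset: "S \<subseteq> lie_span sc br S"
  by (auto simp: lie_span_def)

lemma lie_algebra_prod:
  assumes "lie_algebra sc br"
  shows "lie_algebra (prod_scale sc) (prod_br br)"
proof -
  interpret lie_algebra sc br by (rule assms)
  show ?thesis
    by unfold_locales
       (auto simp: prod_scale_def prod_br_def map_prod_def case_prod_unfold plus_prod_def zero_prod_def
         br_add_left br_add_right br_scale_left br_scale_right br_self jacobi[simplified add.assoc] algebra_simps
         scale_right_distrib scale_left_distrib)
qed


section \<open>Serre elements commute with opposite generators\<close>

context lie_algebra
begin

lemma ad_string_weight:
  assumes "br h f = sc a f" "br h y = sc b y"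
  shows "br h ((br f ^^ n) y) = sc (of_nat n * a + b) ((br f ^^ n) y)"
proof (induction n)
  case (Suc n)
  have "br h (br f ((br f ^^ n) y)) = br (br h f) ((br f ^^ n) y) + br f (br h ((br f ^^ n) y))"
    by (rule br_derivation)
  also have "\<dots> = sc (a + (of_nat n * a + b)) (br f ((br f ^^ n) y))"
    unfolding Suc.IH assms br_scale_left br_scale_right by (rule scale_left_distrib[symmetric])
  finally show ?case
    by (simp add: distrib_right add.assoc)
qed (simp add: assms)

lemma sl2_string:
  assumes "br h f = sc (- 2) f" "br h y = sc (- a) y" "br e f = h" "br e y = 0"
  shows "br e ((br f ^^ n) y) = sc (of_nat n * (1 - a - of_nat n)) ((br f ^^ (n - 1)) y)"
proof (induction n)
  case (Suc n)
  let ?z = "(br f ^^ n) y"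
  have "br e (br f ?z) = br h ?z + br f (br e ?z)"
    using br_derivation[of e f ?z] by (simp add: assms)
  also have "br h ?z = sc (of_nat n * (- 2) + (- a)) ?z"
    by (rule ad_string_weight) (fact assms)+
  also have "br f (br e ?z) = sc (of_nat n * (1 - a - of_nat n)) ?z"
    unfolding Suc.IH br_scale_right by (cases n) simp_all
  also have "sc (of_nat n * (- 2) + (- a)) ?z + sc (of_nat n * (1 - a - of_nat n)) ?z =
      sc ((of_nat n * (- 2) + (- a)) + of_nat n * (1 - a - of_nat n)) ?z"
    by (rule scale_left_distrib[symmetric])
  also have "(of_nat n * (- 2) + (- a)) + of_nat n * (1 - a - of_nat n) =
      (of_nat (Suc n) * (1 - a - of_nat (Suc n)) :: rat)"
    by (simp add: algebra_simps)
  finally show ?case by simp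
qed (simp add: assms)

text \<open>
  Three cases. For \<open>k = i\<close> this is the theory of \<open>sl\<^sub>2\<close>-strings: the scalar in \<open>sl2_string\<close> has the
  factor \<open>1 - A i j - n\<close>, which vanishes at \<open>n = 1 - A i j\<close>. For \<open>k = j\<close> the bracket is the same power of
  \<open>ad (f i)\<close> applied to \<open>h j\<close>; the first step gives a multiple of \<open>f i\<close>, the second gives 0, and if
  there is only one step then \<open>A i j = 0 = A j i\<close>. For other \<open>k\<close> everything commutes.\<close>

lemma serre_commutes:
  assumes A: "generalized_cartan_matrix A" and ij: "i \<noteq> j"
    and ef: "\<And>i j. br (e i) (f j) = (if i = j then h i else 0)"
    and hf: "\<And>i j. br (h i) (f j) = sc (- of_int (A i j)) (f j)"
  shows "br (e k) ((br (f i) ^^ nat (1 - A i j)) (f j)) = 0"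
proof (cases "k = i")
  case True
  define n where "n = nat (1 - A i j)"
  have "A i j \<le> 0" using A ij by (auto simp: generalized_cartan_matrix_def)
  then have n: "(of_nat n :: rat) = 1 - of_int (A i j)"
    unfolding n_def by (simp add: of_nat_nat)
  have "br (e i) ((br (f i) ^^ n) (f j)) =
      sc (of_nat n * (1 - of_int (A i j) - of_nat n)) ((br (f i) ^^ (n - 1)) (f j))"
    by (rule sl2_string[where h = "h i"])
       (use A ij in \<open>auto simp: ef hf generalized_cartan_matrix_def\<close>)
  then show ?thesis by (simp add: n True flip: n_def)
next
  case False
  have comm_f: "br (e k) ((br (f i) ^^ n) y) = (br (f i) ^^ n) (br (e k) y)" for n y
  proof (induction n)
    case (Suc n)
    then show ?case
      using br_derivation[of "e k" "f i"] by (simp add: ef False)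
  qed simp
  have zero: "(br (f i) ^^ n) 0 = 0" for n
    by (induction n) simp_all
  show ?thesis
  proof (cases "k = j")
    case True
    have fh: "br (f i) (h j) = sc (of_int (A j i)) (f i)"
      using br_skew[of "f i" "h j"] by (simp add: hf)
    have Aij: "A i j \<le> 0" and sym: "A i j = 0 \<longleftrightarrow> A j i = 0"
      using A ij by (auto simp: generalized_cartan_matrix_def)
    have "(br (f i) ^^ nat (1 - A i j)) (h j) = 0"
    proof (cases "A i j = 0")
      case True
      then show ?thesis using sym by (simp add: fh)
    next
      case False
      then have "nat (1 - A i j) = nat (- A i j - 1) + 2"
        using Aij by simp
      then have "(br (f i) ^^ nat (1 - A i j)) (h j) =
          (br (f i) ^^ nat (- A i j - 1)) (br (f i) (br (f i) (h j)))"
        by (simp add: funpow_add numeral_2_eq_2 funpow_swap1)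
      then show ?thesis
        by (simp add: fh br_scale_right br_self zero)
    qed
    then show ?thesis using comm_f True by (simp add: ef)
  next
    case False
    then show ?thesis using comm_f by (simp add: ef zero)
  qed
qed

end


section \<open>Linear endomorphisms of the free algebra\<close>

text \<open>
  A type of its own makes the endomorphisms an instance of \<^class>\<open>ring_1\<close>, so that Lie
  polynomials can be evaluated in them with \<^const>\<open>comm\<close> as the bracket.\<close>

typedef 'k endo = "{\<phi> :: ('k \<Rightarrow>\<^sub>0 rat) \<Rightarrow> ('k \<Rightarrow>\<^sub>0 rat).
    (\<forall>p q. \<phi> (p + q) = \<phi> p + \<phi> q) \<and> (\<forall>r p. \<phi> (qscale r p) = qscale r (\<phi> p))}"
  morphisms app Abs_endo
  by (rule exI[of _ "\<lambda>p. p"]) simp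

setup_lifting type_definition_endo

lemma app_add: "app X (p + q) = app X p + app X q"
  and app_qscale: "app X (qscale r p) = qscale r (app X p)"
  using app[of X] by auto

lemma app_zero [simp]: "app X 0 = 0"
  using app_qscale[of X 0 0] by simp

lemma app_uminus: "app X (- p) = - app X p"
  using app_qscale[of X "-1" p] by simp

instantiation endo :: (type) ring_1
begin

lift_definition zero_endo :: "'k endo" is "\<lambda>p. 0" by simp
lift_definition one_endo :: "'k endo" is "\<lambda>p. p" by simp
lift_definition plus_endo :: "'k endo \<Rightarrow> 'k endo \<Rightarrow> 'k endo" is "\<lambda>\<phi> \<psi> p. \<phi> p + \<psi> p"
  by (simp add: Q.scale_right_distrib)
lift_definition minus_endo :: "'k endo \<Rightarrow> 'k endo \<Rightarrow> 'k endo" is "\<lambda>\<phi> \<psi> p. \<phi> p - \<psi> p"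
  by (simp add: Q.scale_right_diff_distrib)
lift_definition uminus_endo :: "'k endo \<Rightarrow> 'k endo" is "\<lambda>\<phi> p. - \<phi> p"
  by simp
lift_definition times_endo :: "'k endo \<Rightarrow> 'k endo \<Rightarrow> 'k endo" is "\<lambda>\<phi> \<psi> p. \<phi> (\<psi> p)"
  by simp

instance
proof
  have "app (0 :: 'k endo) (Poly_Mapping.single undefined 1) \<noteq> app 1 (Poly_Mapping.single undefined 1)"
    by (simp add: zero_endo.rep_eq one_endo.rep_eq)
       (metis lookup_single_eq lookup_zero zero_neq_one)
  then show "(0 :: 'k endo) \<noteq> 1" by metis
qed (transfer; simp add: fun_eq_iff algebra_simps)+

end

lemmas app_simps [simp] = zero_endo.rep_eq one_endo.rep_eq plus_endo.rep_eq minus_endo.rep_eq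
  uminus_endo.rep_eq times_endo.rep_eq

lift_definition escale :: "rat \<Rightarrow> 'k endo \<Rightarrow> 'k endo" is "\<lambda>r \<phi> p. qscale r (\<phi> p)"
  by (simp add: Q.scale_right_distrib mult.commute)

lift_definition lin_endo :: "('k \<Rightarrow> 'k \<Rightarrow>\<^sub>0 rat) \<Rightarrow> 'k endo" is "lin_ext qscale"
  by (simp add: Q.lin_add Q.lin_qscale)

definition lmul :: "('k::monoid_add \<Rightarrow>\<^sub>0 rat) \<Rightarrow> 'k endo" where
  "lmul p = Abs_endo (\<lambda>q. p * q)"

lemma app_lmul [simp]: "app (lmul p) q = p * q"
  unfolding lmul_def by (subst Abs_endo_inverse) (simp_all add: distrib_left qscale_mult_right)

declare escale.rep_eq [simp]

lemma app_lin_endo_single [simp]: "app (lin_endo g) (Poly_Mapping.single k c) = qscale c (g k)"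
  by (simp add: lin_endo.rep_eq)

lemma endo_eqI:
  assumes "\<And>k. app X (Poly_Mapping.single k 1) = app Y (Poly_Mapping.single k 1)"
  shows "X = Y"
proof -
  have "app X p = app Y p" for p
  proof (induction p rule: poly_mapping_linear_induct)
    case (single k c)
    show ?case
      using assms[of k] app_qscale[of X c "Poly_Mapping.single k 1"]
        app_qscale[of Y c "Poly_Mapping.single k 1"] by simp
  qed (simp_all add: app_add)
  then have "app X = app Y" by (rule HOL.ext)
  then show ?thesis by (simp add: app_inject)
qed

interpretation E: rat_algebra escale
  by unfold_locales
     (rule endo_eqI, simp add: Q.scale_right_distrib Q.scale_left_distrib app_qscale)+

lemma app_comm: "app (comm X Y) p = app X (app Y p) - app Y (app X p)"
  by (simp add: comm_def)

lemma lmul_comm: "lmul (comm p q) = comm (lmul p) (lmul q)"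
  by (rule endo_eqI) (simp add: comm_def algebra_simps)

lemma lmul_ad: "lmul ((comm p ^^ n) q) = (comm (lmul p) ^^ n) (lmul q)"
  by (induction n) (simp_all add: lmul_comm)

lemma lmul_lin: "lmul (lin_ext qscale g p) = lin_ext escale (lmul \<circ> g) p"
  by (rule E.lin_compose) (rule endo_eqI, simp add: distrib_right qscale_mult_left)+

lemma lmul_magma: "lmul (magma_eval comm v m) = magma_eval comm (lmul \<circ> v) m"
  by (induction m) (simp_all add: lmul_comm)


section \<open>Verma modules modulo the Serre elements\<close>

definition serre_element :: "('i \<Rightarrow> 'i \<Rightarrow> int) \<Rightarrow> 'i \<Rightarrow> 'i \<Rightarrow> ('i list \<Rightarrow>\<^sub>0 rat)" where
  "serre_element A i j = (comm (var i) ^^ nat (1 - A i j)) (var j)"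

text \<open>
  This is the two-sided ideal generated by the Serre elements. Building right multiples into the base
  case leaves left multiplication by letters as the only other rule, which is the action of the
  creation operators; stability under the other operators is then an easy induction.\<close>

inductive_set serre_ideal :: "('i \<Rightarrow> 'i \<Rightarrow> int) \<Rightarrow> ('i list \<Rightarrow>\<^sub>0 rat) set"
  for A :: "'i \<Rightarrow> 'i \<Rightarrow> int" where
  zero: "0 \<in> serre_ideal A"
| serre: "i \<noteq> j \<Longrightarrow> serre_element A i j * v \<in> serre_ideal A"
| add: "p \<in> serre_ideal A \<Longrightarrow> q \<in> serre_ideal A \<Longrightarrow> p + q \<in> serre_ideal A"
| var_mult: "p \<in> serre_ideal A \<Longrightarrow> var i * p \<in> serre_ideal A"

lemma serre_ideal_qscale: "p \<in> serre_ideal A \<Longrightarrow> qscale r p \<in> serre_ideal A"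
  by (induction rule: serre_ideal.induct)
     (auto simp: Q.scale_right_distrib simp flip: qscale_mult_right intro: serre_ideal.intros)

lemma serre_ideal_diff: "p \<in> serre_ideal A \<Longrightarrow> q \<in> serre_ideal A \<Longrightarrow> p - q \<in> serre_ideal A"
  using serre_ideal.add[of p A "qscale (-1) q"] serre_ideal_qscale[of q A "-1"] by simp

text \<open>
  The Serre ideal has no terms of degree less than two, since \<open>1 - A i j \<ge> 1\<close>. Hence coefficients of
  words of length at most one are well defined on the quotient by this ideal.\<close>

definition order_ge :: "nat \<Rightarrow> ('x list \<Rightarrow>\<^sub>0 rat) \<Rightarrow> bool" where
  "order_ge n p \<longleftrightarrow> (\<forall>w\<in>Poly_Mapping.keys p. n \<le> length w)"

lemma order_ge_mult: "order_ge m p \<Longrightarrow> order_ge n q \<Longrightarrow> order_ge (m + n) (p * q)"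
  using keys_mult[of p q] by (fastforce simp: order_ge_def plus_list_def intro: add_mono)

lemma order_ge_add: "order_ge n p \<Longrightarrow> order_ge n q \<Longrightarrow> order_ge n (p + q)"
  using keys_add[of p q] by (fastforce simp: order_ge_def)

lemma order_ge_diff: "order_ge n p \<Longrightarrow> order_ge n q \<Longrightarrow> order_ge n (p - q)"
  by (auto simp: order_ge_def in_keys_iff lookup_minus)

lemma order_ge_var: "order_ge 1 (var i)"
  by (simp add: order_ge_def var_def)

lemma order_ge_comm: "order_ge m p \<Longrightarrow> order_ge n q \<Longrightarrow> order_ge (m + n) (comm p q)"
  unfolding comm_def using order_ge_mult[of m p n q] order_ge_mult[of n q m p]
  by (auto intro: order_ge_diff simp: add.commute)

lemma order_ge_serre_ideal:
  assumes "generalized_cartan_matrix A" "p \<in> serre_ideal A"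
  shows "order_ge 2 p"
  using assms(2)
proof (induction rule: serre_ideal.induct)
  case (serre i j v)
  have pow: "order_ge (Suc n) ((comm (var i) ^^ n) (var j))" for n
  proof (induction n)
    case 0
    show ?case using order_ge_var[of j] by simp
  next
    case (Suc n)
    then show ?case using order_ge_comm[OF order_ge_var] by fastforce
  qed
  have "A i j \<le> 0" using assms(1) serre by (simp add: generalized_cartan_matrix_def)
  then have "2 \<le> Suc (nat (1 - A i j))" by simp
  with pow[of "nat (1 - A i j)"] have "order_ge 2 (serre_element A i j)"
    unfolding serre_element_def order_ge_def by fastforce
  moreover have "order_ge 0 v" by (simp add: order_ge_def)
  ultimately show ?case using order_ge_mult by fastforce
next
  case (var_mult p i)
  then show ?case using order_ge_mult[OF order_ge_var[of i]] by (fastforce simp: order_ge_def)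
qed (simp_all add: order_ge_add, simp add: order_ge_def)

lemma lookup_serre_ideal:
  assumes "generalized_cartan_matrix A" "p \<in> serre_ideal A" "length w < 2"
  shows "Poly_Mapping.lookup p w = 0"
  using order_ge_serre_ideal[OF assms(1,2)] assms(3) by (force simp: order_ge_def in_keys_iff)

context cartan_realization
begin

lemma root_add: "\<alpha> i (h + h') = \<alpha> i h + \<alpha> i h'"
  and root_scale: "\<alpha> i (sT r h) = r * \<alpha> i h"
  using roots_linear[of i] by (auto simp: Vector_Spaces.linear_iff)

text \<open>
  Operators of the Verma module with highest weight \<open>\<mu>\<close>, on the whole free algebra: a word
  \<open>i\<^sub>1 \<dots> i\<^sub>n\<close> stands for \<open>f\<close> with these indices, multiplied in this order, applied to the
  highest weight vector.\<close>

definition verma_weight :: "('t \<Rightarrow> rat) \<Rightarrow> 't \<Rightarrow> 'i list \<Rightarrow> rat" where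
  "verma_weight \<mu> h w = \<mu> h - sum_list (map (\<lambda>j. \<alpha> j h) w)"

definition fop :: "'i \<Rightarrow> 'i list endo" where
  "fop i = lmul (var i)"

definition hop :: "('t \<Rightarrow> rat) \<Rightarrow> 't \<Rightarrow> 'i list endo" where
  "hop \<mu> h = lin_endo (\<lambda>w. Poly_Mapping.single w (verma_weight \<mu> h w))"

primrec eword :: "('t \<Rightarrow> rat) \<Rightarrow> 'i \<Rightarrow> 'i list \<Rightarrow> ('i list \<Rightarrow>\<^sub>0 rat)" where
  "eword \<mu> i [] = 0"
| "eword \<mu> i (j # w) = var j * eword \<mu> i w +
     (if i = j then Poly_Mapping.single w (verma_weight \<mu> (hc i) w) else 0)"

definition eop :: "('t \<Rightarrow> rat) \<Rightarrow> 'i \<Rightarrow> 'i list endo" where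
  "eop \<mu> i = lin_endo (eword \<mu> i)"

lemma app_fop [simp]: "app (fop i) p = var i * p"
  and app_hop_single [simp]:
    "app (hop \<mu> h) (Poly_Mapping.single w c) = Poly_Mapping.single w (c * verma_weight \<mu> h w)"
  and app_eop_single [simp]: "app (eop \<mu> i) (Poly_Mapping.single w c) = qscale c (eword \<mu> i w)"
  by (simp_all add: fop_def hop_def eop_def)

lemma verma_weight_Cons: "verma_weight \<mu> h (j # w) = verma_weight \<mu> h w - \<alpha> j h"
  by (simp add: verma_weight_def)

lemma comm_hop_fop: "comm (hop \<mu> h) (fop j) = escale (- \<alpha> j h) (fop j)"
  by (rule endo_eqI)
     (simp add: app_comm verma_weight_Cons single_Cons[symmetric] single_diff single_uminus algebra_simps)

lemma comm_hop_hop: "comm (hop \<mu> h) (hop \<mu> h') = 0"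
  by (rule endo_eqI) (simp add: app_comm mult.commute)

lemma comm_eop_fop: "comm (eop \<mu> i) (fop j) = (if i = j then hop \<mu> (hc i) else 0)"
  by (rule endo_eqI) (simp add: app_comm single_Cons[symmetric] app_qscale)

text \<open>The words span, so an operator that kills the empty word and commutes with all letters
  vanishes.\<close>

lemma endo_eq_zeroI:
  assumes "app X 1 = 0" "\<And>j. comm X (fop j) = 0"
  shows "X = 0"
proof (rule endo_eqI)
  fix w :: "'i list"
  show "app X (Poly_Mapping.single w 1) = app 0 (Poly_Mapping.single w 1)"
  proof (induction w)
    case Nil
    then show ?case using assms(1) by (simp add: zero_list_def flip: single_one)
  next
    case (Cons j w)
    have "app (comm X (fop j)) (Poly_Mapping.single w 1) = 0"
      by (simp add: assms(2))
    then show ?case using Cons by (simp add: app_comm single_Cons)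
  qed
qed

lemma eop_one [simp]: "app (eop \<mu> i) 1 = 0"
  by (simp add: zero_list_def flip: single_one)

lemma hop_one [simp]: "app (hop \<mu> h) 1 = qscale (\<mu> h) 1"
  by (simp add: zero_list_def verma_weight_def flip: single_one)

text \<open>
  The difference of the two sides kills the highest weight vector and, by the Jacobi identity and the
  other commutation rules, commutes with all creation operators.\<close>

lemma comm_hop_eop: "comm (hop \<mu> h) (eop \<mu> i) = escale (\<alpha> i h) (eop \<mu> i)"
proof -
  let ?X = "comm (hop \<mu> h) (eop \<mu> i) - escale (\<alpha> i h) (eop \<mu> i)"
  have *: "comm ?X (fop j) = 0" for j
  proof -
    have "comm (comm (hop \<mu> h) (eop \<mu> i)) (fop j) =
        comm (hop \<mu> h) (comm (eop \<mu> i) (fop j)) - comm (eop \<mu> i) (comm (hop \<mu> h) (fop j))"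
      using E.Comm.br_derivation[of "hop \<mu> h" "eop \<mu> i" "fop j"] by simp
    also have "\<dots> = escale (\<alpha> j h) (comm (eop \<mu> i) (fop j))"
      by (simp add: comm_eop_fop comm_hop_fop comm_hop_hop E.Comm.br_scale_right
          E.Comm.br_minus_right)
    finally show ?thesis
      by (simp add: E.Comm.br_diff_left E.Comm.br_scale_left comm_eop_fop)
  qed
  have "?X = 0"
    by (rule endo_eq_zeroI[OF _ *]) (simp add: app_comm app_qscale)
  then show ?thesis by simp
qed

lemma serre_eop: "i \<noteq> j \<Longrightarrow> (comm (eop \<mu> i) ^^ nat (1 - A i j)) (eop \<mu> j) = 0"
proof (rule endo_eq_zeroI)
  have "app ((comm (eop \<mu> i) ^^ n) (eop \<mu> j)) 1 = 0" for n
    by (induction n) (simp_all add: app_comm)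
  then show "app ((comm (eop \<mu> i) ^^ nat (1 - A i j)) (eop \<mu> j)) 1 = 0" .
next
  fix k assume "i \<noteq> j"
  have "comm (fop k) ((comm (eop \<mu> i) ^^ nat (1 - A i j)) (eop \<mu> j)) = 0"
    by (rule E.Comm.serre_commutes[where h = "\<lambda>i. - hop \<mu> (hc i)", OF gcm \<open>i \<noteq> j\<close>])
       (auto simp: E.Comm.br_skew[of "fop _"] comm_eop_fop E.Comm.br_minus_left comm_hop_eop pairing)
  then show "comm ((comm (eop \<mu> i) ^^ nat (1 - A i j)) (eop \<mu> j)) (fop k) = 0"
    using E.Comm.br_skew by (metis neg_equal_0_iff_equal)
qed

lemma eop_serre_element: "i \<noteq> j \<Longrightarrow> comm (eop \<mu> k) (lmul (serre_element A i j)) = 0"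
  unfolding serre_element_def lmul_ad fop_def[symmetric]
  by (rule E.Comm.serre_commutes[where h = "\<lambda>i. hop \<mu> (hc i)", OF gcm])
     (auto simp: comm_eop_fop comm_hop_fop pairing)

lemma hop_serre_element:
  "comm (hop \<mu> h) (lmul (serre_element A i j)) =
     escale (- (of_nat (nat (1 - A i j)) * \<alpha> i h + \<alpha> j h)) (lmul (serre_element A i j))"
proof -
  have "comm (hop \<mu> h) ((comm (fop i) ^^ n) (fop j)) =
      escale (of_nat n * (- \<alpha> i h) + (- \<alpha> j h)) ((comm (fop i) ^^ n) (fop j))" for n
    by (rule E.Comm.ad_string_weight) (fact comm_hop_fop)+
  then show ?thesis
    unfolding serre_element_def lmul_ad fop_def[symmetric] by simp
qed

lemma fop_serre_ideal: "p \<in> serre_ideal A \<Longrightarrow> app (fop i) p \<in> serre_ideal A"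
  by (simp add: serre_ideal.var_mult)

lemma app_comm_mult: "app X (p * q) = p * app X q + app (comm X (lmul p)) q"
  by (simp add: app_comm)

lemma hop_serre_ideal: "p \<in> serre_ideal A \<Longrightarrow> app (hop \<mu> h) p \<in> serre_ideal A"
proof (induction rule: serre_ideal.induct)
  case (serre i j v)
  then show ?case
    by (simp add: app_comm_mult hop_serre_element)
       (metis serre_ideal.add serre_ideal.serre serre_ideal_qscale Q.scale_minus_left
         diff_conv_add_uminus serre_ideal_diff)
next
  case (var_mult p i)
  then show ?case
    by (simp add: app_comm_mult comm_hop_fop fop_def[symmetric])
       (metis serre_ideal_qscale serre_ideal.var_mult serre_ideal_diff)
qed (simp_all add: app_add serre_ideal.zero serre_ideal.add)

text \<open>
  Moving \<open>e\<^sub>i\<close> past a Serre element costs nothing, and moving it past a letter costs an operator of the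
  Cartan subalgebra, under which the ideal is stable.\<close>

lemma eop_serre_ideal: "p \<in> serre_ideal A \<Longrightarrow> app (eop \<mu> i) p \<in> serre_ideal A"
proof (induction rule: serre_ideal.induct)
  case (serre i j v)
  then show ?case
    by (simp add: app_comm_mult eop_serre_element serre_ideal.serre)
next
  case (var_mult p j)
  then show ?case
    by (auto simp: app_comm_mult comm_eop_fop fop_def[symmetric]
        intro: serre_ideal.intros hop_serre_ideal)
qed (simp_all add: app_add serre_ideal.zero serre_ideal.add)

end

lemma (in lie_algebra) lie_eval_kac_moody_relations:
  assumes "p \<in> kac_moody_relations sT A \<alpha> hc"
    and "\<And>h h'. H (h + h') = H h + H h'" "\<And>r h. H (sT r h) = sc r (H h)"
    and "\<And>h h'. br (H h) (H h') = 0"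
    and "\<And>h i. br (H h) (E i) = sc (\<alpha> i h) (E i)"
    and "\<And>h i. br (H h) (F i) = sc (- \<alpha> i h) (F i)"
    and "\<And>i j. br (E i) (F j) = (if i = j then H (hc i) else 0)"
  shows "lie_eval sc br (case_gen E F H) p \<in>
     {0} \<union> {(br (E i) ^^ nat (1 - A i j)) (E j) | i j. i \<noteq> j} \<union>
     {(br (F i) ^^ nat (1 - A i j)) (F j) | i j. i \<noteq> j}"
proof -
  note eval = lie_eval_add lie_eval_diff lie_eval_qscale lie_eval_mbr lie_eval_funpow
    lie_eval_mvar lie_eval_zero gen.case assms(2-7)
  from assms(1) show ?thesis unfolding kac_moody_relations_def Let_def
  proof (elim UnE CollectE exE conjE)
    fix i j assume "p = (mbr (mvar (GE i)) ^^ nat (1 - A i j)) (mvar (GE j))" "i \<noteq> j"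
    then show ?thesis by (simp only: eval) blast
  next
    fix i j assume "p = (mbr (mvar (GF i)) ^^ nat (1 - A i j)) (mvar (GF j))" "i \<noteq> j"
    then show ?thesis by (simp only: eval) blast
  qed (simp_all add: eval)
qed

context cartan_realization
begin

text \<open>Families of operators that define an action of the Kac--Moody algebra on the quotient of the
  free algebra by the Serre elements.\<close>

definition acts :: "(('i, 't) gen \<Rightarrow> 'i list endo) \<Rightarrow> bool" where
  "acts W \<longleftrightarrow> (\<forall>x. \<forall>q\<in>serre_ideal A. app (W x) q \<in> serre_ideal A) \<and>
    (\<forall>p\<in>kac_moody_relations sT A \<alpha> hc. \<forall>q. app (lie_eval escale comm W p) q \<in> serre_ideal A)"

text \<open>
  The action with highest weight \<open>\<mu>\<close>, and its composition with the Chevalley involution, which exchanges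
  \<open>e\<^sub>i\<close> and \<open>f\<^sub>i\<close> and therefore has to change the sign on the Cartan subalgebra.\<close>

definition lower_ops :: "('t \<Rightarrow> rat) \<Rightarrow> ('i, 't) gen \<Rightarrow> 'i list endo" where
  "lower_ops \<mu> = case_gen (eop \<mu>) fop (hop \<mu>)"

definition upper_ops :: "('t \<Rightarrow> rat) \<Rightarrow> ('i, 't) gen \<Rightarrow> 'i list endo" where
  "upper_ops \<mu> = case_gen fop (eop \<mu>) (\<lambda>h. - hop \<mu> h)"

lemma hop_linear:
  assumes "Vector_Spaces.linear sT (*) \<mu>"
  shows "hop \<mu> (h + h') = hop \<mu> h + hop \<mu> h'" "hop \<mu> (sT r h) = escale r (hop \<mu> h)"
proof -
  have verma_weight: "verma_weight \<mu> (h + h') w = verma_weight \<mu> h w + verma_weight \<mu> h' w" "verma_weight \<mu> (sT r h) w = r * verma_weight \<mu> h w" for w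
    using assms
    by (induction w) (simp_all add: verma_weight_def Vector_Spaces.linear_iff root_add root_scale algebra_simps)
  show "hop \<mu> (h + h') = hop \<mu> h + hop \<mu> h'" "hop \<mu> (sT r h) = escale r (hop \<mu> h)"
    by (rule endo_eqI, simp add: verma_weight single_add)+
qed

lemma acts_lower_ops: "Vector_Spaces.linear sT (*) \<mu> \<Longrightarrow> acts (lower_ops \<mu>)"
proof -
  assume \<mu>: "Vector_Spaces.linear sT (*) \<mu>"
  have "app (lie_eval escale comm (lower_ops \<mu>) p) q \<in> serre_ideal A"
    if "p \<in> kac_moody_relations sT A \<alpha> hc" for p q
  proof -
    have "lie_eval escale comm (lower_ops \<mu>) p \<in>
     {0} \<union> {(comm (eop \<mu> i) ^^ nat (1 - A i j)) (eop \<mu> j) | i j. i \<noteq> j} \<union>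
     {(comm (fop i) ^^ nat (1 - A i j)) (fop j) | i j. i \<noteq> j}"
      unfolding lower_ops_def
      by (rule E.Comm.lie_eval_kac_moody_relations[OF that])
         (simp_all add: hop_linear[OF \<mu>] comm_hop_hop comm_hop_eop comm_hop_fop comm_eop_fop)
    then show ?thesis
      by (auto simp: serre_eop serre_ideal.zero fop_def serre_element_def[symmetric]
          simp flip: lmul_ad intro: serre_ideal.serre)
  qed
  moreover have "app (lower_ops \<mu> x) q \<in> serre_ideal A" if "q \<in> serre_ideal A" for x q
    using that by (cases x) (simp_all add: lower_ops_def eop_serre_ideal hop_serre_ideal
        fop_serre_ideal serre_ideal.var_mult)
  ultimately show ?thesis by (simp add: acts_def)
qed

lemma acts_upper_ops: "Vector_Spaces.linear sT (*) \<mu> \<Longrightarrow> acts (upper_ops \<mu>)"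
proof -
  assume \<mu>: "Vector_Spaces.linear sT (*) \<mu>"
  have "app (lie_eval escale comm (upper_ops \<mu>) p) q \<in> serre_ideal A"
    if "p \<in> kac_moody_relations sT A \<alpha> hc" for p q
  proof -
    have "lie_eval escale comm (upper_ops \<mu>) p \<in>
     {0} \<union> {(comm (fop i) ^^ nat (1 - A i j)) (fop j) | i j. i \<noteq> j} \<union>
     {(comm (eop \<mu> i) ^^ nat (1 - A i j)) (eop \<mu> j) | i j. i \<noteq> j}"
      unfolding upper_ops_def
      by (rule E.Comm.lie_eval_kac_moody_relations[OF that])
         (simp_all add: hop_linear[OF \<mu>] comm_hop_hop comm_hop_eop comm_hop_fop comm_eop_fop
           E.Comm.br_minus_left E.Comm.br_minus_right E.Comm.br_skew[of "fop _" "eop _ _"])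
    then show ?thesis
      by (auto simp: serre_eop serre_ideal.zero fop_def serre_element_def[symmetric]
          simp flip: lmul_ad intro: serre_ideal.serre)
  qed
  moreover have "app (upper_ops \<mu> x) q \<in> serre_ideal A" if "q \<in> serre_ideal A" for x q
    using that hop_serre_ideal[OF that, of \<mu>] serre_ideal_diff[OF serre_ideal.zero]
    by (cases x) (fastforce simp: upper_ops_def eop_serre_ideal
        fop_serre_ideal serre_ideal.var_mult)+
  ultimately show ?thesis by (simp add: acts_def)
qed

lemma acts_lie_eval_serre_ideal:
  assumes "acts W" "q \<in> serre_ideal A"
  shows "app (lie_eval escale comm W p) q \<in> serre_ideal A"
proof -
  have mag: "app (magma_eval comm W m) q \<in> serre_ideal A" if "q \<in> serre_ideal A" for m q
    using that
    by (induction m arbitrary: q) (use assms in \<open>auto simp: acts_def app_comm intro: serre_ideal_diff\<close>)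
  show ?thesis
    by (induction p rule: poly_mapping_linear_induct)
       (simp_all add: lie_eval_eq_lin E.lin_add mag assms serre_ideal.zero serre_ideal.add
         serre_ideal_qscale)
qed

text \<open>
  The operators that preserve the Serre ideal form an algebra, and those that map everything into it an
  ideal of this algebra; squares and Jacobi expressions vanish identically.\<close>

lemma acts_lie_relation_ideal:
  assumes "acts W" "p \<in> lie_relation_ideal (kac_moody_relations sT A \<alpha> hc)"
  shows "app (lie_eval escale comm W p) q \<in> serre_ideal A"
  using assms(2)
proof (induction arbitrary: q rule: lie_relation_ideal.induct)
  case (relation p)
  then show ?case using assms(1) by (simp add: acts_def)
next
  case (left p r)
  then show ?case
    by (simp add: E.Comm.lie_eval_mbr app_comm serre_ideal_diff acts_lie_eval_serre_ideal assms(1))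
next
  case (right p r)
  then show ?case
    by (simp add: E.Comm.lie_eval_mbr app_comm serre_ideal_diff acts_lie_eval_serre_ideal assms(1))
qed (simp_all add: E.Comm.lie_eval_add E.Comm.lie_eval_mbr E.Comm.lie_eval_qscale
      E.Comm.lie_eval_zero E.Comm.br_self E.Comm.jacobi serre_ideal.zero serre_ideal.add
      serre_ideal_qscale del: plus_endo.rep_eq, simp add: serre_ideal.add)

end


section \<open>Consequences of the action for the triangular parts\<close>

lemma magma_eval_map_magma: "magma_eval br v (map_magma G m) = magma_eval br (v \<circ> G) m"
  by (induction m) simp_all

definition rename_leaves :: "('x \<Rightarrow> 'y) \<Rightarrow> ('x magma \<Rightarrow>\<^sub>0 rat) \<Rightarrow> ('y magma \<Rightarrow>\<^sub>0 rat)" where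
  "rename_leaves G = lin_ext qscale (\<lambda>m. Poly_Mapping.single (map_magma G m) 1)"

lemma (in lie_algebra) lie_eval_rename_leaves:
  "lie_eval sc br v (rename_leaves G p) = lie_eval sc br (v \<circ> G) p"
  unfolding rename_leaves_def
  by (subst lin_compose[where \<phi> = "lie_eval sc br v" and s = qscale])
     (simp_all add: lie_eval_zero lie_eval_add lie_eval_qscale,
      simp add: lie_eval_eq_lin magma_eval_map_magma o_def)

lemma lookup_var_mult_Nil: "Poly_Mapping.lookup (var j * q) [] = 0"
  by (induction q rule: poly_mapping_linear_induct)
     (simp_all add: distrib_left lookup_add lookup_single flip: single_Cons)

lemma lookup_var_mult_singleton:
  "Poly_Mapping.lookup (var j * q) [i] = (if i = j then Poly_Mapping.lookup q [] else 0)"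
  by (induction q rule: poly_mapping_linear_induct)
     (auto simp: distrib_left lookup_add lookup_single when_def simp flip: single_Cons)

lemma lookup_one_list: "Poly_Mapping.lookup 1 w = (if w = [] then 1 else 0 :: rat)"
  by (simp add: lookup_one zero_list_def)

lemma lookup_var: "Poly_Mapping.lookup (var i) w = (if w = [i] then 1 else 0)"
  by (auto simp: var_def lookup_single when_def)

lemma (in cartan_realization) lookup_hop:
  "Poly_Mapping.lookup (app (hop \<mu> h) q) w = verma_weight \<mu> h w * Poly_Mapping.lookup q w"
  by (induction q rule: poly_mapping_linear_induct)
     (auto simp: app_add lookup_add lookup_single when_def algebra_simps)

context symmetrizable_kac_moody_algebra
begin

abbreviation gens :: "('i, 't) gen \<Rightarrow> 'g" where
  "gens \<equiv> case_gen e f \<iota>"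

definition poly_of :: "'g \<Rightarrow> ('i, 't) gen magma \<Rightarrow>\<^sub>0 rat" where
  "poly_of x = (SOME p. lie_eval sc br gens p = x)"

lemma lie_eval_poly_of: "lie_eval sc br gens (poly_of x) = x"
proof -
  obtain p where "lie_eval sc br gens p = x"
    using presented unfolding lie_presented_by_def by (metis surjD)
  then show ?thesis unfolding poly_of_def by (rule someI)
qed

lemma lie_eval_eq_zero_iff:
  "lie_eval sc br gens p = 0 \<longleftrightarrow> p \<in> lie_relation_ideal (kac_moody_relations sT A \<alpha> hc)"
  using presented unfolding lie_presented_by_def by blast

text \<open>
  The choice of a Lie polynomial matters only modulo the Serre ideal, which is why the laws
  below are stated for coefficients of words of length less than two.\<close>

definition act :: "(('i, 't) gen \<Rightarrow> 'i list endo) \<Rightarrow> 'g \<Rightarrow> 'i list endo" where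
  "act W x = lie_eval escale comm W (poly_of x)"

lemma lookup_act_lie_eval:
  assumes "acts W" "length w < 2"
  shows "Poly_Mapping.lookup (app (act W (lie_eval sc br gens p)) q) w =
    Poly_Mapping.lookup (app (lie_eval escale comm W p) q) w"
proof -
  let ?p = "poly_of (lie_eval sc br gens p) - p"
  have "?p \<in> lie_relation_ideal (kac_moody_relations sT A \<alpha> hc)"
    unfolding lie_eval_eq_zero_iff[symmetric] by (simp add: Lie.lie_eval_diff lie_eval_poly_of)
  from lookup_serre_ideal[OF gcm acts_lie_relation_ideal[OF assms(1) this, of q] assms(2)]
  show ?thesis by (simp add: act_def E.Comm.lie_eval_diff lookup_minus)
qed

lemma lookup_act:
  assumes "acts W" "length w < 2"
  shows "Poly_Mapping.lookup (app (act W (x + y)) q) w =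
      Poly_Mapping.lookup (app (act W x) q) w + Poly_Mapping.lookup (app (act W y) q) w"
    and "Poly_Mapping.lookup (app (act W (sc r x)) q) w = r * Poly_Mapping.lookup (app (act W x) q) w"
    and "Poly_Mapping.lookup (app (act W (br x y)) q) w =
      Poly_Mapping.lookup (app (act W x) (app (act W y) q)) w -
      Poly_Mapping.lookup (app (act W y) (app (act W x) q)) w"
    and "Poly_Mapping.lookup (app (act W (gens g)) q) w = Poly_Mapping.lookup (app (W g) q) w"
    and "Poly_Mapping.lookup (app (act W 0) q) w = 0"
  using lookup_act_lie_eval[OF assms, of "poly_of x + poly_of y" q]
    lookup_act_lie_eval[OF assms, of "qscale r (poly_of x)" q]
    lookup_act_lie_eval[OF assms, of "mbr (poly_of x) (poly_of y)" q]
    lookup_act_lie_eval[OF assms, of "mvar g" q]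
    lookup_act_lie_eval[OF assms, of 0 q]
  by (simp_all add: Lie.lie_eval_add Lie.lie_eval_qscale Lie.lie_eval_mbr lie_eval_poly_of
      E.Comm.lie_eval_add E.Comm.lie_eval_qscale E.Comm.lie_eval_mbr act_def[symmetric]
      lookup_add lookup_minus app_comm Lie.lie_eval_zero E.Comm.lie_eval_zero)

text \<open>
  The part generated by the \<open>e\<^sub>i\<close> (or by the \<open>f\<^sub>i\<close>) is presented by the Serre relations: if the
  polynomial vanishes in the Lie algebra, its operator maps 1 into the Serre ideal; since the
  generators act by left multiplication with letters, the image of 1 is the value of the polynomial.\<close>

lemma creation_lie_polynomial:
  assumes "acts W" "\<And>i. W (G i) = fop i" "lie_eval sc br (gens \<circ> G) p = 0"
  shows "lie_eval qscale comm var p \<in> serre_ideal A"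
proof -
  have "rename_leaves G p \<in> lie_relation_ideal (kac_moody_relations sT A \<alpha> hc)"
    unfolding lie_eval_eq_zero_iff[symmetric] Lie.lie_eval_rename_leaves by (rule assms)
  from acts_lie_relation_ideal[OF assms(1) this, of 1]
  have "app (lie_eval escale comm (W \<circ> G) p) 1 \<in> serre_ideal A"
    by (simp only: E.Comm.lie_eval_rename_leaves)
  moreover have "W \<circ> G = lmul \<circ> var"
    by (simp add: fun_eq_iff assms(2) fop_def)
  then have "lie_eval escale comm (W \<circ> G) p = lmul (lie_eval qscale comm var p)"
    by (simp add: lie_eval_eq_lin lmul_lin lmul_magma o_def)
  ultimately show ?thesis by simp
qed

lemma lower_ops_simps [simp]: "lower_ops \<mu> (GE i) = eop \<mu> i" "lower_ops \<mu> (GF i) = fop i"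
    "lower_ops \<mu> (GT h) = hop \<mu> h"
  and upper_ops_simps [simp]: "upper_ops \<mu> (GE i) = fop i" "upper_ops \<mu> (GF i) = eop \<mu> i"
    "upper_ops \<mu> (GT h) = - hop \<mu> h"
  by (simp_all add: lower_ops_def upper_ops_def)

lemma lookup_act_nilpotent:
  assumes "acts W" "\<And>i. W (G i) = fop i" "x \<in> nilpotent_part sc br (gens \<circ> G)"
  shows "Poly_Mapping.lookup (app (act W x) q) [] = 0"
proof -
  let ?L = "{x. \<forall>q. Poly_Mapping.lookup (app (act W x) q) [] = 0}"
  have "gens (G i) \<in> ?L" for i
    using assms(1,2) by (simp add: lookup_act lookup_var_mult_Nil)
  moreover have "lie_subalgebra sc br ?L"
    using assms(1) by (auto simp: lie_subalgebra_def lookup_act)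
  ultimately have "nilpotent_part sc br (gens \<circ> G) \<subseteq> ?L"
    unfolding nilpotent_part_def by (intro lie_span_least) auto
  with assms(3) show ?thesis by auto
qed

lemma exists_linear_functional:
  assumes "h \<noteq> 0"
  obtains \<mu> where "Vector_Spaces.linear sT (*) \<mu>" "\<mu> h = 1"
proof -
  interpret vector_space_pair sT "(*) :: rat \<Rightarrow> rat \<Rightarrow> rat"
    by unfold_locales (simp_all add: algebra_simps)
  show ?thesis
    using linear_independent_extend[of "{h}" "\<lambda>_. 1"] assms that by auto
qed

text \<open>
  The element \<open>\<iota> h\<close> multiplies the highest weight vector by \<open>\<plusminus>\<mu> h\<close>, whereas the
  constant term of the image under the nilpotent part is 0. Since \<open>\<mu>\<close> is arbitrary, \<open>h = 0\<close>.\<close>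

lemma cartan_nilpotent_disjoint:
  "\<iota> h \<in> nilpotent_part sc br e \<Longrightarrow> h = 0"
  "\<iota> h \<in> nilpotent_part sc br f \<Longrightarrow> h = 0"
proof -
  have e: "gens \<circ> GE = e" and f: "gens \<circ> GF = f" by auto
  have zero: "\<mu> h = 0" if "\<iota> h \<in> nilpotent_part sc br e \<or> \<iota> h \<in> nilpotent_part sc br f"
    "Vector_Spaces.linear sT (*) \<mu>" for \<mu>
    using that(1)
  proof
    assume "\<iota> h \<in> nilpotent_part sc br e"
    then have "Poly_Mapping.lookup (app (act (upper_ops \<mu>) (gens (GT h))) 1) [] = 0"
      using lookup_act_nilpotent[OF acts_upper_ops[OF that(2)], of GE] by (simp add: e)
    then show ?thesis
      unfolding lookup_act[OF acts_upper_ops[OF that(2)], of "[]", simplified]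
      by (simp add: lookup_hop lookup_one_list verma_weight_def)
  next
    assume "\<iota> h \<in> nilpotent_part sc br f"
    then have "Poly_Mapping.lookup (app (act (lower_ops \<mu>) (gens (GT h))) 1) [] = 0"
      using lookup_act_nilpotent[OF acts_lower_ops[OF that(2)], of GF] by (simp add: f)
    then show ?thesis
      unfolding lookup_act[OF acts_lower_ops[OF that(2)], of "[]", simplified]
      by (simp add: lookup_hop lookup_one_list verma_weight_def)
  qed
  then show "\<iota> h \<in> nilpotent_part sc br e \<Longrightarrow> h = 0" "\<iota> h \<in> nilpotent_part sc br f \<Longrightarrow> h = 0"
    using exists_linear_functional by (metis zero_neq_one)+
qed


subsection \<open>Existence of the cocycle\<close>

text \<open>
  A Borel subalgebra preserves the filtration by word length, so for each letter \<open>i\<close> it acts on the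
  span of the empty word and the word \<open>i\<close>, modulo the other words, by lower triangular matrices. For
  highest weight 0 the only entries are the coefficient of \<open>i\<close> in \<open>x \<cdot> 1\<close> and the eigenvalue on \<open>i\<close>;
  \<open>triangular\<close> singles out the elements that act in this way.\<close>

definition letter_coeff :: "(('i, 't) gen \<Rightarrow> 'i list endo) \<Rightarrow> 'i \<Rightarrow> 'g \<Rightarrow> rat" where
  "letter_coeff W i x = Poly_Mapping.lookup (app (act W x) 1) [i]"

definition letter_weight :: "(('i, 't) gen \<Rightarrow> 'i list endo) \<Rightarrow> 'i \<Rightarrow> 'g \<Rightarrow> rat" where
  "letter_weight W i x = Poly_Mapping.lookup (app (act W x) (var i)) [i]"

definition triangular :: "(('i, 't) gen \<Rightarrow> 'i list endo) \<Rightarrow> 'g set" where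
  "triangular W = {x. \<forall>q. Poly_Mapping.lookup (app (act W x) q) [] = 0 \<and>
     (\<forall>i. Poly_Mapping.lookup (app (act W x) q) [i] =
        letter_coeff W i x * Poly_Mapping.lookup q [] + letter_weight W i x * Poly_Mapping.lookup q [i])}"

lemma triangularD:
  assumes "x \<in> triangular W"
  shows "Poly_Mapping.lookup (app (act W x) q) [] = 0"
    "Poly_Mapping.lookup (app (act W x) q) [i] =
        letter_coeff W i x * Poly_Mapping.lookup q [] + letter_weight W i x * Poly_Mapping.lookup q [i]"
  using assms by (auto simp: triangular_def)

lemma letter_coeff_linear:
  assumes "acts W"
  shows "letter_coeff W i (x + y) = letter_coeff W i x + letter_coeff W i y" "letter_coeff W i (sc r x) = r * letter_coeff W i x"
    "letter_coeff W i 0 = 0" "letter_weight W i (x + y) = letter_weight W i x + letter_weight W i y"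
    "letter_weight W i (sc r x) = r * letter_weight W i x" "letter_weight W i 0 = 0"
  using assms by (simp_all add: letter_coeff_def letter_weight_def lookup_act)

text \<open>
  This is the commutator of two lower triangular matrices with entries 0 and \<open>letter_weight\<close> on the
  diagonal and \<open>letter_coeff\<close> below it.\<close>

lemma letter_coeff_br:
  assumes "acts W" "x \<in> triangular W" "y \<in> triangular W"
  shows "letter_coeff W i (br x y) = letter_weight W i x * letter_coeff W i y - letter_weight W i y * letter_coeff W i x"
    and "letter_weight W i (br x y) = 0"
  using assms
  by (simp_all add: letter_coeff_def[of _ _ "br x y"] letter_weight_def[of _ _ "br x y"] lookup_act triangularD
      lookup_one_list lookup_var)

lemma lie_subalgebra_triangular: "acts W \<Longrightarrow> lie_subalgebra sc br (triangular W)"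
  unfolding lie_subalgebra_def
proof (intro conjI ballI allI)
  assume W: "acts W"
  show "0 \<in> triangular W"
    by (simp add: triangular_def lookup_act W letter_coeff_linear)
  fix x assume x: "x \<in> triangular W"
  show "sc r x \<in> triangular W" for r
    unfolding triangular_def
    by (simp add: lookup_act W letter_coeff_linear triangularD[OF x] algebra_simps)
  fix y assume y: "y \<in> triangular W"
  show "x + y \<in> triangular W"
    unfolding triangular_def
    by (simp add: lookup_act W letter_coeff_linear triangularD[OF x] triangularD[OF y] algebra_simps)
  show "br x y \<in> triangular W"
    unfolding triangular_def
    by (simp add: lookup_act W letter_coeff_br x y triangularD[OF x] triangularD[OF y] algebra_simps)
qed

lemma borel_triangular:
  assumes "acts W" "\<And>i. W (G i) = fop i" "\<And>h. W (GT h) = escale s (hop (\<lambda>_. 0) h)"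
    and n: "x - \<iota> h \<in> nilpotent_part sc br (gens \<circ> G)"
  shows "x \<in> triangular W" "letter_weight W i x = - s * \<alpha> i h"
proof -
  note act = lookup_act[OF assms(1)]
  have fgen: "letter_coeff W i (gens (G j)) = (if i = j then 1 else 0)" "letter_weight W i (gens (G j)) = 0" for i j
    by (simp_all add: letter_coeff_def letter_weight_def act(4) assms(2) lookup_var_mult_singleton
        lookup_one_list lookup_var)
  have hact: "Poly_Mapping.lookup (app (act W (\<iota> h)) q) w = s * verma_weight (\<lambda>_. 0) h w * Poly_Mapping.lookup q w"
    if "length w < 2" for h q w
    using act(4)[OF that, of "GT h" q] by (simp add: assms(3) lookup_hop)
  have hgen: "letter_coeff W i (\<iota> h) = 0" "letter_weight W i (\<iota> h) = - s * \<alpha> i h" for i h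
    by (simp_all add: letter_coeff_def letter_weight_def hact lookup_one_list lookup_var verma_weight_def)
  have f: "gens (G j) \<in> triangular W" for j
    unfolding triangular_def mem_Collect_eq fgen
    by (simp add: act(4) assms(2) lookup_var_mult_singleton lookup_var_mult_Nil)
  have h: "\<iota> h \<in> triangular W"
    unfolding triangular_def mem_Collect_eq hgen by (simp add: hact verma_weight_def)
  let ?L = "{x \<in> triangular W. \<forall>i. letter_weight W i x = 0}"
  have "lie_subalgebra sc br ?L"
    using lie_subalgebra_triangular[OF assms(1)]
    by (auto simp: lie_subalgebra_def letter_coeff_linear[OF assms(1)] letter_coeff_br[OF assms(1)])
  then have "nilpotent_part sc br (gens \<circ> G) \<subseteq> ?L"
    unfolding nilpotent_part_def by (rule lie_span_least) (auto simp: f fgen)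
  with n have n': "x - \<iota> h \<in> triangular W" "letter_weight W i (x - \<iota> h) = 0" by auto
  have x: "x = \<iota> h + (x - \<iota> h)" by simp
  show "x \<in> triangular W"
    using h n'(1) lie_subalgebra_triangular[OF assms(1)] unfolding lie_subalgebra_def
    by (subst x) blast
  show "letter_weight W i x = - s * \<alpha> i h"
    using hgen(2)[of i h] n'(2) by (subst x, subst letter_coeff_linear[OF assms(1)]) simp
qed

lemma linear_zero: "Vector_Spaces.linear sT (*) (\<lambda>_. 0 :: rat)"
  unfolding Vector_Spaces.linear_iff
  by (auto intro: vector_space_axioms vector_space_pair.intro simp: vector_space_def algebra_simps)

abbreviation "lower0 \<equiv> lower_ops (\<lambda>_. 0)"
abbreviation "upper0 \<equiv> upper_ops (\<lambda>_. 0)"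

lemmas acts0 = acts_lower_ops[OF linear_zero] acts_upper_ops[OF linear_zero]

lemma pair_algebra_iff:
  "x \<in> pair_algebra sc br e f \<iota> \<longleftrightarrow>
     (\<exists>h. fst x - \<iota> h \<in> nilpotent_part sc br e \<and> snd x - \<iota> h \<in> nilpotent_part sc br f)"
  unfolding pair_algebra_def borel_part_def
  by (cases x) (auto, (metis add_diff_cancel_left' diff_add_cancel add.commute)+)

lemma pair_triangular:
  assumes "x \<in> pair_algebra sc br e f \<iota>"
  shows "fst x \<in> triangular upper0" "snd x \<in> triangular lower0"
    "letter_weight lower0 i (snd x) = - letter_weight upper0 i (fst x)"
proof -
  obtain h where h: "fst x - \<iota> h \<in> nilpotent_part sc br e" "snd x - \<iota> h \<in> nilpotent_part sc br f"
    using assms unfolding pair_algebra_iff by blast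
  have e: "gens \<circ> GE = e" and f: "gens \<circ> GF = f" by auto
  have neg: "- X = escale (-1) X" and pos: "X = escale 1 X" for X :: "'i list endo"
    by simp_all
  note u = borel_triangular[OF acts0(2), where G = GE and s = "-1", unfolded e, OF _ _ h(1)]
  note l = borel_triangular[OF acts0(1), where G = GF and s = 1, unfolded f, OF _ _ h(2)]
  show "fst x \<in> triangular upper0" by (rule u) simp_all
  show "snd x \<in> triangular lower0" by (rule l) simp_all
  show "letter_weight lower0 i (snd x) = - letter_weight upper0 i (fst x)"
    by (subst u, simp, simp, subst l, simp, simp, simp)
qed

text \<open>
  The forms \<open>letter_coeff upper0 i\<close> and \<open>letter_coeff lower0 i\<close> are the components of \<open>x\<^sub>+\<close> along \<open>e\<^sub>i\<close> and of
  \<open>x\<^sub>-\<close> along \<open>f\<^sub>i\<close>. They vanish on brackets inside the nilpotent parts, and they transform under the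
  common Cartan part of \<open>x\<^sub>+\<close> and \<open>x\<^sub>-\<close> with opposite weights, so that their antisymmetrised product
  is invariant under the Cartan subalgebra. These two facts give the cocycle identity.\<close>

definition standard_cocycle :: "'g \<times> 'g \<Rightarrow> 'g \<times> 'g \<Rightarrow> rat" where
  "standard_cocycle x y = (\<Sum>i\<in>UNIV. letter_coeff upper0 i (fst x) * letter_coeff lower0 i (snd y) -
     letter_coeff upper0 i (fst y) * letter_coeff lower0 i (snd x))"

lemma two_cocycle_standard_cocycle:
  "two_cocycle (prod_scale sc) (prod_br br) (pair_algebra sc br e f \<iota>) standard_cocycle"
  unfolding two_cocycle_def
proof (intro conjI ballI allI)
  fix x y z
  assume xyz: "x \<in> pair_algebra sc br e f \<iota>" "y \<in> pair_algebra sc br e f \<iota>"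
    "z \<in> pair_algebra sc br e f \<iota>"
  note tri = xyz[THEN pair_triangular(1)] xyz[THEN pair_triangular(2)]
  show "standard_cocycle (prod_br br x y) z + standard_cocycle (prod_br br y z) x +
      standard_cocycle (prod_br br z x) y = 0"
    unfolding standard_cocycle_def sum.distrib[symmetric]
    by (rule sum.neutral)
       (simp add: prod_br_def letter_coeff_br acts0 tri pair_triangular(3)[OF xyz(1)]
         pair_triangular(3)[OF xyz(2)] pair_triangular(3)[OF xyz(3)] algebra_simps)
qed (simp_all add: standard_cocycle_def prod_scale_def letter_coeff_linear acts0
       sum.distrib[symmetric] sum_distrib_left algebra_simps)

lemma kashiwara_values_standard_cocycle: "kashiwara_values e f \<iota> standard_cocycle"
proof -
  have gen: "letter_coeff W i (gens g) = Poly_Mapping.lookup (app (W g) 1) [i]" if "acts W" for W i g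
    by (simp add: letter_coeff_def lookup_act[OF that])
  have e: "letter_coeff upper0 i (e j) = (if i = j then 1 else 0)" for i j
    using gen[OF acts0(2), of i "GE j"] by (simp add: lookup_var)
  have f: "letter_coeff lower0 i (f j) = (if i = j then 1 else 0)" for i j
    using gen[OF acts0(1), of i "GF j"] by (simp add: lookup_var)
  have h: "letter_coeff upper0 i (\<iota> h) = 0" "letter_coeff lower0 i (\<iota> h) = 0" for i h
    using gen[OF acts0(2), of i "GT h"] gen[OF acts0(1), of i "GT h"] by simp_all
  show ?thesis
    by (simp add: kashiwara_values_def Let_def standard_cocycle_def e f h
        letter_coeff_linear[OF acts0(1)] letter_coeff_linear[OF acts0(2)]
        if_distrib[of "\<lambda>x. x * _"] sum.delta cong: if_cong)
qed

end

section \<open>A grading element\<close>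

text \<open>
  Induction on the number of functionals: normalise one of them to \<open>a k h0 = 1\<close> and subtract
  multiples of it from the others, so that all are compared on its kernel.\<close>

lemma functional_in_span:
  fixes sT :: "rat \<Rightarrow> 't::ab_group_add \<Rightarrow> 't"
  assumes "finite S"
    and "\<And>j h h'. j \<in> S \<Longrightarrow> a j (h + h') = a j h + (a j h' :: rat)"
    and "\<And>j r h. j \<in> S \<Longrightarrow> a j (sT r h) = r * a j h"
    and "\<And>h h'. b (h + h') = b h + b h'" "\<And>r h. b (sT r h) = r * b h"
    and "\<And>h. (\<And>j. j \<in> S \<Longrightarrow> a j h = 0) \<Longrightarrow> b h = 0"
  shows "\<exists>u. \<forall>h. b h = (\<Sum>j\<in>S. u j * a j h)"
  using assms
proof (induction S arbitrary: a b rule: finite_induct)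
  case (insert k S)
  show ?case
  proof (cases "\<forall>h. a k h = 0")
    case True
    have "\<exists>u. \<forall>h. b h = (\<Sum>j\<in>S. u j * a j h)"
    proof (rule insert.IH)
      fix h assume "\<And>j. j \<in> S \<Longrightarrow> a j h = 0"
      with True show "b h = 0" by (intro insert.prems(5)) auto
    qed (use insert.prems in auto)
    then show ?thesis using True insert.hyps by auto
  next
    case False
    then obtain h1 where h1: "a k h1 \<noteq> 0" by blast
    define h0 where "h0 = sT (1 / a k h1) h1"
    have h0: "a k h0 = 1" using h1 insert.prems(2)[of k] by (simp add: h0_def)
    have "\<exists>u. \<forall>h. b h - b h0 * a k h = (\<Sum>j\<in>S. u j * (a j h - a j h0 * a k h))"
    proof (rule insert.IH)
      fix h assume *: "\<And>j. j \<in> S \<Longrightarrow> a j h - a j h0 * a k h = 0"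
      have "b (h + sT (- a k h) h0) = 0"
        by (rule insert.prems(5)) (use * insert.prems h0 in \<open>auto simp: mult.commute\<close>)
      then show "b h - b h0 * a k h = 0"
        by (simp add: insert.prems mult.commute)
    qed (use insert.prems in \<open>simp_all add: algebra_simps\<close>)
    then obtain u where u: "\<And>h. b h - b h0 * a k h = (\<Sum>j\<in>S. u j * (a j h - a j h0 * a k h))"
      by blast
    let ?u = "u(k := b h0 - (\<Sum>j\<in>S. u j * a j h0))"
    have "(\<Sum>j\<in>S. ?u j * a j h) = (\<Sum>j\<in>S. u j * a j h)" for h
      by (rule sum.cong) (use insert.hyps in auto)
    then have "b h = (\<Sum>j\<in>insert k S. ?u j * a j h)" for h
      using u[of h] insert.hyps
      by (simp add: algebra_simps sum_subtractf sum_distrib_left)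
    then show ?thesis by blast
  qed
qed simp

text \<open>
  Independence of the simple roots gives, for every \<open>i\<close>, an \<open>h\<close> on which only \<open>\<alpha> i\<close> does not vanish; the
  normalised sum of these elements is the grading element.\<close>

lemma (in cartan_realization) exists_grading_element: "\<exists>\<rho>. \<forall>i. \<alpha> i \<rho> = 1"
proof -
  have "\<exists>h. \<alpha> i h \<noteq> 0 \<and> (\<forall>j. j \<noteq> i \<longrightarrow> \<alpha> j h = 0)" for i
  proof (rule ccontr)
    assume *: "\<not> ?thesis"
    have "\<exists>u. \<forall>h. \<alpha> i h = (\<Sum>j\<in>UNIV - {i}. u j * \<alpha> j h)"
      by (rule functional_in_span[where sT = sT]) (use * in \<open>auto simp: root_add root_scale\<close>)
    then obtain u where u: "\<And>h. \<alpha> i h = (\<Sum>j\<in>UNIV - {i}. u j * \<alpha> j h)" by blast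
    have "(\<Sum>j\<in>UNIV. (u(i := -1)) j * \<alpha> j h) = 0" for h
    proof -
      have "(\<Sum>j\<in>UNIV - {i}. (u(i := -1)) j * \<alpha> j h) = (\<Sum>j\<in>UNIV - {i}. u j * \<alpha> j h)"
        by (rule sum.cong) auto
      then show ?thesis using u[of h] by (simp add: sum.remove[of UNIV i])
    qed
    from roots_independent[OF allI, OF this, of i] show False by simp
  qed
  then obtain g where g: "\<And>i. \<alpha> i (g i) \<noteq> 0" "\<And>i j. j \<noteq> i \<Longrightarrow> \<alpha> j (g i) = 0" by metis
  have sum: "\<alpha> i (sum k X) = (\<Sum>x\<in>X. \<alpha> i (k x))" for i k and X :: "'i set"
    using root_scale[of i 0 0] by (induction X rule: infinite_finite_induct) (simp_all add: root_add)
  have "\<alpha> i (\<Sum>j\<in>UNIV. sT (1 / \<alpha> j (g j)) (g j)) = 1" for i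
  proof -
    have "(\<Sum>j\<in>UNIV. \<alpha> i (g j) / \<alpha> j (g j)) = (\<Sum>j\<in>UNIV. if j = i then 1 else 0)"
      by (rule sum.cong) (use g in auto)
    then show ?thesis by (simp add: sum root_scale)
  qed
  then show ?thesis by blast
qed


section \<open>Free algebras and quotient algebras\<close>

lemma free_alg_simps [simp]:
  "carrier (free_alg S) = {p. \<forall>w \<in> Poly_Mapping.keys p. set w \<subseteq> S}"
  "mult (free_alg S) = (*)" "one (free_alg S) = 1" "zero (free_alg S) = 0"
  "add (free_alg S) = (+)" "smult (free_alg S) = qscale"
  by (simp_all add: free_alg_def)

lemma free_alg_closed:
  shows "p \<in> carrier (free_alg S) \<Longrightarrow> q \<in> carrier (free_alg S) \<Longrightarrow> p + q \<in> carrier (free_alg S)"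
    and "p \<in> carrier (free_alg S) \<Longrightarrow> q \<in> carrier (free_alg S) \<Longrightarrow> p * q \<in> carrier (free_alg S)"
    and "p \<in> carrier (free_alg S) \<Longrightarrow> - p \<in> carrier (free_alg S)"
    and "p \<in> carrier (free_alg S) \<Longrightarrow> q \<in> carrier (free_alg S) \<Longrightarrow> p - q \<in> carrier (free_alg S)"
    and "p \<in> carrier (free_alg S) \<Longrightarrow> qscale r p \<in> carrier (free_alg S)"
proof -
  let ?C = "carrier (free_alg S)"
  show "p \<in> ?C \<Longrightarrow> q \<in> ?C \<Longrightarrow> p + q \<in> ?C" using keys_add[of p q] by auto
  show "p \<in> ?C \<Longrightarrow> - p \<in> ?C" by simp
  show "p \<in> ?C \<Longrightarrow> q \<in> ?C \<Longrightarrow> p - q \<in> ?C" using keys_diff[of p q] by auto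
  show "p \<in> ?C \<Longrightarrow> qscale r p \<in> ?C" by (auto simp: in_keys_iff)
  assume pq: "p \<in> ?C" "q \<in> ?C"
  have "set w \<subseteq> S" if w: "w \<in> Poly_Mapping.keys (p * q)" for w
  proof -
    obtain u v where "u \<in> Poly_Mapping.keys p" "v \<in> Poly_Mapping.keys q" "w = u @ v"
      using w keys_mult[of p q] by (auto simp: plus_list_def)
    then show ?thesis using pq by auto
  qed
  then show "p * q \<in> ?C" by simp
qed

lemma one_free_alg: "1 \<in> carrier (free_alg S)"
  by (simp add: zero_list_def)

lemma var_free_alg: "x \<in> S \<Longrightarrow> var x \<in> carrier (free_alg S)"
  by (simp add: var_def)

lemma ring_free_alg: "ring (free_alg S)"
proof (rule ringI)
  show "abelian_group (free_alg S)"
  proof (rule abelian_groupI)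
    fix x assume "x \<in> carrier (free_alg S)"
    then show "\<exists>y\<in>carrier (free_alg S). y \<oplus>\<^bsub>free_alg S\<^esub> x = \<zero>\<^bsub>free_alg S\<^esub>"
      using free_alg_closed(3) by (intro bexI[of _ "- x"]) auto
  next
    fix x y assume "x \<in> carrier (free_alg S)" "y \<in> carrier (free_alg S)"
    then show "x \<oplus>\<^bsub>free_alg S\<^esub> y \<in> carrier (free_alg S)"
      using free_alg_closed(1) by (simp only: free_alg_simps(5))
  qed (simp_all add: add_ac)
  show "monoid (free_alg S)"
  proof (rule monoidI)
    fix x y assume "x \<in> carrier (free_alg S)" "y \<in> carrier (free_alg S)"
    then show "x \<otimes>\<^bsub>free_alg S\<^esub> y \<in> carrier (free_alg S)"
      using free_alg_closed(2) by (simp only: free_alg_simps(2))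
  qed (simp_all add: mult.assoc one_free_alg zero_list_def)
qed (simp_all add: algebra_simps)

lemma a_inv_free_alg:
  assumes "p \<in> carrier (free_alg S)"
  shows "\<ominus>\<^bsub>free_alg S\<^esub> p = - p"
proof (rule abelian_group.minus_equality[OF ring.is_abelian_group[OF ring_free_alg]])
  show "- p \<in> carrier (free_alg S)" by (rule free_alg_closed(3)[OF assms])
qed (use assms in simp_all)

lemma a_minus_free_alg:
  "p \<in> carrier (free_alg S) \<Longrightarrow> q \<in> carrier (free_alg S) \<Longrightarrow> p \<ominus>\<^bsub>free_alg S\<^esub> q = p - q"
  unfolding a_minus_def by (subst a_inv_free_alg) simp_all

lemma ideal_free_algD:
  assumes "ideal I (free_alg S)"
  shows "p \<in> I \<Longrightarrow> p \<in> carrier (free_alg S)" "0 \<in> I" "p \<in> I \<Longrightarrow> q \<in> I \<Longrightarrow> p + q \<in> I"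
    "p \<in> I \<Longrightarrow> a \<in> carrier (free_alg S) \<Longrightarrow> a * p \<in> I"
    "p \<in> I \<Longrightarrow> a \<in> carrier (free_alg S) \<Longrightarrow> p * a \<in> I"
    "p \<in> I \<Longrightarrow> qscale r p \<in> I" "p \<in> I \<Longrightarrow> - p \<in> I" "p \<in> I \<Longrightarrow> q \<in> I \<Longrightarrow> p - q \<in> I"
proof -
  interpret ideal I "free_alg S" by (rule assms)
  show "p \<in> I \<Longrightarrow> p \<in> carrier (free_alg S)" for p by (rule a_Hcarr)
  show "0 \<in> I" using additive_subgroup.zero_closed[OF ideal.axioms(1)[OF assms]] by simp
  show add: "p + q \<in> I" if "p \<in> I" "q \<in> I" for p q 
    using additive_subgroup.a_closed[OF ideal.axioms(1)[OF assms] that] by simp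
  show left: "a * p \<in> I" if "p \<in> I" "a \<in> carrier (free_alg S)" for a p
    using I_l_closed[OF that] by simp
  show "p * a \<in> I" if "p \<in> I" "a \<in> carrier (free_alg S)" for a p
    using I_r_closed[OF that] by simp
  show scale: "qscale r p \<in> I" if "p \<in> I" for r p
    using left[OF that free_alg_closed(5)[OF one_free_alg, where r = r]]
    by (simp add: qscale_mult_left)
  show minus: "- p \<in> I" if "p \<in> I" for p using scale[OF that, of "-1"] by simp
  show "p - q \<in> I" if "p \<in> I" "q \<in> I" for p q
    using add[OF that(1) minus[OF that(2)]] by simp
qed

lemma ideal_free_algI:
  assumes "P \<subseteq> carrier (free_alg S)" "0 \<in> P" "\<And>p q. p \<in> P \<Longrightarrow> q \<in> P \<Longrightarrow> p + q \<in> P"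
    "\<And>a p. p \<in> P \<Longrightarrow> a \<in> carrier (free_alg S) \<Longrightarrow> a * p \<in> P"
    "\<And>a p. p \<in> P \<Longrightarrow> a \<in> carrier (free_alg S) \<Longrightarrow> p * a \<in> P"
  shows "ideal P (free_alg S)"
proof (rule idealI[OF ring_free_alg])
  have minus: "- p \<in> P" if "p \<in> P" for p
    using assms(4)[OF that free_alg_closed(3)[OF one_free_alg]] by simp
  show "subgroup P (add_monoid (free_alg S))"
  proof (rule subgroup.intro)
    fix p assume p: "p \<in> P"
    have "inv\<^bsub>add_monoid (free_alg S)\<^esub> p = - p"
      using a_inv_free_alg[of p S] p assms(1) unfolding a_inv_def by blast
    then show "inv\<^bsub>add_monoid (free_alg S)\<^esub> p \<in> P" using minus[OF p] by (simp only:)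
  qed (use assms in simp_all)
qed (use assms in simp_all)

text \<open>
  Since scalars act through multiples of the unit, ideals are closed under scalars and quotients
  inherit the scalar multiplication.\<close>

definition unital_algebra :: "'a qalg \<Rightarrow> bool" where
  "unital_algebra A \<longleftrightarrow> ring A \<and> (\<forall>r. r \<odot>\<^bsub>A\<^esub> \<one>\<^bsub>A\<^esub> \<in> carrier A) \<and>
     (\<forall>r. \<forall>x\<in>carrier A. r \<odot>\<^bsub>A\<^esub> x = (r \<odot>\<^bsub>A\<^esub> \<one>\<^bsub>A\<^esub>) \<otimes>\<^bsub>A\<^esub> x)"

lemma unital_algebra_free_alg: "unital_algebra (free_alg S)"
  unfolding unital_algebra_def free_alg_simps(2,3,6)
  by (intro conjI allI ballI ring_free_alg free_alg_closed(5) one_free_alg)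
     (simp add: qscale_mult_left)

lemma quot_alg_simps [simp]:
  "carrier (A Quot\<^sub>Q I) = carrier (A Quot I)" "mult (A Quot\<^sub>Q I) = mult (A Quot I)"
  "one (A Quot\<^sub>Q I) = one (A Quot I)" "zero (A Quot\<^sub>Q I) = zero (A Quot I)"
  "add (A Quot\<^sub>Q I) = add (A Quot I)"
  "smult (A Quot\<^sub>Q I) = (\<lambda>r X. \<Union>x\<in>X. I +>\<^bsub>A\<^esub> (r \<odot>\<^bsub>A\<^esub> x))"
  by (simp_all add: quot_alg_def)

text \<open>
  An algebra and its underlying ring are records of different types, so facts about
  \<^const>\<open>FactRing\<close> reach \<^const>\<open>quot_alg\<close> only through their common fields.\<close>

lemma ring_transfer:
  assumes "carrier R = carrier S" "mult R = mult S" "one R = one S" "zero R = zero S" "add R = add S"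
  shows "ring R \<longleftrightarrow> ring S" "ideal I R \<longleftrightarrow> ideal I S" "ring_hom R T = ring_hom S T"
    "ring_hom T' R = ring_hom T' S"
proof -
  show r: "ring R \<longleftrightarrow> ring S"
    by (simp only: ring_def ring_axioms_def abelian_group_def abelian_monoid_def
        abelian_group_axioms_def monoid_def comm_monoid_def comm_monoid_axioms_def comm_group_def
        group_def group_axioms_def Units_def partial_object.simps monoid.simps assms)
  show "ideal I R \<longleftrightarrow> ideal I S"
    by (simp only: ideal_def additive_subgroup_def ideal_axioms_def r subgroup_def m_inv_def
        partial_object.simps monoid.simps assms)
  show "ring_hom R T = ring_hom S T" "ring_hom T' R = ring_hom T' S"
    by (simp_all only: ring_hom_def assms)
qed

lemmas quot_alg_transfer = ring_transfer[OF quot_alg_simps(1-5)]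

lemma ring_quot_alg: "ideal I A \<Longrightarrow> ring (A Quot\<^sub>Q I)"
  by (simp add: quot_alg_transfer ideal.quotient_is_ring)

lemma smult_quot_alg:
  assumes "ideal I A" "unital_algebra A" "x \<in> carrier A"
  shows "r \<odot>\<^bsub>A Quot\<^sub>Q I\<^esub> (I +>\<^bsub>A\<^esub> x) = I +>\<^bsub>A\<^esub> (r \<odot>\<^bsub>A\<^esub> x)"
proof -
  interpret ideal I A by (rule assms)
  have s1: "r \<odot>\<^bsub>A\<^esub> \<one>\<^bsub>A\<^esub> \<in> carrier A" for r
    using assms(2) unfolding unital_algebra_def by blast
  have s2: "r \<odot>\<^bsub>A\<^esub> y = (r \<odot>\<^bsub>A\<^esub> \<one>\<^bsub>A\<^esub>) \<otimes>\<^bsub>A\<^esub> y" if "y \<in> carrier A" for r y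
    using assms(2) that unfolding unital_algebra_def by blast
  have "I +>\<^bsub>A\<^esub> (r \<odot>\<^bsub>A\<^esub> y) = I +>\<^bsub>A\<^esub> (r \<odot>\<^bsub>A\<^esub> x)" if y: "y \<in> I +>\<^bsub>A\<^esub> x" for y
  proof -
    have yc: "y \<in> carrier A"
      using y a_r_coset_subset_G[OF a_subset assms(3)] by blast
    have "I +>\<^bsub>A\<^esub> x = I +>\<^bsub>A\<^esub> y"
      by (rule a_repr_independence[OF y assms(3) a_subgroup])
    then have "y \<ominus>\<^bsub>A\<^esub> x \<in> I"
      using quotient_eq_iff_same_a_r_cos[OF assms(1) yc assms(3)] by simp
    then have "(r \<odot>\<^bsub>A\<^esub> \<one>\<^bsub>A\<^esub>) \<otimes>\<^bsub>A\<^esub> (y \<ominus>\<^bsub>A\<^esub> x) \<in> I"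
      by (rule I_l_closed[OF _ s1])
    then have "(r \<odot>\<^bsub>A\<^esub> y) \<ominus>\<^bsub>A\<^esub> (r \<odot>\<^bsub>A\<^esub> x) \<in> I"
      unfolding s2[OF yc] s2[OF assms(3)] using s1 yc assms(3) by (simp add: a_minus_def r_distr r_minus)
    moreover have "r \<odot>\<^bsub>A\<^esub> y \<in> carrier A" "r \<odot>\<^bsub>A\<^esub> x \<in> carrier A"
      unfolding s2[OF yc] s2[OF assms(3)] using s1 yc assms(3) by simp_all
    ultimately show ?thesis
      using quotient_eq_iff_same_a_r_cos[OF assms(1)] by blast
  qed
  moreover have "x \<in> I +>\<^bsub>A\<^esub> x" using a_rcos_self[OF assms(3)] .
  ultimately show ?thesis unfolding quot_alg_simps(6) by blast
qed

lemma unital_algebra_quot: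
  assumes "ideal I A" "unital_algebra A"
  shows "unital_algebra (A Quot\<^sub>Q I)"
proof -
  interpret ideal I A by (rule assms)
  have s1: "r \<odot>\<^bsub>A\<^esub> \<one>\<^bsub>A\<^esub> \<in> carrier A" for r
    using assms(2) unfolding unital_algebra_def by blast
  have s2: "r \<odot>\<^bsub>A\<^esub> y = (r \<odot>\<^bsub>A\<^esub> \<one>\<^bsub>A\<^esub>) \<otimes>\<^bsub>A\<^esub> y" if "y \<in> carrier A" for r y
    using assms(2) that unfolding unital_algebra_def by blast
  have one: "\<one>\<^bsub>A Quot\<^sub>Q I\<^esub> = I +>\<^bsub>A\<^esub> \<one>\<^bsub>A\<^esub>" by (simp add: FactRing_def)
  have carr: "carrier (A Quot\<^sub>Q I) = (+>\<^bsub>A\<^esub>) I ` carrier A"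
    by (auto simp: FactRing_def A_RCOSETS_def')
  have mult: "(I +>\<^bsub>A\<^esub> x) \<otimes>\<^bsub>A Quot\<^sub>Q I\<^esub> (I +>\<^bsub>A\<^esub> y) = I +>\<^bsub>A\<^esub> (x \<otimes>\<^bsub>A\<^esub> y)"
    if "x \<in> carrier A" "y \<in> carrier A" for x y
    using that by (simp add: FactRing_def rcoset_mult_add)
  have smult: "r \<odot>\<^bsub>A Quot\<^sub>Q I\<^esub> (I +>\<^bsub>A\<^esub> x) = I +>\<^bsub>A\<^esub> (r \<odot>\<^bsub>A\<^esub> x)" if "x \<in> carrier A" for r x
    by (rule smult_quot_alg[OF assms that])
  show ?thesis
    unfolding unital_algebra_def one carr smult[OF one_closed]
  proof (intro conjI allI ballI)
    show "I +>\<^bsub>A\<^esub> (r \<odot>\<^bsub>A\<^esub> \<one>\<^bsub>A\<^esub>) \<in> (+>\<^bsub>A\<^esub>) I ` carrier A" for r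
      using s1 by blast
    fix r X assume "X \<in> (+>\<^bsub>A\<^esub>) I ` carrier A"
    then obtain x where x: "x \<in> carrier A" "X = I +>\<^bsub>A\<^esub> x" by blast
    show "r \<odot>\<^bsub>A Quot\<^sub>Q I\<^esub> X = (I +>\<^bsub>A\<^esub> (r \<odot>\<^bsub>A\<^esub> \<one>\<^bsub>A\<^esub>)) \<otimes>\<^bsub>A Quot\<^sub>Q I\<^esub> X"
      unfolding x(2) smult[OF x(1)] mult[OF s1 x(1)] using s2[OF x(1)] by simp
  qed (rule ring_quot_alg[OF assms(1)])
qed

lemma alg_isomorphic_quotI:
  assumes "ideal K A" "unital_algebra A" "ring B" "h \<in> ring_hom A B" "h ` carrier A = carrier B"
    and ker: "\<And>x. x \<in> carrier A \<Longrightarrow> h x = \<zero>\<^bsub>B\<^esub> \<longleftrightarrow> x \<in> K"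
    and smult: "\<And>r x. x \<in> carrier A \<Longrightarrow> h (r \<odot>\<^bsub>A\<^esub> x) = r \<odot>\<^bsub>B\<^esub> h x"
  shows "A Quot\<^sub>Q K \<simeq>\<^sub>Q B"
proof -
  interpret ideal K A by (rule assms)
  interpret h: ring_hom_ring A B h
    by (rule ring_hom_ringI2) (use assms ring_axioms in auto)
  have K: "a_kernel A B h = K"
    unfolding a_kernel_def' using ker a_Hcarr by blast
  let ?\<phi> = "\<lambda>X. the_elem (h ` X)"
  have "?\<phi> \<in> ring_iso (A Quot K) B"
    using h.FactRing_iso_set[OF assms(5)] unfolding K .
  then have iso: "?\<phi> \<in> ring_iso (A Quot\<^sub>Q K) B"
    by (simp only: ring_iso_def quot_alg_transfer quot_alg_simps(1))
  have smult_iso: "?\<phi> (r \<odot>\<^bsub>A Quot\<^sub>Q K\<^esub> X) = r \<odot>\<^bsub>B\<^esub> ?\<phi> X" if X: "X \<in> carrier (A Quot\<^sub>Q K)" for r X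
  proof -
    obtain x where x: "x \<in> carrier A" "X = K +>\<^bsub>A\<^esub> x"
      using X by (auto simp: FactRing_def A_RCOSETS_def')
    have e: "r \<odot>\<^bsub>A\<^esub> x = (r \<odot>\<^bsub>A\<^esub> \<one>\<^bsub>A\<^esub>) \<otimes>\<^bsub>A\<^esub> x" "r \<odot>\<^bsub>A\<^esub> \<one>\<^bsub>A\<^esub> \<in> carrier A"
      using assms(2) x(1) unfolding unital_algebra_def by blast+
    have rx: "r \<odot>\<^bsub>A\<^esub> x \<in> carrier A"
      by (subst e(1)) (rule m_closed[OF e(2) x(1)])
    show ?thesis
      unfolding x(2) smult_quot_alg[OF assms(1,2) x(1)]
        h.the_elem_simp[unfolded K, OF x(1)] h.the_elem_simp[unfolded K, OF rx]
      by (rule smult[OF x(1)])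
  qed
  show ?thesis
    unfolding alg_isomorphic_def
    by (rule bexI[OF _ iso]) (intro allI ballI smult_iso)
qed


section \<open>Sridharan algebras as quotients of free algebras\<close>

text \<open>
  The Sridharan algebra is defined as a quotient of a quotient. It is handled as one quotient of the
  free algebra, by the kernel of the composed projection; \<open>S_contains\<close> and \<open>S_least\<close> describe this
  kernel as the smallest ideal containing the linear relations and the deformed commutator relations,
  so that all computations take place with noncommutative polynomials.\<close>

definition linear_gens :: "(rat \<Rightarrow> 'v \<Rightarrow> 'v) \<Rightarrow> 'v set \<Rightarrow> ('v::ab_group_add list \<Rightarrow>\<^sub>0 rat) set" where
  "linear_gens sc L = {var (x + y) - var x - var y | x y. x \<in> L \<and> y \<in> L} \<union>
      {var (sc r x) - qscale r (var x) | r x. x \<in> L}"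

definition sridharan_gens ::
    "('v \<Rightarrow> 'v \<Rightarrow> 'v) \<Rightarrow> 'v set \<Rightarrow> ('v \<Rightarrow> 'v \<Rightarrow> rat) \<Rightarrow> ('v::ab_group_add list \<Rightarrow>\<^sub>0 rat) set" where
  "sridharan_gens br L c =
     {comm (var x) (var y) - var (br x y) - qscale (c x y) 1 | x y. x \<in> L \<and> y \<in> L}"

definition sridharan_proj where
  "sridharan_proj sc br L c p =
     Idl\<^bsub>tensor_algebra sc L\<^esub>
       {tensor_incl sc L x \<otimes>\<^bsub>tensor_algebra sc L\<^esub> tensor_incl sc L y
          \<ominus>\<^bsub>tensor_algebra sc L\<^esub> tensor_incl sc L y \<otimes>\<^bsub>tensor_algebra sc L\<^esub> tensor_incl sc L x
          \<ominus>\<^bsub>tensor_algebra sc L\<^esub> tensor_incl sc L (br x y)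
          \<ominus>\<^bsub>tensor_algebra sc L\<^esub> c x y \<odot>\<^bsub>tensor_algebra sc L\<^esub> \<one>\<^bsub>tensor_algebra sc L\<^esub> | x y.
          x \<in> L \<and> y \<in> L}
     +>\<^bsub>tensor_algebra sc L\<^esub> (tensor_ideal sc L +>\<^bsub>free_alg L\<^esub> p)"

definition sridharan_ideal where
  "sridharan_ideal sc br L c = {p \<in> carrier (free_alg L).
     sridharan_proj sc br L c p = \<zero>\<^bsub>sridharan_algebra sc br L c\<^esub>}"

locale sridharan_data =
  fixes sc :: "rat \<Rightarrow> 'v::ab_group_add \<Rightarrow> 'v" and br :: "'v \<Rightarrow> 'v \<Rightarrow> 'v" and L :: "'v set"
    and c :: "'v \<Rightarrow> 'v \<Rightarrow> rat"
  assumes L_add: "x \<in> L \<Longrightarrow> y \<in> L \<Longrightarrow> x + y \<in> L"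
    and L_scale: "x \<in> L \<Longrightarrow> sc r x \<in> L"
    and L_br: "x \<in> L \<Longrightarrow> y \<in> L \<Longrightarrow> br x y \<in> L"
begin

abbreviation "C \<equiv> free_alg L"
abbreviation "I \<equiv> tensor_ideal sc L"
abbreviation "T \<equiv> tensor_algebra sc L"
abbreviation "\<pi> p \<equiv> I +>\<^bsub>C\<^esub> p"
abbreviation "rels \<equiv> {tensor_incl sc L x \<otimes>\<^bsub>T\<^esub> tensor_incl sc L y
          \<ominus>\<^bsub>T\<^esub> tensor_incl sc L y \<otimes>\<^bsub>T\<^esub> tensor_incl sc L x
          \<ominus>\<^bsub>T\<^esub> tensor_incl sc L (br x y) \<ominus>\<^bsub>T\<^esub> c x y \<odot>\<^bsub>T\<^esub> \<one>\<^bsub>T\<^esub> | x y.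
          x \<in> L \<and> y \<in> L}"
abbreviation "J \<equiv> Idl\<^bsub>T\<^esub> rels"
abbreviation "U \<equiv> sridharan_algebra sc br L c"
abbreviation "proj \<equiv> sridharan_proj sc br L c"

lemma U_eq: "U = T Quot\<^sub>Q J"
  by (simp only: sridharan_algebra_def Let_def)

lemma proj_eq: "proj p = J +>\<^bsub>T\<^esub> \<pi> p"
  by (simp only: sridharan_proj_def)

lemma linear_gens_carrier: "linear_gens sc L \<subseteq> carrier C"
  unfolding linear_gens_def
  by (auto intro!: free_alg_closed(4,5) var_free_alg L_add L_scale simp del: free_alg_simps)

lemma sridharan_gens_carrier: "sridharan_gens br L c \<subseteq> carrier C"
  unfolding sridharan_gens_def comm_def
  by (auto intro!: free_alg_closed(2,4,5) var_free_alg L_br one_free_alg[of L] simp del: free_alg_simps)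

lemma I_eq: "I = Idl\<^bsub>C\<^esub> (linear_gens sc L)"
  by (simp only: tensor_ideal_def linear_gens_def)

lemma ideal_I: "ideal I C"
  unfolding I_eq by (rule ring.genideal_ideal[OF ring_free_alg linear_gens_carrier])

lemma unital_T: "unital_algebra T"
  unfolding tensor_algebra_def by (rule unital_algebra_quot[OF ideal_I unital_algebra_free_alg])

lemma ring_T: "ring T"
  using unital_T by (simp add: unital_algebra_def)

lemma carrier_T: "carrier T = \<pi> ` carrier C"
  by (auto simp: tensor_algebra_def FactRing_def A_RCOSETS_def')

lemma \<pi>_hom: "ring_hom_ring C T (\<lambda>p. \<pi> p)"
  using ideal.rcos_ring_hom[OF ideal_I]
  by (intro ring_hom_ringI2 ring_free_alg ring_T) (simp add: tensor_algebra_def quot_alg_transfer)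

sublocale \<pi>: ring_hom_ring C T "\<lambda>p. \<pi> p"
  by (rule \<pi>_hom)

lemma rels_eq: "rels = (\<lambda>p. \<pi> p) ` sridharan_gens br L c"
proof -
  have "tensor_incl sc L x \<otimes>\<^bsub>T\<^esub> tensor_incl sc L y
          \<ominus>\<^bsub>T\<^esub> tensor_incl sc L y \<otimes>\<^bsub>T\<^esub> tensor_incl sc L x
          \<ominus>\<^bsub>T\<^esub> tensor_incl sc L (br x y) \<ominus>\<^bsub>T\<^esub> c x y \<odot>\<^bsub>T\<^esub> \<one>\<^bsub>T\<^esub> =
     \<pi> (comm (var x) (var y) - var (br x y) - qscale (c x y) 1)" if "x \<in> L" "y \<in> L" for x y
  proof -
    have cl: "var x \<in> carrier C" "var y \<in> carrier C" "var (br x y) \<in> carrier C"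
      "qscale (c x y) 1 \<in> carrier C"
      using that by (auto intro!: var_free_alg L_br free_alg_closed(5) one_free_alg[of L] simp del: free_alg_simps)
    have "c x y \<odot>\<^bsub>T\<^esub> \<one>\<^bsub>T\<^esub> = \<pi> (qscale (c x y) 1)"
      using smult_quot_alg[OF ideal_I unital_algebra_free_alg one_free_alg, of "c x y"] \<pi>.hom_one
      by (simp add: tensor_algebra_def del: quot_alg_simps)
    moreover have "comm (var x) (var y) - var (br x y) - qscale (c x y) 1 =
        var x \<otimes>\<^bsub>C\<^esub> var y \<ominus>\<^bsub>C\<^esub> var y \<otimes>\<^bsub>C\<^esub> var x \<ominus>\<^bsub>C\<^esub> var (br x y) \<ominus>\<^bsub>C\<^esub> qscale (c x y) 1"
      by (simp only: comm_def free_alg_simps(2) a_minus_free_alg free_alg_closed(2,4) cl)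
    ultimately show ?thesis
      using cl unfolding tensor_incl_def
      by (simp add: a_minus_def \<pi>.hom_add \<pi>.hom_mult \<pi>.hom_a_inv del: free_alg_simps)
  qed
  then show ?thesis unfolding sridharan_gens_def by (auto simp: image_iff) metis+
qed

lemma ideal_J: "ideal J T"
  by (rule ring.genideal_ideal[OF ring_T])
     (unfold rels_eq, use sridharan_gens_carrier in \<open>auto simp del: free_alg_simps intro!: \<pi>.hom_closed\<close>)

lemma ring_U: "ring U"
  unfolding U_eq by (rule ring_quot_alg[OF ideal_J])

lemma proj_hom: "proj \<in> ring_hom C U"
proof -
  have "(+>\<^bsub>T\<^esub>) J \<in> ring_hom T U"
    using ideal.rcos_ring_hom[OF ideal_J] unfolding U_eq by (simp add: quot_alg_transfer)
  from ring_hom_trans[OF \<pi>.homh this] show ?thesis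
    by (simp add: o_def proj_eq[abs_def])
qed

lemma proj_surj: "proj ` carrier C = carrier U"
proof -
  have "carrier U = (+>\<^bsub>T\<^esub>) J ` carrier T"
    unfolding U_eq by (auto simp: FactRing_def A_RCOSETS_def')
  then show ?thesis by (simp only: carrier_T image_image proj_eq[abs_def])
qed

lemma proj_smult:
  assumes "p \<in> carrier C"
  shows "proj (qscale r p) = r \<odot>\<^bsub>U\<^esub> proj p"
proof -
  have "r \<odot>\<^bsub>T\<^esub> \<pi> p = \<pi> (qscale r p)"
    using smult_quot_alg[OF ideal_I unital_algebra_free_alg assms, of r]
    by (simp add: tensor_algebra_def del: quot_alg_simps)
  moreover have "r \<odot>\<^bsub>U\<^esub> proj p = J +>\<^bsub>T\<^esub> (r \<odot>\<^bsub>T\<^esub> \<pi> p)"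
    unfolding U_eq proj_eq by (rule smult_quot_alg[OF ideal_J unital_T \<pi>.hom_closed[OF assms]])
  ultimately show ?thesis by (simp add: proj_eq)
qed

abbreviation "S \<equiv> sridharan_ideal sc br L c"

lemma ideal_S: "ideal S C"
proof -
  interpret p: ring_hom_ring C U proj
    by (rule ring_hom_ringI2[OF ring_free_alg ring_U proj_hom])
  have "S = a_kernel C U proj"
    unfolding sridharan_ideal_def a_kernel_def' ..
  then show ?thesis using p.kernel_is_ideal by (simp only:)
qed

lemma S_iff:
  assumes "p \<in> carrier C"
  shows "p \<in> S \<longleftrightarrow> \<pi> p \<in> J"
proof -
  interpret J: ideal J T by (rule ideal_J)
  have "proj p = \<zero>\<^bsub>U\<^esub> \<longleftrightarrow> J +>\<^bsub>T\<^esub> \<pi> p = J"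
    unfolding U_eq proj_eq by (simp add: FactRing_def)
  also have "\<dots> \<longleftrightarrow> \<pi> p \<in> J"
  proof
    show "J +>\<^bsub>T\<^esub> \<pi> p = J \<Longrightarrow> \<pi> p \<in> J"
      using J.a_rcos_self[OF \<pi>.hom_closed[OF assms]] by (simp only:)
  qed (rule J.a_rcos_const)
  finally show ?thesis using assms by (simp only: sridharan_ideal_def mem_Collect_eq simp_thms)
qed

lemma S_contains: "linear_gens sc L \<subseteq> S" "sridharan_gens br L c \<subseteq> S"
proof -
  interpret I: ideal I C by (rule ideal_I)
  interpret J: ideal J T by (rule ideal_J)
  show "linear_gens sc L \<subseteq> S"
  proof
    fix p assume p: "p \<in> linear_gens sc L"
    then have "p \<in> I"
      unfolding I_eq using ring.genideal_self[OF ring_free_alg linear_gens_carrier] by blast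
    then have "\<pi> p = \<zero>\<^bsub>T\<^esub>"
      by (simp add: I.a_rcos_const tensor_algebra_def FactRing_def)
    then show "p \<in> S"
      using p linear_gens_carrier J.zero_closed by (subst S_iff) auto
  qed
  show "sridharan_gens br L c \<subseteq> S"
  proof
    fix p assume p: "p \<in> sridharan_gens br L c"
    have "rels \<subseteq> carrier T"
      unfolding rels_eq using sridharan_gens_carrier
      by (auto simp del: free_alg_simps intro!: \<pi>.hom_closed)
    from ring.genideal_self[OF ring_T this] have "\<pi> p \<in> J"
      using p unfolding rels_eq by blast
    then show "p \<in> S"
      using p sridharan_gens_carrier by (subst S_iff) auto
  qed
qed

text \<open>
  The image of \<open>P\<close> in the tensor algebra is an ideal containing the relations of the Sridharan algebra,
  and \<open>P\<close> is the full preimage of its image because it contains the tensor ideal.\<close>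

lemma S_least:
  assumes P: "ideal P C" "linear_gens sc L \<subseteq> P" "sridharan_gens br L c \<subseteq> P"
  shows "S \<subseteq> P"
proof
  fix p assume p: "p \<in> S"
  interpret I: ideal I C by (rule ideal_I)
  interpret P: ideal P C by (rule P)
  have IP: "I \<subseteq> P"
    unfolding I_eq by (rule ring.genideal_minimal[OF ring_free_alg P(1,2)])
  have "ideal (((+>\<^bsub>C\<^esub>) I) ` P) (C Quot I)"
    by (rule ring.ring_ideal_imp_quot_ideal[OF ring_free_alg ideal_I P(1)])
  then have "ideal ((\<lambda>p. \<pi> p) ` P) T"
    by (simp add: tensor_algebra_def quot_alg_transfer)
  then have "J \<subseteq> (\<lambda>p. \<pi> p) ` P"
    by (rule ring.genideal_minimal[OF ring_T]) (unfold rels_eq, use P(3) in blast)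
  moreover have pc: "p \<in> carrier C" using p by (simp only: sridharan_ideal_def) blast
  ultimately obtain p' where p': "p' \<in> P" "\<pi> p = \<pi> p'" using p S_iff by blast
  have "p \<ominus>\<^bsub>C\<^esub> p' \<in> I"
    using ring.quotient_eq_iff_same_a_r_cos[OF ring_free_alg ideal_I pc P.a_Hcarr[OF p'(1)]] p'(2) by simp
  then have "p - p' \<in> P"
    using IP a_minus_free_alg[OF pc P.a_Hcarr[OF p'(1)]] by auto
  then show "p \<in> P" using ideal_free_algD(3)[OF P(1) _ p'(1), of "p - p'"] by simp
qed

end


section \<open>Weights of Lie words\<close>

context rat_vector_space
begin

lemma eigenvectors_sum_zero:
  assumes "finite V" "\<And>x y. D (x + y) = D x + D y" "\<And>r x. D (sc r x) = sc r (D x)"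
    and "\<And>t. t \<in> V \<Longrightarrow> D (y t) = sc t (y t)" "sum y V = 0" "t \<in> V"
  shows "y t = 0"
  using assms(1,4-)
proof (induction V arbitrary: y t rule: finite_induct)
  case (insert u V)
  have D0: "D 0 = 0" using assms(3)[of 0 0] by simp
  have Dsum: "D (sum y V) = (\<Sum>t\<in>V. sc t (y t))"
  proof -
    have "D (sum y W) = (\<Sum>t\<in>W. D (y t))" for W
      by (induction W rule: infinite_finite_induct) (simp_all add: D0 assms(2))
    then show ?thesis using insert.prems(1) by simp
  qed
  have yu: "y u = - sum y V"
    using insert.prems(2) insert.hyps by (simp add: eq_neg_iff_add_eq_0)
  have "D (sum y V) = sc u (sum y V)"
    using insert.prems(1)[of u] assms(3)[of "-1" "sum y V"] by (simp add: yu)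
  then have sum: "(\<Sum>t\<in>V. sc (t - u) (y t)) = 0"
    by (simp add: scale_left_diff_distrib sum_subtractf Dsum scale_sum_right)
  have V: "y t = 0" if "t \<in> V" for t
  proof -
    have "sc (t - u) (y t) = 0"
    proof (rule insert.IH[OF _ sum that])
      show "D (sc (t - u) (y t)) = sc t (sc (t - u) (y t))" if "t \<in> V" for t
        using insert.prems(1)[of t] that by (simp add: assms(3) mult.commute)
    qed
    moreover have "t \<noteq> u" using that insert.hyps by blast
    ultimately show ?thesis by simp
  qed
  then have "y u = 0" using yu by (simp add: sum.neutral)
  with V insert.prems(3) show ?case by blast
qed simp

text \<open>
  A linear relation among eigenvectors splits into one relation for each eigenvalue, so it survives when
  every eigenvector is multiplied by a function of its eigenvalue.\<close>

lemma lin_eigenvectors_reweight: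
  assumes "\<And>x y. D (x + y) = D x + D y" "\<And>r x. D (sc r x) = sc r (D x)"
    and "\<And>m. D (x m) = sc (\<kappa> m) (x m)" "lin_ext sc x p = 0"
  shows "lin_ext sc (\<lambda>m. sc (g (\<kappa> m)) (x m)) p = 0"
proof -
  let ?K = "Poly_Mapping.keys p" and ?c = "Poly_Mapping.lookup p"
  define y where "y t = (\<Sum>m\<in>{m \<in> ?K. \<kappa> m = t}. sc (?c m) (x m))" for t
  have D0: "D 0 = 0" using assms(2)[of 0 0] by simp
  have "sum y (\<kappa> ` ?K) = 0"
    using assms(4) unfolding y_def lin_ext_def by (subst (asm) sum.image_gen[of _ _ \<kappa>]) simp_all
  moreover have "D (y t) = sc t (y t)" for t
  proof -
    have "D (\<Sum>m\<in>M. sc (?c m) (x m)) = (\<Sum>m\<in>M. D (sc (?c m) (x m)))" for M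
      by (induction M rule: infinite_finite_induct) (simp_all add: D0 assms(1))
    then show ?thesis
      by (simp add: y_def assms(2,3) scale_sum_right mult.commute)
  qed
  ultimately have y: "y t = 0" if "t \<in> \<kappa> ` ?K" for t
    by (intro eigenvectors_sum_zero[where V = "\<kappa> ` ?K" and D = D and y = y]) (use assms that in auto)
  have "lin_ext sc (\<lambda>m. sc (g (\<kappa> m)) (x m)) p =
      (\<Sum>t\<in>\<kappa> ` ?K. \<Sum>m\<in>{m \<in> ?K. \<kappa> m = t}. sc (?c m) (sc (g (\<kappa> m)) (x m)))"
    unfolding lin_ext_def by (rule sum.image_gen) simp
  also have "\<dots> = (\<Sum>t\<in>\<kappa> ` ?K. sc (g t) (y t))"
    unfolding y_def scale_sum_right by (intro sum.cong) (auto simp: mult.commute)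
  also have "\<dots> = 0" using y by (simp add: sum.neutral)
  finally show ?thesis .
qed

end

context cartan_realization
begin

primrec word_weight :: "'t \<Rightarrow> 'i magma \<Rightarrow> rat" where
  "word_weight h (Leaf i) = \<alpha> i h"
| "word_weight h (Node m m') = word_weight h m + word_weight h m'"

definition grading_element :: 't where
  "grading_element = (SOME \<rho>. \<forall>i. \<alpha> i \<rho> = 1)"

lemma root_grading_element [simp]: "\<alpha> i grading_element = 1"
  using someI_ex[OF exists_grading_element] by (simp add: grading_element_def)

lemma word_weight_grading_element_pos: "word_weight grading_element m > 0"
  by (induction m) simp_all

end


section \<open>Brackets in the algebra of pairs\<close>

lemma magma_eval_prod:
  "magma_eval (prod_br br) v m = (magma_eval br (fst \<circ> v) m, magma_eval br (snd \<circ> v) m)"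
  by (induction m) (simp_all add: prod_br_def)

lemma (in lie_algebra) magma_eval_zero: "magma_eval br (\<lambda>_. 0) m = 0"
  by (induction m) simp_all

lemma (in lie_algebra) lie_eval_prod:
  "lie_eval (prod_scale sc) (prod_br br) v p =
     (lie_eval sc br (fst \<circ> v) p, lie_eval sc br (snd \<circ> v) p)"
  unfolding lie_eval_def magma_eval_prod prod_scale_def
  by (rule prod_eqI) (simp_all add: fst_sum snd_sum)

lemma (in lie_algebra) lie_eval_const_zero: "lie_eval sc br (\<lambda>_. 0) p = 0"
  by (simp add: lie_eval_def magma_eval_zero)

context symmetrizable_kac_moody_algebra
begin

lemma lie_eval_relation:
  "p \<in> kac_moody_relations sT A \<alpha> hc \<Longrightarrow> lie_eval sc br gens p = 0"
  unfolding lie_eval_eq_zero_iff by (rule lie_relation_ideal.relation)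

lemmas lie_eval_simps = Lie.lie_eval_add Lie.lie_eval_diff Lie.lie_eval_qscale Lie.lie_eval_mbr
  Lie.lie_eval_funpow Lie.lie_eval_mvar Lie.lie_eval_zero

lemma cartan_add: "\<iota> (h + h') = \<iota> h + \<iota> h'"
  and cartan_scale: "\<iota> (sT r h) = sc r (\<iota> h)"
  and br_cartan: "br (\<iota> h) (\<iota> h') = 0"
  and br_cartan_e: "br (\<iota> h) (e i) = sc (\<alpha> i h) (e i)"
  and br_cartan_f: "br (\<iota> h) (f i) = sc (- \<alpha> i h) (f i)"
  and serre_e: "i \<noteq> j \<Longrightarrow> (br (e i) ^^ nat (1 - A i j)) (e j) = 0"
  and serre_f: "i \<noteq> j \<Longrightarrow> (br (f i) ^^ nat (1 - A i j)) (f j) = 0"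
proof -
  let ?R = "kac_moody_relations sT A \<alpha> hc"
  have "mvar (GT (h + h')) - mvar (GT h) - mvar (GT h') \<in> ?R"
    unfolding kac_moody_relations_def Let_def by blast
  from lie_eval_relation[OF this] show "\<iota> (h + h') = \<iota> h + \<iota> h'"
    by (simp add: lie_eval_simps algebra_simps)
  have "mvar (GT (sT r h)) - qscale r (mvar (GT h)) \<in> ?R"
    unfolding kac_moody_relations_def Let_def by blast
  from lie_eval_relation[OF this] show "\<iota> (sT r h) = sc r (\<iota> h)"
    by (simp add: lie_eval_simps)
  have "mbr (mvar (GT h)) (mvar (GT h')) \<in> ?R"
    unfolding kac_moody_relations_def Let_def by blast
  from lie_eval_relation[OF this] show "br (\<iota> h) (\<iota> h') = 0"
    by (simp add: lie_eval_simps)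
  have "mbr (mvar (GT h)) (mvar (GE i)) - qscale (\<alpha> i h) (mvar (GE i)) \<in> ?R"
    unfolding kac_moody_relations_def Let_def by blast
  from lie_eval_relation[OF this] show "br (\<iota> h) (e i) = sc (\<alpha> i h) (e i)"
    by (simp add: lie_eval_simps)
  have "mbr (mvar (GT h)) (mvar (GF i)) + qscale (\<alpha> i h) (mvar (GF i)) \<in> ?R"
    unfolding kac_moody_relations_def Let_def by blast
  from lie_eval_relation[OF this] show "br (\<iota> h) (f i) = sc (- \<alpha> i h) (f i)"
    by (simp add: lie_eval_simps eq_neg_iff_add_eq_0)
  assume ij: "i \<noteq> j"
  have "(mbr (mvar (GE i)) ^^ nat (1 - A i j)) (mvar (GE j)) \<in> ?R"
    unfolding kac_moody_relations_def Let_def using ij by blast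
  from lie_eval_relation[OF this] show "(br (e i) ^^ nat (1 - A i j)) (e j) = 0"
    by (simp add: lie_eval_simps)
  have "(mbr (mvar (GF i)) ^^ nat (1 - A i j)) (mvar (GF j)) \<in> ?R"
    unfolding kac_moody_relations_def Let_def using ij by blast
  from lie_eval_relation[OF this] show "(br (f i) ^^ nat (1 - A i j)) (f j) = 0"
    by (simp add: lie_eval_simps)
qed

lemma cartan_zero [simp]: "\<iota> 0 = 0"
  using cartan_scale[of 0 0] by simp

lemma nilpotent_part_closed:
  shows "0 \<in> nilpotent_part sc br g"
    "x \<in> nilpotent_part sc br g \<Longrightarrow> y \<in> nilpotent_part sc br g \<Longrightarrow> x + y \<in> nilpotent_part sc br g"
    "x \<in> nilpotent_part sc br g \<Longrightarrow> y \<in> nilpotent_part sc br g \<Longrightarrow> br x y \<in> nilpotent_part sc br g"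
    "x \<in> nilpotent_part sc br g \<Longrightarrow> sc r x \<in> nilpotent_part sc br g"
    "g i \<in> nilpotent_part sc br g"
  using lie_subalgebra_lie_span[of sc br "range g"] lie_span_superset[of "range g" sc br]
  unfolding nilpotent_part_def lie_subalgebra_def by auto

lemma magma_nilpotent: "magma_eval br g m \<in> nilpotent_part sc br g"
  by (induction m) (simp_all add: nilpotent_part_closed)

text \<open>
  The elements of the nilpotent part that the Cartan subalgebra maps into it form a subalgebra, since
  the bracket with \<open>\<iota> h\<close> is a derivation.\<close>

lemma br_cartan_nilpotent:
  assumes "\<And>i h. br (\<iota> h) (g i) \<in> nilpotent_part sc br g" "x \<in> nilpotent_part sc br g"
  shows "br (\<iota> h) x \<in> nilpotent_part sc br g"
proof -
  let ?N = "nilpotent_part sc br g"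
  have "lie_span sc br (range g) \<subseteq> {x \<in> ?N. br (\<iota> h) x \<in> ?N}"
  proof (rule lie_span_least)
    show "lie_subalgebra sc br {x \<in> ?N. br (\<iota> h) x \<in> ?N}"
      unfolding lie_subalgebra_def
      by (auto simp: nilpotent_part_closed Lie.br_add_right Lie.br_scale_right
          Lie.br_derivation[of "\<iota> h"])
  qed (auto simp: nilpotent_part_closed assms)
  with assms(2) show ?thesis unfolding nilpotent_part_def by blast
qed

abbreviation "\<aa> \<equiv> pair_algebra sc br e f \<iota>"
abbreviation "sc2 \<equiv> prod_scale sc"
abbreviation "br2 \<equiv> prod_br br"
abbreviation "EE i \<equiv> (e i, 0 :: 'g)"
abbreviation "FF i \<equiv> (0 :: 'g, f i)"
abbreviation "HH h \<equiv> (\<iota> h, \<iota> h)"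

sublocale P: lie_algebra "prod_scale sc" "prod_br br"
  by (rule lie_algebra_prod) (rule Lie.lie_algebra_axioms)

lemma pair_gens: "EE i \<in> \<aa>" "FF i \<in> \<aa>" "HH h \<in> \<aa>"
proof -
  show "EE i \<in> \<aa>" unfolding pair_algebra_iff
    by (intro exI[of _ 0]) (simp add: nilpotent_part_closed)
  show "FF i \<in> \<aa>" unfolding pair_algebra_iff
    by (intro exI[of _ 0]) (simp add: nilpotent_part_closed)
  show "HH h \<in> \<aa>" unfolding pair_algebra_iff
    by (intro exI[of _ h]) (simp add: nilpotent_part_closed)
qed

lemma pair_closed:
  shows "x \<in> \<aa> \<Longrightarrow> y \<in> \<aa> \<Longrightarrow> x + y \<in> \<aa>" "x \<in> \<aa> \<Longrightarrow> sc2 r x \<in> \<aa>"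
    "x \<in> \<aa> \<Longrightarrow> y \<in> \<aa> \<Longrightarrow> br2 x y \<in> \<aa>" "0 \<in> \<aa>"
proof -
  show "x + y \<in> \<aa>" if xy: "x \<in> \<aa>" "y \<in> \<aa>"
  proof -
    obtain h h' where "fst x - \<iota> h \<in> nilpotent_part sc br e" "snd x - \<iota> h \<in> nilpotent_part sc br f"
      "fst y - \<iota> h' \<in> nilpotent_part sc br e" "snd y - \<iota> h' \<in> nilpotent_part sc br f"
      using xy unfolding pair_algebra_iff by blast
    then show ?thesis unfolding pair_algebra_iff
      using nilpotent_part_closed(2)[of "fst x - \<iota> h" e "fst y - \<iota> h'"]
        nilpotent_part_closed(2)[of "snd x - \<iota> h" f "snd y - \<iota> h'"]
      by (intro exI[of _ "h + h'"]) (simp add: cartan_add algebra_simps)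
  qed
  show "sc2 r x \<in> \<aa>" if x: "x \<in> \<aa>"
  proof -
    obtain h where "fst x - \<iota> h \<in> nilpotent_part sc br e" "snd x - \<iota> h \<in> nilpotent_part sc br f"
      using x unfolding pair_algebra_iff by blast
    then show ?thesis unfolding pair_algebra_iff
      using nilpotent_part_closed(4)[of "fst x - \<iota> h" e r] nilpotent_part_closed(4)[of "snd x - \<iota> h" f r]
      by (intro exI[of _ "sT r h"]) (simp add: cartan_scale prod_scale_def Lie.scale_right_diff_distrib)
  qed
  show "br2 x y \<in> \<aa>" if xy: "x \<in> \<aa>" "y \<in> \<aa>"
  proof -
    obtain h h' where hh: "fst x - \<iota> h \<in> nilpotent_part sc br e" "snd x - \<iota> h \<in> nilpotent_part sc br f"
      "fst y - \<iota> h' \<in> nilpotent_part sc br e" "snd y - \<iota> h' \<in> nilpotent_part sc br f"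
      using xy unfolding pair_algebra_iff by blast
    have *: "br u v \<in> nilpotent_part sc br g"
      if g: "u - \<iota> h \<in> nilpotent_part sc br g" "v - \<iota> h' \<in> nilpotent_part sc br g"
        "\<And>i h. br (\<iota> h) (g i) \<in> nilpotent_part sc br g" for u v and g :: "'i \<Rightarrow> 'g"
    proof -
      have eq: "br u v = br (u - \<iota> h) (v - \<iota> h') + br (\<iota> h) (v - \<iota> h') + sc (-1) (br (\<iota> h') (u - \<iota> h))"
        using Lie.br_skew[of u "\<iota> h'"]
        by (simp add: Lie.br_diff_left Lie.br_diff_right br_cartan)
      show ?thesis
        unfolding eq
        using nilpotent_part_closed(3)[OF g(1,2)] br_cartan_nilpotent[OF g(3) g(2), of h]
          nilpotent_part_closed(4)[OF br_cartan_nilpotent[OF g(3) g(1), of h'], of "-1"]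
        by (metis nilpotent_part_closed(2))
    qed
    have "br (fst x) (fst y) \<in> nilpotent_part sc br e"
      by (rule *[OF hh(1,3)]) (simp add: br_cartan_e nilpotent_part_closed)
    moreover have "br (snd x) (snd y) \<in> nilpotent_part sc br f"
      by (rule *[OF hh(2,4)]) (simp only: br_cartan_f nilpotent_part_closed)
    ultimately show ?thesis unfolding pair_algebra_iff
      by (intro exI[of _ 0]) (simp add: prod_br_def)
  qed
  show "0 \<in> \<aa>" using pair_gens(3)[of 0] by (simp add: zero_prod_def)
qed

lemma br2_HH:
  "br2 (HH h) (EE i) = sc2 (\<alpha> i h) (EE i)" "br2 (HH h) (FF i) = sc2 (- \<alpha> i h) (FF i)"
  "br2 (HH h) (HH h') = 0" "br2 (EE i) (FF j) = 0"
  by (simp_all add: prod_br_def prod_scale_def br_cartan_e br_cartan_f br_cartan zero_prod_def)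

lemma HH_linear: "HH (h + h') = HH h + HH h'" "HH (sT r h) = sc2 r (HH h)"
  by (simp_all add: cartan_add cartan_scale prod_scale_def)

end

lemma ideal_comm_cong:
  assumes "ideal I (free_alg S)"
    and "a \<in> carrier (free_alg S)" "b \<in> carrier (free_alg S)"
    and "a' \<in> carrier (free_alg S)" "b' \<in> carrier (free_alg S)"
    and "a - a' \<in> I" "b - b' \<in> I"
  shows "comm a b - comm a' b' \<in> I"
proof -
  have "comm a b - comm a' b' = (a - a') * b + a' * (b - b') - (b - b') * a - b' * (a - a')"
    by (simp add: comm_def algebra_simps)
  also have "\<dots> \<in> I"
    by (intro ideal_free_algD[OF assms(1)] assms)
  finally show ?thesis .
qed

lemma comm_one [simp]:
  "comm (qscale r 1) a = 0" "comm a (qscale r 1) = 0" for a :: "'x list \<Rightarrow>\<^sub>0 rat"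
  by (simp_all add: comm_def qscale_mult_left qscale_mult_right)


section \<open>The ideal of the Kashiwara algebra and the Sridharan ideal\<close>

locale kashiwara_cocycle = symmetrizable_kac_moody_algebra sT A \<alpha> hc sc br e f \<iota>
  for sT :: "rat \<Rightarrow> 't::ab_group_add \<Rightarrow> 't"
    and A :: "'i::finite \<Rightarrow> 'i \<Rightarrow> int"
    and \<alpha> :: "'i \<Rightarrow> 't \<Rightarrow> rat"
    and hc :: "'i \<Rightarrow> 't"
    and sc :: "rat \<Rightarrow> 'g::ab_group_add \<Rightarrow> 'g"
    and br :: "'g \<Rightarrow> 'g \<Rightarrow> 'g"
    and e f :: "'i \<Rightarrow> 'g"
    and \<iota> :: "'t \<Rightarrow> 'g" +
  fixes c :: "'g \<times> 'g \<Rightarrow> 'g \<times> 'g \<Rightarrow> rat"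
  assumes cocycle: "two_cocycle (prod_scale sc) (prod_br br) (pair_algebra sc br e f \<iota>) c"
    and "values": "kashiwara_values e f \<iota> c"
begin

lemma c_add:
  "x \<in> \<aa> \<Longrightarrow> y \<in> \<aa> \<Longrightarrow> z \<in> \<aa> \<Longrightarrow> c (x + y) z = c x z + c y z"
  "x \<in> \<aa> \<Longrightarrow> y \<in> \<aa> \<Longrightarrow> z \<in> \<aa> \<Longrightarrow> c x (y + z) = c x y + c x z"
  using cocycle unfolding two_cocycle_def by blast+

lemma c_scale:
  "x \<in> \<aa> \<Longrightarrow> y \<in> \<aa> \<Longrightarrow> c (sc2 r x) y = r * c x y"
  "x \<in> \<aa> \<Longrightarrow> y \<in> \<aa> \<Longrightarrow> c x (sc2 r y) = r * c x y"
  using cocycle unfolding two_cocycle_def by blast+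

lemma c_self: "x \<in> \<aa> \<Longrightarrow> c x x = 0"
  using cocycle unfolding two_cocycle_def by blast

lemma c_cocycle:
  "x \<in> \<aa> \<Longrightarrow> y \<in> \<aa> \<Longrightarrow> z \<in> \<aa> \<Longrightarrow> c (br2 x y) z + c (br2 y z) x + c (br2 z x) y = 0"
  using cocycle unfolding two_cocycle_def by blast

lemma c_skew:
  assumes "x \<in> \<aa>" "y \<in> \<aa>"
  shows "c x y = - c y x"
proof -
  have "0 = c (x + y) (x + y)" using c_self pair_closed(1) assms by metis
  also have "\<dots> = c x y + c y x" 
    using assms by (simp add: c_add pair_closed c_self[OF assms(1)] c_self[OF assms(2)])
  finally show ?thesis by simp
qed

lemma c_zero: "x \<in> \<aa> \<Longrightarrow> c x 0 = 0" "x \<in> \<aa> \<Longrightarrow> c 0 x = 0"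
  using c_scale[of x 0 0] c_scale[of 0 x 0] by (simp_all add: pair_closed)

lemma c_gens:
  "c (EE i) (FF j) = (if i = j then 1 else 0)" "c (EE i) (EE j) = 0" "c (FF i) (FF j) = 0"
  "c (HH h) (EE i) = 0" "c (HH h) (FF i) = 0" "c (HH h) (HH h') = 0"
  using "values" by (auto simp: kashiwara_values_def Let_def)

abbreviation "K \<equiv> Idl\<^bsub>free_alg UNIV\<^esub> (kashiwara_cl_relations sT A \<alpha>)"

lemma ideal_K: "ideal K (free_alg UNIV)"
  by (rule ring.genideal_ideal[OF ring_free_alg]) simp

lemmas K_closed = ideal_free_algD(2,3,6,7,8)[OF ideal_K]

lemma K_mult: "p \<in> K \<Longrightarrow> a * p \<in> K" "p \<in> K \<Longrightarrow> p * a \<in> K"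
  using ideal_free_algD(4,5)[OF ideal_K, of p a] by simp_all

lemma K_comm: "p \<in> K \<Longrightarrow> comm p a \<in> K" "p \<in> K \<Longrightarrow> comm a p \<in> K"
  by (simp_all add: comm_def K_closed(5) K_mult)

lemma K_relation: "p \<in> kashiwara_cl_relations sT A \<alpha> \<Longrightarrow> p \<in> K"
  using ring.genideal_self[OF ring_free_alg, of "kashiwara_cl_relations sT A \<alpha>" UNIV] by auto

lemma K_relations:
  "var (GT (h + h')) - var (GT h) - var (GT h') \<in> K"
  "var (GT (sT r h)) - qscale r (var (GT h)) \<in> K"
  "comm (var (GT h)) (var (GT h')) \<in> K"
  "comm (var (GT h)) (var (GE i)) - qscale (\<alpha> i h) (var (GE i)) \<in> K"
  "comm (var (GT h)) (var (GF i)) + qscale (\<alpha> i h) (var (GF i)) \<in> K"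
  "comm (var (GE i)) (var (GF j)) - (if i = j then 1 else 0) \<in> K"
  "i \<noteq> j \<Longrightarrow> (comm (var (GE i)) ^^ nat (1 - A i j)) (var (GE j)) \<in> K"
  "i \<noteq> j \<Longrightarrow> (comm (var (GF i)) ^^ nat (1 - A i j)) (var (GF j)) \<in> K"
  by (rule K_relation; unfold kashiwara_cl_relations_def Let_def comm_def[of "var (GE _)" "var (GF _)"]; blast)+

sublocale sridharan_data "prod_scale sc" "prod_br br" "pair_algebra sc br e f \<iota>" c
  by unfold_locales (rule pair_closed; assumption)+

lemmas S_closed = ideal_free_algD(2,3,6,7,8)[OF ideal_S]
lemmas S_mult = ideal_free_algD(4,5)[OF ideal_S]

lemma S_relations:
  "x \<in> \<aa> \<Longrightarrow> y \<in> \<aa> \<Longrightarrow> var (x + y) - var x - var y \<in> S"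
  "x \<in> \<aa> \<Longrightarrow> var (sc2 r x) - qscale r (var x) \<in> S"
  "x \<in> \<aa> \<Longrightarrow> y \<in> \<aa> \<Longrightarrow> comm (var x) (var y) - var (br2 x y) - qscale (c x y) 1 \<in> S"
  using S_contains unfolding linear_gens_def sridharan_gens_def by blast+

lemma S_var_zero: "var 0 \<in> S"
  using S_relations(2)[OF pair_closed(4), of 0] by simp

end


section \<open>Lie words in one triangular half\<close>

text \<open>
  The two nilpotent parts are treated at once: \<open>X\<close> are the generators in the algebra of pairs, \<open>G\<close> the
  corresponding letters, and the sign \<open>s\<close> is \<open>1\<close> for the \<open>e\<^sub>i\<close> and \<open>-1\<close> for the \<open>f\<^sub>i\<close>.\<close>

locale triangular_half = kashiwara_cocycle sT A \<alpha> hc sc br e f \<iota> c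
  for sT :: "rat \<Rightarrow> 't::ab_group_add \<Rightarrow> 't"
    and A :: "'i::finite \<Rightarrow> 'i \<Rightarrow> int"
    and \<alpha> :: "'i \<Rightarrow> 't \<Rightarrow> rat"
    and hc :: "'i \<Rightarrow> 't"
    and sc :: "rat \<Rightarrow> 'g::ab_group_add \<Rightarrow> 'g"
    and br :: "'g \<Rightarrow> 'g \<Rightarrow> 'g"
    and e f :: "'i \<Rightarrow> 'g"
    and \<iota> :: "'t \<Rightarrow> 'g"
    and c :: "'g \<times> 'g \<Rightarrow> 'g \<times> 'g \<Rightarrow> rat" +
  fixes X :: "'i \<Rightarrow> 'g \<times> 'g" and s :: rat and G :: "'i \<Rightarrow> ('i, 't) gen"
  assumes X_pair: "X i \<in> pair_algebra sc br e f \<iota>"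
    and s_square: "s * s = 1"
    and br_HH_X: "prod_br br (\<iota> h, \<iota> h) (X i) = prod_scale sc (s * \<alpha> i h) (X i)"
    and c_HH_X: "c (\<iota> h, \<iota> h) (X i) = 0"
    and GT_G: "comm (var (GT h)) (var (G i)) - qscale (s * \<alpha> i h) (var (G i)) \<in>
      Idl\<^bsub>free_alg UNIV\<^esub> (kashiwara_cl_relations sT A \<alpha>)"
    and serre_G: "i \<noteq> j \<Longrightarrow> (comm (var (G i)) ^^ nat (1 - A i j)) (var (G j)) \<in>
      Idl\<^bsub>free_alg UNIV\<^esub> (kashiwara_cl_relations sT A \<alpha>)"
    and serre_X: "i \<noteq> j \<Longrightarrow> (prod_br br (X i) ^^ nat (1 - A i j)) (X j) = 0"
    and presented_X: "lie_eval (prod_scale sc) (prod_br br) X p = 0 \<Longrightarrow>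
      lie_eval qscale comm var p \<in> serre_ideal A"
begin

abbreviation "\<rho> \<equiv> grading_element"

abbreviation pair_word :: "'i magma \<Rightarrow> 'g \<times> 'g" where
  "pair_word \<equiv> magma_eval br2 X"

abbreviation gen_word :: "'i magma \<Rightarrow> (('i, 't) gen list \<Rightarrow>\<^sub>0 rat)" where
  "gen_word \<equiv> magma_eval comm (\<lambda>i. var (G i))"

abbreviation pair_var_word :: "'i magma \<Rightarrow> (('g \<times> 'g) list \<Rightarrow>\<^sub>0 rat)" where
  "pair_var_word \<equiv> magma_eval comm (\<lambda>i. var (X i))"

text \<open>
  If the cocycle is changed by the coboundary of a linear form that vanishes on the generators, then
  \<open>\<sigma>\<close> changes by the value of this form, so subtracting \<open>\<sigma>\<close> from a lift absorbs the coboundary.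
  Every word has positive height, so the denominator is not 0.\<close>

definition \<sigma> :: "'i magma \<Rightarrow> rat" where
  "\<sigma> m = s * c (HH \<rho>) (pair_word m) / word_weight \<rho> m"

text \<open>
  The scalar correction turns the commutator of two lifts into the lift of the bracket plus the value
  of the cocycle, see \<open>lift_word_Node\<close>.\<close>

definition lift_word :: "'i magma \<Rightarrow> (('i, 't) gen list \<Rightarrow>\<^sub>0 rat)" where
  "lift_word m = gen_word m - qscale (\<sigma> m) 1"

lemma pair_word_pair: "pair_word m \<in> \<aa>"
  by (induction m) (simp_all add: X_pair pair_closed)

lemma br_HH_pair_word: "br2 (HH h) (pair_word m) = sc2 (s * word_weight h m) (pair_word m)"
proof (induction m)
  case (Node m m')
  have "br2 (HH h) (br2 (pair_word m) (pair_word m')) =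
      sc2 (s * word_weight h m) (br2 (pair_word m) (pair_word m')) + sc2 (s * word_weight h m') (br2 (pair_word m) (pair_word m'))"
    by (simp add: P.br_derivation[of "HH h"] Node P.br_scale_left P.br_scale_right)
  then show ?case by (simp add: P.scale_left_distrib distrib_left)
qed (simp add: br_HH_X)

text \<open>
  In the cocycle identity for \<open>x\<close>, \<open>y\<close> and \<open>h\<close> both brackets with \<open>h\<close> are multiples of the weight vectors
  \<open>x\<close> and \<open>y\<close>. So \<open>c\<close> on a pair of weight vectors of nonzero
  total weight is determined by \<open>c(h, \<cdot>)\<close> on their bracket.\<close>

lemma c_HH_br:
  assumes "x \<in> \<aa>" "y \<in> \<aa>" "br2 (HH h) x = sc2 a x" "br2 (HH h) y = sc2 b y"
  shows "c (HH h) (br2 x y) = (a + b) * c x y"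
proof -
  have y: "br2 y (HH h) = sc2 (- b) y"
    using P.br_skew[of y "HH h"] assms by simp
  have "c (br2 x y) (HH h) + (- b) * c y x + a * c x y = 0"
    using c_cocycle[OF assms(1,2) pair_gens(3)[of h]]
    unfolding y assms(3) c_scale(1)[OF assms(1,2)] c_scale(1)[OF assms(2,1)] .
  then show ?thesis
    using c_skew[OF assms(1,2)] c_skew[OF pair_closed(3)[OF assms(1,2)] pair_gens(3)[of h]]
    by (simp add: algebra_simps)
qed

lemma c_HH_Node: "c (HH h) (pair_word (Node m m')) = s * word_weight h (Node m m') * c (pair_word m) (pair_word m')"
  using c_HH_br[OF pair_word_pair pair_word_pair br_HH_pair_word br_HH_pair_word, of h m m'] by (simp add: algebra_simps)

lemma \<sigma>_Leaf: "\<sigma> (Leaf i) = 0"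
  by (simp add: \<sigma>_def c_HH_X)

lemma \<sigma>_Node: "\<sigma> (Node m m') = c (pair_word m) (pair_word m')"
proof -
  have "\<sigma> (Node m m') = s * (s * word_weight \<rho> (Node m m') * c (pair_word m) (pair_word m')) / word_weight \<rho> (Node m m')"
    unfolding \<sigma>_def c_HH_Node by simp
  also have "\<dots> = (s * s) * c (pair_word m) (pair_word m')"
    using word_weight_grading_element_pos[of "Node m m'"] by simp
  finally show ?thesis by (simp add: s_square)
qed

lemma c_HH_pair_word: "c (HH h) (pair_word m) = s * word_weight h m * \<sigma> m"
proof (cases m)
  case (Node m1 m2)
  then show ?thesis using c_HH_Node[of h m1 m2] \<sigma>_Node[of m1 m2] by simp
qed (simp add: \<sigma>_Leaf c_HH_X)

lemma lift_word_Leaf: "lift_word (Leaf i) = var (G i)"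
  by (simp add: lift_word_def \<sigma>_Leaf)

lemma comm_lift_word: "comm (lift_word m) a = comm (gen_word m) a" "comm a (lift_word m) = comm a (gen_word m)"
  by (simp_all add: lift_word_def Q.Comm.br_diff_left Q.Comm.br_diff_right)

lemma lift_word_Node: "lift_word (Node m m') = comm (lift_word m) (lift_word m') - qscale (c (pair_word m) (pair_word m')) 1"
  unfolding comm_lift_word by (simp add: lift_word_def \<sigma>_Node)

lemma GT_gen_word: "comm (var (GT h)) (gen_word m) - qscale (s * word_weight h m) (gen_word m) \<in> K"
proof (induction m)
  case (Node m m')
  let ?D = "\<lambda>m. comm (var (GT h)) (gen_word m) - qscale (s * word_weight h m) (gen_word m)"
  have "comm (var (GT h)) (gen_word (Node m m')) - qscale (s * word_weight h (Node m m')) (gen_word (Node m m')) =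
      comm (?D m) (gen_word m') + comm (gen_word m) (?D m')"
    by (simp add: Q.Comm.br_derivation[of "var (GT h)"] Q.Comm.br_diff_left Q.Comm.br_diff_right
        Q.Comm.br_scale_left Q.Comm.br_scale_right Q.scale_left_distrib distrib_left)
  also have "\<dots> \<in> K"
    by (intro K_closed(2) K_comm Node)
  finally show ?case .
qed (simp add: GT_G)

lemma GT_lift_word: "comm (var (GT h)) (lift_word m) - qscale (c (HH h) (pair_word m)) 1 - qscale (s * word_weight h m) (lift_word m) \<in> K"
  using GT_gen_word[of h m] unfolding comm_lift_word
  by (simp add: lift_word_def c_HH_pair_word Q.scale_right_diff_distrib)

lemma ev_serre_ideal: "p \<in> serre_ideal A \<Longrightarrow> ev qscale (\<lambda>i. var (G i)) p \<in> K"
proof (induction rule: serre_ideal.induct)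
  case (serre i j v)
  have "ev qscale (\<lambda>i. var (G i)) ((comm (var i) ^^ n) (var j)) = (comm (var (G i)) ^^ n) (var (G j))" for n
    by (induction n) (simp_all add: Q.ev_comm)
  then show ?case
    using serre_G[OF serre] by (simp add: Q.ev_mult serre_element_def K_mult)
qed (simp_all add: Q.ev_add Q.ev_mult K_closed K_mult)

lemma lin_gen_word_zero:
  assumes "lin_ext sc2 pair_word p = 0"
  shows "lin_ext qscale gen_word p \<in> K"
proof -
  have "ev qscale (\<lambda>i. var (G i)) (lin_ext qscale (magma_eval comm var) p) = lin_ext qscale gen_word p"
    by (subst Q.lin_compose[where \<phi> = "ev qscale (\<lambda>i. var (G i))" and s = qscale])
       (simp_all add: Q.ev_add Q.ev_qscale, simp add: o_def Q.ev_magma)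
  moreover have "lin_ext qscale (magma_eval comm var) p \<in> serre_ideal A"
    using presented_X[of p] assms by (simp add: lie_eval_eq_lin)
  ultimately show ?thesis using ev_serre_ideal by metis
qed

lemma lin_pair: "lin_ext sc2 h p \<in> \<aa>" if "\<And>m. h m \<in> \<aa>" for h :: "'i magma \<Rightarrow> 'g \<times> 'g"
  by (induction p rule: poly_mapping_linear_induct) (simp_all add: P.lin_add pair_closed that)

lemma c_lin:
  fixes h :: "'i magma \<Rightarrow> 'g \<times> 'g"
  assumes "y \<in> \<aa>" "\<And>m. h m \<in> \<aa>"
  shows "c y (lin_ext sc2 h p) = lin_ext (*) (\<lambda>m. c y (h m)) p"
proof -
  interpret R: rat_vector_space "(*) :: rat \<Rightarrow> rat \<Rightarrow> rat"
    by unfold_locales (simp_all add: algebra_simps)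
  show ?thesis
    by (induction p rule: poly_mapping_linear_induct)
       (simp_all add: P.lin_add R.lin_add c_add c_scale c_zero assms lin_pair[of h, OF assms(2)])
qed

text \<open>
  The commutators cancel by the presentation of the nilpotent part. The scalars are
  \<open>c(\<rho>, x\<^sub>m)\<close> divided by the height of \<open>x\<^sub>m\<close>; a linear relation among the \<open>x\<^sub>m\<close> persists after this
  division because height is an eigenvalue of \<open>ad \<rho>\<close>, so they cancel as well.\<close>

lemma lin_lift_word_zero:
  assumes "lin_ext sc2 pair_word p = 0"
  shows "lin_ext qscale lift_word p \<in> K"
proof -
  \<comment> \<open>The eigenvalue of \<open>ad \<rho>\<close> on a word is \<open>s\<close> times its height; the second factor \<open>s\<close> in the
    denominator removes this sign.\<close>
  have "lin_ext sc2 (\<lambda>m. sc2 (s * (1 / (s * word_weight \<rho> m * s))) (pair_word m)) p = 0"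
    by (rule P.lin_eigenvectors_reweight[where D = "br2 (HH \<rho>)" and
          \<kappa> = "\<lambda>m. s * word_weight \<rho> m" and g = "\<lambda>t. s * (1 / (t * s))"])
       (simp_all add: P.br_add_right P.br_scale_right br_HH_pair_word assms)
  then have "0 = c (HH \<rho>) (lin_ext sc2 (\<lambda>m. sc2 (s * (1 / (s * word_weight \<rho> m * s))) (pair_word m)) p)"
    by (simp add: c_zero pair_gens)
  also have "\<dots> = lin_ext (*) \<sigma> p"
  proof -
    have "s * (1 / (s * word_weight \<rho> m * s)) * c (HH \<rho>) (pair_word m) = \<sigma> m" for m
    proof -
      have "s * word_weight \<rho> m * s = (s * s) * word_weight \<rho> m" by (simp only: mult_ac)
      then have eq: "s * word_weight \<rho> m * s = word_weight \<rho> m" by (simp add: s_square)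
      show ?thesis unfolding eq \<sigma>_def by simp
    qed
    then show ?thesis
      by (subst c_lin) (simp_all add: pair_gens pair_word_pair pair_closed c_scale)
  qed
  finally have \<sigma>: "lin_ext (*) \<sigma> p = 0" by simp
  have "lin_ext qscale (\<lambda>m. qscale (\<sigma> m) 1) p = qscale (lin_ext (*) \<sigma> p) (1 :: ('i, 't) gen list \<Rightarrow>\<^sub>0 rat)"
    by (simp add: lin_ext_def Q.scale_sum_left)
  then have "lin_ext qscale lift_word p = lin_ext qscale gen_word p"
    unfolding lift_word_def[abs_def] Q.lin_cong_minus by (simp add: \<sigma>)
  then show ?thesis using lin_gen_word_zero[OF assms] by simp
qed

lemma pair_var_word_carrier: "pair_var_word m \<in> carrier C"
  by (induction m)
     (simp_all only: magma_eval.simps comm_def var_free_alg X_pair free_alg_closed(2,4))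

lemma S_comm_cong:
  assumes "a \<in> carrier C" "b \<in> carrier C" "a' \<in> carrier C" "b' \<in> carrier C" "a - a' \<in> S" "b - b' \<in> S"
  shows "comm a b - comm a' b' \<in> S"
  by (rule ideal_comm_cong[OF ideal_S]) (fact assms)+

lemma pair_var_word_S: "pair_var_word m - (var (pair_word m) + qscale (\<sigma> m) 1) \<in> S"
proof (induction m)
  case (Leaf i)
  then show ?case by (simp add: \<sigma>_Leaf S_closed)
next
  case (Node m m')
  let ?w = "\<lambda>m. var (pair_word m) + qscale (\<sigma> m) 1"
  have car: "?w m \<in> carrier C" for m
    by (intro free_alg_closed var_free_alg pair_word_pair one_free_alg)
  have "comm (pair_var_word m) (pair_var_word m') - comm (?w m) (?w m') \<in> S"
    by (rule S_comm_cong[OF pair_var_word_carrier pair_var_word_carrier car car Node])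
  moreover have "comm (?w m) (?w m') = comm (var (pair_word m)) (var (pair_word m'))"
    by (simp add: Q.Comm.br_add_left Q.Comm.br_add_right)
  ultimately have "comm (pair_var_word m) (pair_var_word m') - comm (var (pair_word m)) (var (pair_word m')) \<in> S"
    by simp
  from S_closed(2)[OF this S_relations(3)[OF pair_word_pair pair_word_pair, of m m']]
  show ?case by (simp add: \<sigma>_Node algebra_simps)
qed

text \<open>
  A Serre element is the commutator form of a word whose value \<open>x\<close> is 0 in the Lie algebra. The word
  therefore reduces to the scalar \<open>\<sigma>\<close>, and this is \<open>\<plusminus>c(\<rho>, 0)\<close> divided by the height.\<close>

lemma serre_S:
  assumes "i \<noteq> j"
  shows "(comm (var (X i)) ^^ nat (1 - A i j)) (var (X j)) \<in> S"
proof -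
  have word: "magma_eval b v ((Node (Leaf i) ^^ n) (Leaf j)) = (b (v i) ^^ n) (v j)"
    for b v n and i j :: 'i
    by (induction n) simp_all
  let ?m = "(Node (Leaf i) ^^ nat (1 - A i j)) (Leaf j)"
  have x: "pair_word ?m = 0" unfolding word by (rule serre_X[OF assms])
  then have "\<sigma> ?m = 0" by (simp add: \<sigma>_def c_zero pair_gens)
  with pair_var_word_S[of ?m] x have "pair_var_word ?m - var 0 \<in> S" by simp
  from S_closed(2)[OF this S_var_zero] show ?thesis by (simp add: word)
qed

end


section \<open>The correspondence between the two presentations\<close>

context kashiwara_cocycle
begin

lemma lie_eval_half_zero:
  "lie_eval sc2 br2 EE p = (lie_eval sc br e p, 0)" "lie_eval sc2 br2 FF p = (0, lie_eval sc br f p)"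
  by (simp_all add: Lie.lie_eval_prod o_def Lie.lie_eval_const_zero)

lemma funpow_br2:
  "(br2 (EE i) ^^ n) (EE j) = ((br (e i) ^^ n) (e j), if n = 0 then 0 else 0)"
  "(br2 (FF i) ^^ n) (FF j) = (if n = 0 then 0 else 0, (br (f i) ^^ n) (f j))"
  by (induction n) (simp_all add: prod_br_def)

interpretation pos: triangular_half sT A \<alpha> hc sc br e f \<iota> c EE 1 GE
proof
  show "lie_eval qscale comm var p \<in> serre_ideal A" if "lie_eval sc2 br2 EE p = 0" for p
    using creation_lie_polynomial[OF acts0(2), of GE p] that
    by (simp add: lie_eval_half_zero zero_prod_def o_def)
qed (simp_all add: pair_gens br2_HH c_gens K_relations funpow_br2 serre_e zero_prod_def)

interpretation neg: triangular_half sT A \<alpha> hc sc br e f \<iota> c FF "-1" GF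
proof
  show "lie_eval qscale comm var p \<in> serre_ideal A" if "lie_eval sc2 br2 FF p = 0" for p
    using creation_lie_polynomial[OF acts0(1), of GF p] that
    by (simp add: lie_eval_half_zero zero_prod_def o_def)
qed (simp_all add: pair_gens br2_HH c_gens K_relations funpow_br2 serre_f zero_prod_def)

lemma snd_pos: "snd (pos.pair_word m) = 0" and fst_neg: "fst (neg.pair_word m) = 0"
  by (simp_all add: magma_eval_prod o_def Lie.magma_eval_zero)

lemma br_pos_neg: "br2 (pos.pair_word m) (neg.pair_word m') = 0"
  by (simp add: prod_br_def snd_pos fst_neg zero_prod_def)

lemma c_br_zero:
  assumes "x \<in> \<aa>" "y \<in> \<aa>" "z \<in> \<aa>" "br2 y z = 0" "br2 z x = 0"
  shows "c (br2 x y) z = 0"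
  using c_cocycle[OF assms(1-3)] assms by (simp add: c_zero)

text \<open>
  Scalars are central, so by the Jacobi identity an element whose commutators with \<open>x\<close> and \<open>y\<close> are
  scalars commutes with \<open>[x, y]\<close>.\<close>

lemma K_comm_derivation:
  assumes "comm a x - qscale r 1 \<in> K" "comm a y - qscale r' 1 \<in> K"
  shows "comm a (comm x y) \<in> K"
proof -
  have "comm a (comm x y) = comm (comm a x - qscale r 1) y + comm x (comm a y - qscale r' 1)"
    by (simp add: Q.Comm.br_derivation[of a] Q.Comm.br_diff_left Q.Comm.br_diff_right)
  also have "\<dots> \<in> K"
    by (intro K_closed(2) K_comm assms)
  finally show ?thesis .
qed

lemma K_comm_skew: "comm a x - qscale r 1 \<in> K \<Longrightarrow> comm x a - qscale (- r) 1 \<in> K"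
  using K_closed(4)[of "comm a x - qscale r 1"] by (simp add: comm_def algebra_simps)

text \<open>
  On generators both terms are the Kronecker delta. If one of the words is a bracket, both terms vanish
  separately: the commutator because scalars are central, the cocycle because the two nilpotent parts
  commute in the algebra of pairs.\<close>

lemma comm_pos_neg: "comm (pos.gen_word m) (neg.gen_word m') - qscale (c (pos.pair_word m) (neg.pair_word m')) 1 \<in> K"
proof (induction m arbitrary: m')
  case (Leaf i)
  show ?case
  proof (induction m')
    case (Leaf j)
    show ?case using K_relations(6)[of i j] by (cases "i = j") (simp_all add: c_gens)
  next
    case (Node m1 m2)
    have z: "br2 (neg.pair_word m2) (pos.pair_word (Leaf i)) = 0" "br2 (pos.pair_word (Leaf i)) (neg.pair_word m1) = 0"
      using br_pos_neg[of "Leaf i"] P.br_skew[of "neg.pair_word m2"] by simp_all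
    have "c (neg.pair_word (Node m1 m2)) (pos.pair_word (Leaf i)) = 0"
      using c_br_zero[OF neg.pair_word_pair neg.pair_word_pair pos.pair_word_pair z] by simp
    then have "c (pos.pair_word (Leaf i)) (neg.pair_word (Node m1 m2)) = 0"
      using c_skew[OF pos.pair_word_pair[of "Leaf i"] neg.pair_word_pair[of "Node m1 m2"]] by simp
    then show ?case
      using K_comm_derivation[OF Node] by simp
  qed
next
  case (Node m1 m2)
  have z: "br2 (pos.pair_word m2) (neg.pair_word m') = 0" "br2 (neg.pair_word m') (pos.pair_word m1) = 0"
    using br_pos_neg P.br_skew[of "neg.pair_word m'"] by simp_all
  have "c (pos.pair_word (Node m1 m2)) (neg.pair_word m') = 0"
    using c_br_zero[OF pos.pair_word_pair pos.pair_word_pair neg.pair_word_pair z] by simp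
  moreover have "comm (neg.gen_word m') (comm (pos.gen_word m1) (pos.gen_word m2)) \<in> K"
    by (rule K_comm_derivation) (rule K_comm_skew, rule Node)+
  then have "comm (comm (pos.gen_word m1) (pos.gen_word m2)) (neg.gen_word m') \<in> K"
    using K_closed(4) Q.Comm.br_skew by metis
  ultimately show ?case by simp
qed

text \<open>
  The graph of the lift of the algebra of pairs to the free algebra, saturated by the ideal of the
  Kashiwara algebra. A relation is easier to handle than a function here, because an element has many
  expressions by words; uniqueness modulo the ideal is the content of \<open>\<Gamma>_zero\<close>.\<close>

inductive_set \<Gamma> :: "(('g \<times> 'g) \<times> (('i, 't) gen list \<Rightarrow>\<^sub>0 rat)) set" where
  ker: "a \<in> K \<Longrightarrow> (0, a) \<in> \<Gamma>"
| cartan: "(HH h, var (GT h)) \<in> \<Gamma>"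
| pos: "(pos.pair_word m, pos.lift_word m) \<in> \<Gamma>"
| neg: "(neg.pair_word m, neg.lift_word m) \<in> \<Gamma>"
| add: "(x, a) \<in> \<Gamma> \<Longrightarrow> (y, b) \<in> \<Gamma> \<Longrightarrow> (x + y, a + b) \<in> \<Gamma>"
| scale: "(x, a) \<in> \<Gamma> \<Longrightarrow> (sc2 r x, qscale r a) \<in> \<Gamma>"

lemma \<Gamma>_pair: "(x, a) \<in> \<Gamma> \<Longrightarrow> x \<in> \<aa>"
  by (induction x a rule: \<Gamma>.induct) (auto intro: pair_closed pair_gens pos.pair_word_pair neg.pair_word_pair)

lemma \<Gamma>_cong: "(x, a) \<in> \<Gamma> \<Longrightarrow> b - a \<in> K \<Longrightarrow> (x, b) \<in> \<Gamma>"
  using \<Gamma>.add[of x a 0 "b - a"] \<Gamma>.ker by simp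

definition compatible where
  "compatible x a y b \<longleftrightarrow> (br2 x y, comm a b - qscale (c x y) 1) \<in> \<Gamma>"

lemma compatible_sym:
  assumes "x \<in> \<aa>" "y \<in> \<aa>" "compatible x a y b"
  shows "compatible y b x a"
proof -
  have "sc2 (-1) (br2 x y) = br2 y x" using P.br_skew[of y x] by simp
  moreover have "qscale (-1) (comm a b - qscale (c x y) 1) = comm b a - qscale (c y x) 1"
    using c_skew[OF assms(2,1)] by (simp add: comm_def)
  ultimately show ?thesis
    using \<Gamma>.scale[of "br2 x y" "comm a b - qscale (c x y) 1" "-1"] assms(3)
    by (simp add: compatible_def)
qed

lemma compatible_ker: "x \<in> \<aa> \<Longrightarrow> k \<in> K \<Longrightarrow> compatible x a 0 k"
  unfolding compatible_def
  by (simp add: c_zero \<Gamma>.ker K_comm)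

text \<open>
  Compatibility is bilinear, so it has to be checked only for the spanning elements in each argument.\<close>

lemma compatible_extend:
  assumes x: "x \<in> \<aa>"
    and gens: "\<And>h. compatible x a (HH h) (var (GT h))" "\<And>m. compatible x a (pos.pair_word m) (pos.lift_word m)"
      "\<And>m. compatible x a (neg.pair_word m) (neg.lift_word m)"
    and "(y, b) \<in> \<Gamma>"
  shows "compatible x a y b"
  using assms(5)
proof (induction y b rule: \<Gamma>.induct)
  case (add y b z d)
  have "comm a (b + d) - qscale (c x (y + z)) 1 =
      (comm a b - qscale (c x y) 1) + (comm a d - qscale (c x z) 1)"
    by (simp add: Q.Comm.br_add_right c_add x \<Gamma>_pair[OF add(1)] \<Gamma>_pair[OF add(2)] Q.scale_left_distrib)
  then show ?case
    using \<Gamma>.add add.IH by (simp add: compatible_def P.br_add_right)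
next
  case (scale y b r)
  have "comm a (qscale r b) - qscale (c x (sc2 r y)) 1 = qscale r (comm a b - qscale (c x y) 1)"
    by (simp add: Q.Comm.br_scale_right c_scale x \<Gamma>_pair[OF scale(1)] Q.scale_right_diff_distrib)
  then show ?case
    using \<Gamma>.scale scale.IH by (simp add: compatible_def P.br_scale_right)
qed (simp_all add: gens compatible_ker x)

lemma compatible_cartan_cartan: "compatible (HH h) (var (GT h)) (HH h') (var (GT h'))"
  unfolding compatible_def by (simp add: br2_HH c_gens \<Gamma>.ker K_relations)

lemma compatible_cartan_pos: "compatible (HH h) (var (GT h)) (pos.pair_word m) (pos.lift_word m)"
  unfolding compatible_def pos.br_HH_pair_word
  by (rule \<Gamma>_cong[OF \<Gamma>.scale[OF \<Gamma>.pos] pos.GT_lift_word])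

lemma compatible_cartan_neg: "compatible (HH h) (var (GT h)) (neg.pair_word m) (neg.lift_word m)"
  unfolding compatible_def neg.br_HH_pair_word
  by (rule \<Gamma>_cong[OF \<Gamma>.scale[OF \<Gamma>.neg] neg.GT_lift_word])

lemma compatible_pos_pos: "compatible (pos.pair_word m) (pos.lift_word m) (pos.pair_word m') (pos.lift_word m')"
  using \<Gamma>.pos[of "Node m m'"] unfolding compatible_def pos.lift_word_Node by simp

lemma compatible_neg_neg: "compatible (neg.pair_word m) (neg.lift_word m) (neg.pair_word m') (neg.lift_word m')"
  using \<Gamma>.neg[of "Node m m'"] unfolding compatible_def neg.lift_word_Node by simp

lemma compatible_pos_neg: "compatible (pos.pair_word m) (pos.lift_word m) (neg.pair_word m') (neg.lift_word m')"
  unfolding compatible_def br_pos_neg pos.comm_lift_word neg.comm_lift_word by (rule \<Gamma>.ker[OF comm_pos_neg])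

lemmas in_pair = pair_gens(3) pos.pair_word_pair neg.pair_word_pair

lemma \<Gamma>_bracket:
  assumes xa: "(x, a) \<in> \<Gamma>" and yb: "(y, b) \<in> \<Gamma>"
  shows "compatible x a y b"
proof -
  note y = \<Gamma>_pair[OF yb] and x = \<Gamma>_pair[OF xa]
  have cartan: "compatible (HH h) (var (GT h)) y b" for h
    by (rule compatible_extend[OF in_pair(1) compatible_cartan_cartan compatible_cartan_pos
          compatible_cartan_neg yb])
  have pos: "compatible (pos.pair_word m) (pos.lift_word m) y b" for m
    by (rule compatible_extend[OF in_pair(2)
          compatible_sym[OF in_pair(1,2) compatible_cartan_pos] compatible_pos_pos
          compatible_pos_neg yb])
  have neg: "compatible (neg.pair_word m) (neg.lift_word m) y b" for m
    by (rule compatible_extend[OF in_pair(3)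
          compatible_sym[OF in_pair(1,3) compatible_cartan_neg]
          compatible_sym[OF in_pair(2,3) compatible_pos_neg] compatible_neg_neg yb])
  have "compatible y b x a"
    by (rule compatible_extend[OF y compatible_sym[OF in_pair(1) y cartan]
          compatible_sym[OF in_pair(2) y pos] compatible_sym[OF in_pair(3) y neg] xa])
  then show ?thesis by (rule compatible_sym[OF y x])
qed

lemma lin_\<Gamma>:
  assumes "\<And>m. (x m, b m) \<in> \<Gamma>"
  shows "(lin_ext sc2 x p, lin_ext qscale b p) \<in> \<Gamma>"
  by (induction p rule: poly_mapping_linear_induct)
     (simp_all add: P.lin_add Q.lin_add assms \<Gamma>.add \<Gamma>.scale \<Gamma>.ker K_closed)

lemma lin_pos: "lin_ext sc2 pos.pair_word p = (lie_eval sc br e p, 0)"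
  and lin_neg: "lin_ext sc2 neg.pair_word p = (0, lie_eval sc br f p)"
  by (simp_all add: lie_eval_half_zero flip: lie_eval_eq_lin)

lemma \<Gamma>_total:
  assumes "x \<in> \<aa>"
  shows "\<exists>a. (x, a) \<in> \<Gamma>"
proof -
  obtain h where h: "fst x - \<iota> h \<in> nilpotent_part sc br e" "snd x - \<iota> h \<in> nilpotent_part sc br f"
    using assms unfolding pair_algebra_iff by blast
  have "nilpotent_part sc br g \<subseteq> range (lie_eval sc br g)" for g :: "'i \<Rightarrow> 'g"
    unfolding nilpotent_part_def
  proof (rule lie_span_least[OF Lie.lie_subalgebra_range_lie_eval])
    show "range g \<subseteq> range (lie_eval sc br g)"
      using Lie.lie_eval_mvar[of g] by (metis image_subsetI rangeI)
  qed
  with h obtain p q where "fst x - \<iota> h = lie_eval sc br e p" "snd x - \<iota> h = lie_eval sc br f q"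
    by blast
  then have x: "x = HH h + lin_ext sc2 pos.pair_word p + lin_ext sc2 neg.pair_word q"
    unfolding lin_pos lin_neg by (simp add: prod_eq_iff algebra_simps)
  show ?thesis
    unfolding x using \<Gamma>.add[OF \<Gamma>.add[OF \<Gamma>.cartan lin_\<Gamma>[of pos.pair_word pos.lift_word, OF \<Gamma>.pos]]
        lin_\<Gamma>[of neg.pair_word neg.lift_word, OF \<Gamma>.neg]] by blast
qed

lemma \<Gamma>_decompose:
  "(x, a) \<in> \<Gamma> \<Longrightarrow> \<exists>h p q. x = HH h + lin_ext sc2 pos.pair_word p + lin_ext sc2 neg.pair_word q \<and>
     a - (var (GT h) + lin_ext qscale pos.lift_word p + lin_ext qscale neg.lift_word q) \<in> K"
proof (induction x a rule: \<Gamma>.induct)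
  case (ker a)
  have "var (GT 0) \<in> K" using K_relations(2)[of 0 0] by simp
  with ker have "a - (var (GT 0) + lin_ext qscale pos.lift_word 0 + lin_ext qscale neg.lift_word 0) \<in> K"
    by (simp add: K_closed)
  then show ?case by (intro exI[of _ 0]) (simp add: zero_prod_def)
next
  case (cartan h)
  show ?case by (rule exI[of _ h], rule exI[of _ 0], rule exI[of _ 0]) (simp add: K_closed)
next
  case (pos m)
  have "var (GT 0) \<in> K" using K_relations(2)[of 0 0] by simp
  then show ?case
    by (intro exI[of _ 0] exI[of _ "Poly_Mapping.single m 1"] conjI)
       (simp_all add: K_closed zero_prod_def exI[of _ 0])
next
  case (neg m)
  have "var (GT 0) \<in> K" using K_relations(2)[of 0 0] by simp
  then show ?case
    by (intro exI[of _ 0] exI[of _ "Poly_Mapping.single m 1"] conjI)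
       (simp_all add: K_closed zero_prod_def)
next
  case (add x a y b)
  then obtain h p q h' p' q' where
    x: "x = HH h + lin_ext sc2 pos.pair_word p + lin_ext sc2 neg.pair_word q"
      "a - (var (GT h) + lin_ext qscale pos.lift_word p + lin_ext qscale neg.lift_word q) \<in> K" and
    y: "y = HH h' + lin_ext sc2 pos.pair_word p' + lin_ext sc2 neg.pair_word q'"
      "b - (var (GT h') + lin_ext qscale pos.lift_word p' + lin_ext qscale neg.lift_word q') \<in> K"
    by blast
  have "x + y = HH (h + h') + lin_ext sc2 pos.pair_word (p + p') + lin_ext sc2 neg.pair_word (q + q')"
    unfolding x(1) y(1) HH_linear(1) by (simp only: P.lin_add add_ac)
  moreover have "a + b - (var (GT (h + h')) + lin_ext qscale pos.lift_word (p + p') + lin_ext qscale neg.lift_word (q + q')) \<in> K"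
    using K_closed(5)[OF K_closed(2)[OF x(2) y(2)] K_relations(1)[of h h']]
    by (simp add: Q.lin_add algebra_simps)
  ultimately show ?case by blast
next
  case (scale x a r)
  then obtain h p q where
    x: "x = HH h + lin_ext sc2 pos.pair_word p + lin_ext sc2 neg.pair_word q"
      "a - (var (GT h) + lin_ext qscale pos.lift_word p + lin_ext qscale neg.lift_word q) \<in> K"
    by blast
  have "sc2 r x = HH (sT r h) + lin_ext sc2 pos.pair_word (qscale r p) + lin_ext sc2 neg.pair_word (qscale r q)"
    unfolding x(1) HH_linear(2) by (simp only: P.lin_qscale P.scale_right_distrib)
  moreover have "qscale r a - (var (GT (sT r h)) + lin_ext qscale pos.lift_word (qscale r p) +
      lin_ext qscale neg.lift_word (qscale r q)) \<in> K"
    using K_closed(5)[OF K_closed(3)[OF x(2), of r] K_relations(2)[of r h]]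
    by (simp add: Q.lin_qscale Q.scale_right_distrib Q.scale_right_diff_distrib algebra_simps)
  ultimately show ?case by blast
qed

text \<open>
  Write the element as a sum of a Cartan part and two nilpotent parts. Its two components vanish, so
  the Cartan part lies in a nilpotent part and is 0; then each nilpotent part is 0 by itself, and
  its lift lies in the ideal by \<open>lin_lift_word_zero\<close>.\<close>

lemma \<Gamma>_zero:
  assumes "(0, a) \<in> \<Gamma>"
  shows "a \<in> K"
proof -
  obtain h p q where x: "0 = HH h + lin_ext sc2 pos.pair_word p + lin_ext sc2 neg.pair_word q"
    and a: "a - (var (GT h) + lin_ext qscale pos.lift_word p + lin_ext qscale neg.lift_word q) \<in> K"
    using \<Gamma>_decompose[OF assms] by blast
  have eq: "\<iota> h + lie_eval sc br e p = 0" "\<iota> h + lie_eval sc br f q = 0"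
    using x unfolding lin_pos lin_neg by (simp_all add: zero_prod_def)
  have "lie_eval sc br e p \<in> nilpotent_part sc br e"
    by (induction p rule: poly_mapping_linear_induct)
       (simp_all add: nilpotent_part_closed Lie.lie_eval_zero Lie.lie_eval_add,
        unfold lie_eval_eq_lin, simp add: nilpotent_part_closed magma_nilpotent)
  moreover have "\<iota> h = - lie_eval sc br e p"
    using eq(1) by (simp add: eq_neg_iff_add_eq_0)
  ultimately have "\<iota> h \<in> nilpotent_part sc br e"
    using nilpotent_part_closed(4)[of "lie_eval sc br e p" e "-1"] by simp
  then have h: "h = 0" by (rule cartan_nilpotent_disjoint(1))
  with eq have "lin_ext sc2 pos.pair_word p = 0" "lin_ext sc2 neg.pair_word q = 0"
    unfolding lin_pos lin_neg by (simp_all add: zero_prod_def)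
  then have "lin_ext qscale pos.lift_word p \<in> K" "lin_ext qscale neg.lift_word q \<in> K"
    using pos.lin_lift_word_zero neg.lin_lift_word_zero by blast+
  moreover have "var (GT h) \<in> K" using K_relations(2)[of 0 0] h by simp
  ultimately show ?thesis
    using K_closed(2)[OF a] K_closed(2) by (metis diff_add_cancel)
qed

lemma \<Gamma>_unique:
  assumes "(x, a) \<in> \<Gamma>" "(x, b) \<in> \<Gamma>"
  shows "a - b \<in> K"
  using \<Gamma>.add[OF assms(1) \<Gamma>.scale[OF assms(2), of "-1"]] by (intro \<Gamma>_zero) simp

definition \<psi> :: "'g \<times> 'g \<Rightarrow> ('i, 't) gen list \<Rightarrow>\<^sub>0 rat" where
  "\<psi> x = (SOME a. (x, a) \<in> \<Gamma>)"

lemma \<psi>_\<Gamma>: "x \<in> \<aa> \<Longrightarrow> (x, \<psi> x) \<in> \<Gamma>"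
  unfolding \<psi>_def by (rule someI_ex) (rule \<Gamma>_total)

abbreviation "pair_var \<equiv> case_gen (\<lambda>i. var (EE i)) (\<lambda>i. var (FF i)) (\<lambda>h. var (HH h))"
abbreviation "to_pairs \<equiv> ev qscale pair_var"
abbreviation "from_pairs \<equiv> ev qscale \<psi>"

lemma to_pairs_carrier: "to_pairs a \<in> carrier C"
proof (rule free_algebra_induct[of a UNIV])
  show "\<forall>w\<in>Poly_Mapping.keys a. set w \<subseteq> UNIV" by simp
  show "to_pairs (var x) \<in> carrier C" for x
    by (cases x) (simp_all only: Q.ev_var gen.case var_free_alg pair_gens)
qed (simp_all only: Q.ev_add Q.ev_mult Q.ev_qscale Q.ev_one free_alg_closed one_free_alg)

lemma to_pairs_funpow:
  "to_pairs ((comm p ^^ n) q) = (comm (to_pairs p) ^^ n) (to_pairs q)"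
  by (induction n) (simp_all add: Q.ev_comm)

lemma to_pairs_relations:
  assumes "p \<in> kashiwara_cl_relations sT A \<alpha>"
  shows "to_pairs p \<in> S"
proof -
  have comm_gens: "comm (var (HH h)) (var (HH h')) \<in> S"
      "comm (var (HH h)) (var (EE i)) - qscale (\<alpha> i h) (var (EE i)) \<in> S"
      "comm (var (HH h)) (var (FF i)) - qscale (- \<alpha> i h) (var (FF i)) \<in> S"
      "comm (var (EE i)) (var (FF j)) - qscale (if i = j then 1 else 0) 1 \<in> S" for h h' i j
    using S_closed(2)[OF S_relations(3)[OF pair_gens(3)[of h] pair_gens(3)[of h']] S_var_zero]
      S_closed(2)[OF S_relations(3)[OF pair_gens(3)[of h] pair_gens(1)[of i]]
        S_relations(2)[OF pair_gens(1)[of i], of "\<alpha> i h", folded br2_HH(1)]]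
      S_closed(2)[OF S_relations(3)[OF pair_gens(3)[of h] pair_gens(2)[of i]]
        S_relations(2)[OF pair_gens(2)[of i], of "- \<alpha> i h", folded br2_HH(2)]]
      S_closed(2)[OF S_relations(3)[OF pair_gens(1)[of i] pair_gens(2)[of j]] S_var_zero]
    by (simp_all only: br2_HH(3,4) c_gens Q.scale_zero_left diff_0_right diff_add_cancel
        diff_add_eq diff_diff_eq2 diff_diff_eq add_diff_cancel_left' add.commute) simp_all
  note ev = Q.ev_add Q.ev_diff Q.ev_qscale Q.ev_comm Q.ev_mult Q.ev_var Q.ev_one Q.ev_zero
    to_pairs_funpow gen.case
  from assms show ?thesis
    unfolding kashiwara_cl_relations_def Let_def
  proof (elim UnE CollectE exE conjE)
    fix h h' assume "p = var (GT (h + h')) - var (GT h) - var (GT h')"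
    then show ?thesis
      using S_relations(1)[OF pair_gens(3)[of h] pair_gens(3)[of h']]
      by (simp only: ev HH_linear)
  next
    fix r h assume "p = var (GT (sT r h)) - qscale r (var (GT h))"
    then show ?thesis
      using S_relations(2)[OF pair_gens(3)[of h], of r] by (simp only: ev HH_linear)
  next
    fix h h' assume "p = comm (var (GT h)) (var (GT h'))"
    then show ?thesis using comm_gens(1) by (simp only: ev)
  next
    fix h i assume "p = comm (var (GT h)) (var (GE i)) - qscale (\<alpha> i h) (var (GE i))"
    then show ?thesis using comm_gens(2) by (simp only: ev)
  next
    fix h i assume "p = comm (var (GT h)) (var (GF i)) + qscale (\<alpha> i h) (var (GF i))"
    then show ?thesis using comm_gens(3)[of h i] by (simp add: ev)
  next
    fix i j assume "p = var (GE i) * var (GF j) - var (GF j) * var (GE i) - (if i = j then 1 else 0)"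
    then show ?thesis using comm_gens(4)[of i j] by (simp add: ev comm_def split: if_splits)
  next
    fix i j assume "p = (comm (var (GE i)) ^^ nat (1 - A i j)) (var (GE j))" "i \<noteq> j"
    then show ?thesis using pos.serre_S by (simp only: ev)
  next
    fix i j assume "p = (comm (var (GF i)) ^^ nat (1 - A i j)) (var (GF j))" "i \<noteq> j"
    then show ?thesis using neg.serre_S by (simp only: ev)
  qed
qed

lemma to_pairs_K:
  assumes "a \<in> K"
  shows "to_pairs a \<in> S"
proof -
  have "ideal {a. to_pairs a \<in> S} (free_alg UNIV)"
  proof (rule ideal_free_algI)
    show "{a. to_pairs a \<in> S} \<subseteq> carrier (free_alg UNIV)" by simp
  qed (simp_all only: mem_Collect_eq Q.ev_zero Q.ev_add Q.ev_mult S_closed S_mult to_pairs_carrier)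
  then have "K \<subseteq> {a. to_pairs a \<in> S}"
    by (rule ring.genideal_minimal[OF ring_free_alg]) (use to_pairs_relations in blast)
  with assms show ?thesis by blast
qed

lemma to_pairs_word:
  "to_pairs (pos.gen_word m) = pos.pair_var_word m" "to_pairs (neg.gen_word m) = neg.pair_var_word m"
  by (simp_all add: Q.ev_magma o_def)

lemma to_pairs_\<Gamma>: "(x, a) \<in> \<Gamma> \<Longrightarrow> to_pairs a - var x \<in> S"
proof (induction x a rule: \<Gamma>.induct)
  case (ker a)
  show ?case by (rule S_closed(5)[OF to_pairs_K[OF ker] S_var_zero])
next
  case (cartan h)
  then show ?case by (simp add: S_closed)
next
  case (pos m)
  then show ?case
    using pos.pair_var_word_S[of m] by (simp add: pos.lift_word_def Q.ev_diff Q.ev_qscale to_pairs_word algebra_simps)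
next
  case (neg m)
  then show ?case
    using neg.pair_var_word_S[of m] by (simp add: neg.lift_word_def Q.ev_diff Q.ev_qscale to_pairs_word algebra_simps)
next
  case (add x a y b)
  have "(to_pairs a - var x) + (to_pairs b - var y) - (var (x + y) - var x - var y) \<in> S"
    by (intro S_closed(5)[OF S_closed(2)] add.IH S_relations(1) \<Gamma>_pair[OF add(1)] \<Gamma>_pair[OF add(2)])
  then show ?case by (simp add: Q.ev_add algebra_simps)
next
  case (scale x a r)
  have "qscale r (to_pairs a - var x) - (var (sc2 r x) - qscale r (var x)) \<in> S"
    by (intro S_closed(5)[OF S_closed(3)] scale.IH S_relations(2) \<Gamma>_pair[OF scale(1)])
  then show ?case by (simp add: Q.ev_qscale Q.scale_right_diff_distrib)
qed

lemma pair_gens_\<Gamma>: "(EE i, var (GE i)) \<in> \<Gamma>" "(FF i, var (GF i)) \<in> \<Gamma>"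
  using \<Gamma>.pos[of "Leaf i"] \<Gamma>.neg[of "Leaf i"] by (simp_all add: pos.lift_word_Leaf neg.lift_word_Leaf)

lemma from_pairs_to_pairs: "from_pairs (to_pairs a) - a \<in> K"
proof (rule free_algebra_induct[of a UNIV])
  show "from_pairs (to_pairs (var x)) - var x \<in> K" for x
    using \<Gamma>_unique[OF \<psi>_\<Gamma>] pair_gens pair_gens_\<Gamma> \<Gamma>.cartan by (cases x) auto
next
  fix p q assume "from_pairs (to_pairs p) - p \<in> K" "from_pairs (to_pairs q) - q \<in> K"
  then have pq: "(from_pairs (to_pairs p) - p) + (from_pairs (to_pairs q) - q) \<in> K"
    "(from_pairs (to_pairs p) - p) * from_pairs (to_pairs q) +
        p * (from_pairs (to_pairs q) - q) \<in> K"
    using K_closed(2) K_mult by blast+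
  from pq(1) show "from_pairs (to_pairs (p + q)) - (p + q) \<in> K"
    by (simp add: Q.ev_add algebra_simps)
  from pq(2) show "from_pairs (to_pairs (p * q)) - p * q \<in> K"
    by (simp add: Q.ev_mult algebra_simps)
next
  fix r p assume "from_pairs (to_pairs p) - p \<in> K"
  from K_closed(3)[OF this, of r] show "from_pairs (to_pairs (qscale r p)) - qscale r p \<in> K"
    by (simp add: Q.ev_qscale Q.scale_right_diff_distrib)
qed (simp_all add: K_closed)

lemma from_pairs_S:
  assumes "p \<in> S"
  shows "from_pairs p \<in> K"
proof -
  let ?P = "{p \<in> carrier C. from_pairs p \<in> K}"
  have "ideal ?P C"
  proof (rule ideal_free_algI)
    show "0 \<in> ?P" using ideal_free_algD(1,2)[OF ideal_S] by (simp add: K_closed)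
  qed (auto simp: Q.ev_add Q.ev_mult K_closed K_mult simp del: free_alg_simps
        intro: free_alg_closed)
  moreover have "linear_gens sc2 \<aa> \<subseteq> ?P"
  proof -
    have "\<psi> (x + y) - \<psi> x - \<psi> y \<in> K" if "x \<in> \<aa>" "y \<in> \<aa>" for x y
      using \<Gamma>_unique[OF \<psi>_\<Gamma>[OF pair_closed(1)[OF that]] \<Gamma>.add[OF \<psi>_\<Gamma>[OF that(1)] \<psi>_\<Gamma>[OF that(2)]]]
      by (simp add: diff_diff_eq)
    moreover have "\<psi> (sc2 r x) - qscale r (\<psi> x) \<in> K" if "x \<in> \<aa>" for r x
      by (rule \<Gamma>_unique[OF \<psi>_\<Gamma>[OF pair_closed(2)[OF that]] \<Gamma>.scale[OF \<psi>_\<Gamma>[OF that]]])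
    ultimately have "from_pairs p \<in> K" if "p \<in> linear_gens sc2 \<aa>" for p
      using that unfolding linear_gens_def by (auto simp: Q.ev_diff Q.ev_qscale)
    with linear_gens_carrier show ?thesis by blast
  qed
  moreover have "sridharan_gens br2 \<aa> c \<subseteq> ?P"
  proof -
    have "comm (\<psi> x) (\<psi> y) - \<psi> (br2 x y) - qscale (c x y) 1 \<in> K" if "x \<in> \<aa>" "y \<in> \<aa>" for x y
      using \<Gamma>_unique[OF \<Gamma>_bracket[OF \<psi>_\<Gamma>[OF that(1)] \<psi>_\<Gamma>[OF that(2)], unfolded compatible_def]
          \<psi>_\<Gamma>[OF pair_closed(3)[OF that]]]
      by (simp add: algebra_simps)
    then have "from_pairs p \<in> K" if "p \<in> sridharan_gens br2 \<aa> c" for p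
      using that unfolding sridharan_gens_def by (auto simp: Q.ev_diff Q.ev_qscale Q.ev_comm)
    with sridharan_gens_carrier show ?thesis by blast
  qed
  ultimately have "S \<subseteq> ?P" by (rule S_least)
  with assms show ?thesis by blast
qed

text \<open>
  Both this composition and the opposite one are homomorphisms that fix the generators modulo the
  respective ideal.\<close>

lemma to_pairs_from_pairs:
  assumes "p \<in> carrier C"
  shows "to_pairs (from_pairs p) - p \<in> S"
proof -
  have "p \<in> carrier C \<and> to_pairs (from_pairs p) - p \<in> S"
  proof (rule free_algebra_induct[of p \<aa>])
    show "\<forall>w\<in>Poly_Mapping.keys p. set w \<subseteq> \<aa>" using assms by simp
    show "1 \<in> carrier C \<and> to_pairs (from_pairs 1) - 1 \<in> S"
      using one_free_alg[of \<aa>] by (simp only: Q.ev_one diff_self S_closed simp_thms)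
    show "var x \<in> carrier C \<and> to_pairs (from_pairs (var x)) - var x \<in> S" if "x \<in> \<aa>" for x
      using var_free_alg[OF that] to_pairs_\<Gamma>[OF \<psi>_\<Gamma>[OF that]] by (simp only: Q.ev_var simp_thms)
  next
    fix p q
    assume p: "p \<in> carrier C \<and> to_pairs (from_pairs p) - p \<in> S"
      and q: "q \<in> carrier C \<and> to_pairs (from_pairs q) - q \<in> S"
    note p = p[THEN conjunct1] p[THEN conjunct2] and q = q[THEN conjunct1] q[THEN conjunct2]
    have "(to_pairs (from_pairs p) - p) + (to_pairs (from_pairs q) - q) \<in> S"
      by (rule S_closed(2)[OF p(2) q(2)])
    moreover have "(to_pairs (from_pairs p) - p) * to_pairs (from_pairs q) +
        p * (to_pairs (from_pairs q) - q) \<in> S"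
      by (rule S_closed(2)[OF S_mult(2)[OF p(2) to_pairs_carrier] S_mult(1)[OF q(2) p(1)]])
    moreover note free_alg_closed(1,2)[OF p(1) q(1)]
    ultimately show "p + q \<in> carrier C \<and> to_pairs (from_pairs (p + q)) - (p + q) \<in> S"
      "p * q \<in> carrier C \<and> to_pairs (from_pairs (p * q)) - p * q \<in> S"
      by (simp_all add: Q.ev_add Q.ev_mult algebra_simps del: free_alg_simps)
  next
    fix r p assume p: "p \<in> carrier C \<and> to_pairs (from_pairs p) - p \<in> S"
    then show "qscale r p \<in> carrier C \<and> to_pairs (from_pairs (qscale r p)) - qscale r p \<in> S"
      using S_closed(3)[of "to_pairs (from_pairs p) - p" r] free_alg_closed(5)[of p \<aa> r]
      by (simp add: Q.ev_qscale Q.scale_right_diff_distrib del: free_alg_simps)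
  qed
  then show ?thesis ..
qed

theorem kashiwara_cl_isomorphic:
  "kashiwara_cl sT A \<alpha> \<simeq>\<^sub>Q sridharan_algebra sc2 br2 \<aa> c"
  unfolding kashiwara_cl_def
proof (rule alg_isomorphic_quotI[OF ideal_K unital_algebra_free_alg ring_U])
  let ?h = "proj \<circ> to_pairs"
  have "to_pairs \<in> ring_hom (free_alg UNIV) C"
    by (rule ring_hom_memI) (simp_all only: to_pairs_carrier free_alg_simps(2,3,5) Q.ev_mult Q.ev_add Q.ev_one)
  then show "?h \<in> ring_hom (free_alg UNIV) U"
    using proj_hom by (rule ring_hom_trans)
  have "proj p \<in> ?h ` carrier (free_alg UNIV)" if p: "p \<in> carrier C" for p
  proof -
    interpret pr: ring_hom_ring C U proj
      by (rule ring_hom_ringI2[OF ring_free_alg ring_U proj_hom])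
    let ?d = "to_pairs (from_pairs p) - p"
    have d: "?d \<in> carrier C" "proj ?d = \<zero>\<^bsub>U\<^esub>"
      using to_pairs_from_pairs[OF p] unfolding sridharan_ideal_def by blast+
    have "proj (p + ?d) = proj p"
      using pr.hom_add[OF p d(1)] pr.hom_closed[OF p] by (simp only: free_alg_simps(5) d pr.S.r_zero)
    then have "?h (from_pairs p) = proj p" by simp
    then show ?thesis by (intro image_eqI[of _ _ "from_pairs p"]) simp_all
  qed
  then have "proj ` carrier C \<subseteq> ?h ` carrier (free_alg UNIV)" by (rule image_subsetI)
  moreover have "?h ` carrier (free_alg UNIV) \<subseteq> proj ` carrier C"
    unfolding image_comp[symmetric] by (rule image_mono) (intro image_subsetI to_pairs_carrier)
  ultimately show "?h ` carrier (free_alg UNIV) = carrier U"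
    unfolding proj_surj[symmetric] by (intro subset_antisym)
  show "?h x = \<zero>\<^bsub>U\<^esub> \<longleftrightarrow> x \<in> K" for x
  proof -
    have "?h x = \<zero>\<^bsub>U\<^esub> \<longleftrightarrow> to_pairs x \<in> S"
      unfolding sridharan_ideal_def mem_Collect_eq comp_apply using to_pairs_carrier by blast
    also have "\<dots> \<longleftrightarrow> x \<in> K"
    proof
      assume "to_pairs x \<in> S"
      from K_closed(5)[OF from_pairs_S[OF this] from_pairs_to_pairs[of x]]
      show "x \<in> K" by simp
    qed (rule to_pairs_K)
    finally show ?thesis .
  qed
  show "?h (r \<odot>\<^bsub>free_alg UNIV\<^esub> x) = r \<odot>\<^bsub>U\<^esub> ?h x" for r x
    by (simp only: free_alg_simps(6) comp_apply Q.ev_qscale proj_smult[OF to_pairs_carrier])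
qed

end

theorem proposition5:
  fixes sT :: "rat \<Rightarrow> 't::ab_group_add \<Rightarrow> 't"
    and A :: "'i::finite \<Rightarrow> 'i \<Rightarrow> int"
    and \<alpha> :: "'i \<Rightarrow> 't \<Rightarrow> rat"
    and hc :: "'i \<Rightarrow> 't"
    and sc :: "rat \<Rightarrow> 'g::ab_group_add \<Rightarrow> 'g"
    and br :: "'g \<Rightarrow> 'g \<Rightarrow> 'g"
    and e f :: "'i \<Rightarrow> 'g"
    and \<iota> :: "'t \<Rightarrow> 'g"
  assumes "symmetrizable_kac_moody_algebra sT A \<alpha> hc sc br e f \<iota>"
  shows "let \<aa> = pair_algebra sc br e f \<iota>; sc2 = prod_scale sc; br2 = prod_br br in
    (\<exists>c. two_cocycle sc2 br2 \<aa> c \<and> kashiwara_values e f \<iota> c) \<and>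
    (\<forall>c. two_cocycle sc2 br2 \<aa> c \<and> kashiwara_values e f \<iota> c \<longrightarrow>
       kashiwara_cl sT A \<alpha> \<simeq>\<^sub>Q sridharan_algebra sc2 br2 \<aa> c)"
proof -
  interpret symmetrizable_kac_moody_algebra sT A \<alpha> hc sc br e f \<iota> by (rule assms)
  have "kashiwara_cl sT A \<alpha> \<simeq>\<^sub>Q sridharan_algebra sc2 br2 \<aa> c"
    if "two_cocycle sc2 br2 \<aa> c" "kashiwara_values e f \<iota> c" for c
  proof -
    interpret kashiwara_cocycle sT A \<alpha> hc sc br e f \<iota> c
      by unfold_locales (fact that)+
    show ?thesis by (rule kashiwara_cl_isomorphic)
  qed
  then show ?thesis
    unfolding Let_def
    using two_cocycle_standard_cocycle kashiwara_values_standard_cocycle by blast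
qed

end
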